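(* Let $p\ge1$ and $\phi\in\mathbf{C}_{[0,1]}$, such that $n^{-2}L_{\phi,n}^p\sim_\lambda\xi_\phi^p$. Then $$\lim_{n\to+\infty}\ \sup_{k\in\mathcal{I}(p,n)}\left\{\frac{n}{k}\left|\sqrt{n^{-2}\lambda_{k,h}}-\sqrt{\xi_\phi^p}\left(\frac{k}{N+1}\right)\right|\right\}=0.$$
   Context: $\mathbb{N}^*=\{1,2,\dots\}$. $\mathbf{C}_{[0,1]}$ is the set of $\phi\in C^2([0,1])$ with $\phi'>0$ on $[0,1]$, with either $\phi''>0$ on $[0,1]$ or $\phi''<0$ on $[0,1]$, and with $\phi(0)=0$, $\phi(1)=1$. B-splines: for $n,p\in\mathbb{N}^*$ take the knots $t_0=\dots=t_p=0$, $t_{p+i}=i/n$ for $1\le i\le n-1$, $t_{p+n}=\dots=t_{2p+n}=1$. Put $N_j^0=\chi_{[t_j,t_{j+1})}$ and, for $1\le q\le p$, $N_j^q(t)=\frac{t-t_j}{t_{j+q}-t_j}N_j^{q-1}(t)+\frac{t_{j+q+1}-t}{t_{j+q+1}-t_{j+1}}N_{j+1}^{q-1}(t)$, a fraction with zero denominator being taken to be $0$. The degree-$p$ B-splines are $N_0^p,\dots,N_{n+p-1}^p$. Matrices: let $N=n+p-2$ and $h=1/n$. For $\phi\in\mathbf{C}_{[0,1]}$ let $M_{\phi,n}^p,K_{\phi,n}^p$ be the $N\times N$ matrices $(M_{\phi,n}^p)_{i,j}=\int_0^1|\phi'(x)|N_i^p(x)N_j^p(x)\,dx$, $(K_{\phi,n}^p)_{i,j}=\int_0^1\frac{1}{|\phi'(x)|}(N_i^p)'(x)(N_j^p)'(x)\,dx$,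 $1\le i,j\le N$, and let $L_{\phi,n}^p=(M_{\phi,n}^p)^{-1}K_{\phi,n}^p$. Its eigenvalues, counted with multiplicity and listed in nondecreasing order, are $\lambda_{1,h}\le\dots\le\lambda_{N,h}$. Symbol: the cardinal B-splines are $\mathcal{N}_0=\chi_{[0,1]}$, $\mathcal{N}_q(x)=\frac{x}{q}\mathcal{N}_{q-1}(x)+\frac{q+1-x}{q}\mathcal{N}_{q-1}(x-1)$ for $q\ge1$. For $\theta\in[0,\pi]$ let $f_p(\theta)=-\mathcal{N}_{2p+1}''(p+1)-2\sum_{k=1}^p\mathcal{N}_{2p+1}''(p+1-k)\cos(k\theta)$, $g_p(\theta)=\mathcal{N}_{2p+1}(p+1)+2\sum_{k=1}^p\mathcal{N}_{2p+1}(p+1-k)\cos(k\theta)$, $e_p=f_p/g_p$. Let $\omega_\phi^p(x,\theta)=e_p(\theta)/(\phi'(x))^2$ on $[0,1]\times[0,\pi]$. $Rg(\cdot)$ denotes the range (image) of a function and $\mu_2$ the Lebesgue measure on $\mathbb{R}^2$. The monotone rearrangement $\xi_\phi^p:[0,1]\to Rg(\omega_\phi^p)$ of $\omega_\phi^p$ is the extension to $[0,1]$ by continuity of $\xi_\phi^p(x)=\inf\{y\in Rg(\omega_\phi^p):\ \mu_2(\{\omega_\phi^p\le y\})>\pi x\}$, $x\in(0,1)$; $\sqrt{\xi_\phi^p}(x)=\sqrt{\xi_\phi^p(x)}$. Outliers: an eigenvalue $n^{-2}\lambda_{k,h}$ of $n^{-2}L_{\phi,n}^p$ is an outlier if it does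 not belong to $Rg(\omega_\phi^p)$ (which is also the essential range of $\omega_\phi^p$). $OUT(p,n)$ is the number of outliers and $\mathcal{I}(p,n)=\{1,\dots,N-OUT(p,n)\}$. The notation $n^{-2}L_{\phi,n}^p\sim_\lambda\xi_\phi^p$ means: for every continuous compactly supported $F:\mathbb{R}\to\mathbb{R}$, $\lim_{n\to\infty}\frac1N\sum_{k=1}^NF(n^{-2}\lambda_{k,h})=\int_0^1F(\xi_\phi^p(x))\,dx$. This is a known fact for every $\phi\in\mathbf{C}_{[0,1]}$.
   Formalization: The cardinal B-spline recursion starts from the indicator of [0,1) instead of [0,1]; with the closed interval the values at interior integers are doubled and the second derivatives defining f_p do not exist. *)

theory Defs
  imports
    "HOL-Analysis.Analysis"
    "Jordan_Normal_Form.Char_Poly"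
    "Jordan_Normal_Form.Gauss_Jordan_Elimination"
begin

subsection \<open>The class of reparametrizations\<close>

text \<open>Derivatives are taken relative to \<open>[0,1]\<close>, hence one-sided at the end points; the values
  of \<open>f\<close> outside \<open>[0,1]\<close> play no role.\<close>

definition deriv01 :: "(real \<Rightarrow> real) \<Rightarrow> real \<Rightarrow> real" where
  "deriv01 f x = vector_derivative f (at x within {0..1})"

definition C2_on01 :: "(real \<Rightarrow> real) \<Rightarrow> bool" where
  "C2_on01 f \<longleftrightarrow> f differentiable_on {0..1} \<and> deriv01 f differentiable_on {0..1} \<and>
     continuous_on {0..1} (deriv01 (deriv01 f))"

definition C01 :: "(real \<Rightarrow> real) set" where
  "C01 = {\<phi>. C2_on01 \<phi> \<and> (\<forall>x\<in>{0..1}. deriv01 \<phi> x > 0) \<and>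
     ((\<forall>x\<in>{0..1}. deriv01 (deriv01 \<phi>) x > 0) \<or> (\<forall>x\<in>{0..1}. deriv01 (deriv01 \<phi>) x < 0)) \<and>
     \<phi> 0 = 0 \<and> \<phi> 1 = 1}"

subsection \<open>B-splines and the matrices\<close>

text \<open>Only the knots with index \<open>j \<le> 2p+n\<close> are meaningful; the B-splines
  \<open>bspline n p p j\<close> with \<open>j \<le> n+p-1\<close> use no others.\<close>

definition knot :: "nat \<Rightarrow> nat \<Rightarrow> nat \<Rightarrow> real" where
  "knot n p j = (if j \<le> p then 0 else if j < p + n then real (j - p) / real n else 1)"

text \<open>\<open>bspline n p q j\<close> is $N_j^q$ for the knots of \<open>n\<close> and \<open>p\<close>.
  The convention that a fraction with zero denominator is zero is that of HOL division.\<close>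

fun bspline :: "nat \<Rightarrow> nat \<Rightarrow> nat \<Rightarrow> nat \<Rightarrow> real \<Rightarrow> real" where
  "bspline n p 0 j t = indicator {knot n p j ..< knot n p (j + 1)} t"
| "bspline n p (Suc q) j t =
     (t - knot n p j) / (knot n p (j + Suc q) - knot n p j) * bspline n p q j t
   + (knot n p (j + Suc q + 1) - t) / (knot n p (j + Suc q + 1) - knot n p (j + 1))
       * bspline n p q (j + 1) t"

definition sysdim :: "nat \<Rightarrow> nat \<Rightarrow> nat" where
  "sysdim p n = n + p - 2"

text \<open>Matrix entries are indexed from \<open>0\<close>, hence the shift by one. In the entries of \<open>K\<close> the
  derivative of a B-spline may fail to exist at the finitely many knots, which does not
  affect the integral.\<close>

definition M_mat :: "(real \<Rightarrow> real) \<Rightarrow> nat \<Rightarrow> nat \<Rightarrow> real Matrix.mat" where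
  "M_mat \<phi> p n = Matrix.mat (sysdim p n) (sysdim p n) (\<lambda>(i, j).
     integral {0..1} (\<lambda>x. \<bar>deriv01 \<phi> x\<bar> * bspline n p p (i + 1) x * bspline n p p (j + 1) x))"

definition K_mat :: "(real \<Rightarrow> real) \<Rightarrow> nat \<Rightarrow> nat \<Rightarrow> real Matrix.mat" where
  "K_mat \<phi> p n = Matrix.mat (sysdim p n) (sysdim p n) (\<lambda>(i, j).
     integral {0..1} (\<lambda>x. 1 / \<bar>deriv01 \<phi> x\<bar>
       * deriv (bspline n p p (i + 1)) x * deriv (bspline n p p (j + 1)) x))"

definition L_mat :: "(real \<Rightarrow> real) \<Rightarrow> nat \<Rightarrow> nat \<Rightarrow> real Matrix.mat" where
  "L_mat \<phi> p n = the (mat_inverse (M_mat \<phi> p n)) * K_mat \<phi> p n"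

text \<open>The real eigenvalues with algebraic multiplicity, in nondecreasing order. For
  \<open>L_mat \<phi> p n\<close> these are all the eigenvalues: \<open>M\<close> and \<open>K\<close> are symmetric and \<open>M\<close> is positive
  definite, so $M^{-1}K$ is diagonalizable over the reals.\<close>

definition eigenvalue_list :: "real Matrix.mat \<Rightarrow> real list" where
  "eigenvalue_list A = sorted_list_of_multiset (proots (char_poly A))"

text \<open>\<open>eigval \<phi> p n k\<close> is $\lambda_{k,h}$ with $h = 1/n$, for \<open>1 \<le> k \<le> sysdim p n\<close>.\<close>

definition eigval :: "(real \<Rightarrow> real) \<Rightarrow> nat \<Rightarrow> nat \<Rightarrow> nat \<Rightarrow> real" where
  "eigval \<phi> p n k = eigenvalue_list (L_mat \<phi> p n) ! (k - 1)"

subsection \<open>The symbol and its monotone rearrangement\<close>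

text \<open>The recursion has to start from the half-open interval for it to give the continuous
  cardinal B-splines: with the indicator of the closed interval \<open>[0,1]\<close>, which agrees almost
  everywhere, the values at interior integers would be doubled and the derivatives there would not
  exist.\<close>

fun cardinal_bspline :: "nat \<Rightarrow> real \<Rightarrow> real" where
  "cardinal_bspline 0 x = indicator {0..<1} x"
| "cardinal_bspline (Suc q) x =
     x / real (Suc q) * cardinal_bspline q x
   + (real (Suc q) + 1 - x) / real (Suc q) * cardinal_bspline q (x - 1)"

definition f_symb :: "nat \<Rightarrow> real \<Rightarrow> real" where
  "f_symb p \<theta> = - deriv (deriv (cardinal_bspline (2 * p + 1))) (real p + 1)
     - 2 * (\<Sum>k = 1..p. deriv (deriv (cardinal_bspline (2 * p + 1))) (real p + 1 - real k)
              * cos (real k * \<theta>))"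

definition g_symb :: "nat \<Rightarrow> real \<Rightarrow> real" where
  "g_symb p \<theta> = cardinal_bspline (2 * p + 1) (real p + 1)
     + 2 * (\<Sum>k = 1..p. cardinal_bspline (2 * p + 1) (real p + 1 - real k) * cos (real k * \<theta>))"

definition e_symb :: "nat \<Rightarrow> real \<Rightarrow> real" where
  "e_symb p \<theta> = f_symb p \<theta> / g_symb p \<theta>"

definition omega :: "(real \<Rightarrow> real) \<Rightarrow> nat \<Rightarrow> real \<times> real \<Rightarrow> real" where
  "omega \<phi> p = (\<lambda>(x, \<theta>). e_symb p \<theta> / (deriv01 \<phi> x)\<^sup>2)"

definition omega_dom :: "(real \<times> real) set" where
  "omega_dom = {0..1} \<times> {0..pi}"

definition Rg_omega :: "(real \<Rightarrow> real) \<Rightarrow> nat \<Rightarrow> real set" where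
  "Rg_omega \<phi> p = omega \<phi> p ` omega_dom"

definition xi_open :: "(real \<Rightarrow> real) \<Rightarrow> nat \<Rightarrow> real \<Rightarrow> real" where
  "xi_open \<phi> p x =
     Inf {y \<in> Rg_omega \<phi> p. measure lebesgue {z \<in> omega_dom. omega \<phi> p z \<le> y} > pi * x}"

definition xi :: "(real \<Rightarrow> real) \<Rightarrow> nat \<Rightarrow> real \<Rightarrow> real" where
  "xi \<phi> p x = (if x \<in> {0<..<1} then xi_open \<phi> p x
     else Lim (at x within {0<..<1}) (xi_open \<phi> p))"

subsection \<open>Spectral distribution and outliers\<close>

definition sim_lambda_xi :: "(real \<Rightarrow> real) \<Rightarrow> nat \<Rightarrow> bool" where
  "sim_lambda_xi \<phi> p \<longleftrightarrow>
     (\<forall>F :: real \<Rightarrow> real. continuous_on UNIV F \<and> compact (closure {y. F y \<noteq> 0}) \<longrightarrow>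
       (\<lambda>n. 1 / real (sysdim p n) * (\<Sum>k = 1..sysdim p n. F (eigval \<phi> p n k / (real n)\<^sup>2)))
         \<longlonglongrightarrow> integral {0..1} (\<lambda>x. F (xi \<phi> p x)))"

text \<open>Outliers are counted with multiplicity.\<close>

definition OUT :: "(real \<Rightarrow> real) \<Rightarrow> nat \<Rightarrow> nat \<Rightarrow> nat" where
  "OUT \<phi> p n = card {k \<in> {1..sysdim p n}. eigval \<phi> p n k / (real n)\<^sup>2 \<notin> Rg_omega \<phi> p}"

definition non_outlier_idx :: "(real \<Rightarrow> real) \<Rightarrow> nat \<Rightarrow> nat \<Rightarrow> nat set" where
  "non_outlier_idx \<phi> p n = {1..sysdim p n - OUT \<phi> p n}"

end

theory Submission
  imports Defs "Jordan_Normal_Form.Schur_Decomposition"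
begin

text \<open>In the variable \<open>y = \<phi> x\<close> the matrices \<open>M\<close> and \<open>K\<close> belong to a Galerkin method for \<open>- u'' = \<lambda> u\<close> on
  \<open>[0, 1]\<close> with zero boundary values, whose eigenvalues are \<open>(k \<pi>)\<^sup>2\<close>. Two regimes of the index have to be
  distinguished, because the factor \<open>n/k\<close> is large for small \<open>k\<close>.

  If \<open>k/n\<close> is small, then \<open>\<lambda>\<^sub>k\<close> is \<open>(k \<pi>)\<^sup>2\<close> up to a factor near \<open>1\<close>, for all large \<open>n\<close>. The bound
  \<open>(k \<pi>)\<^sup>2 \<le> \<lambda>\<^sub>k\<close> (\<open>eigval_ge_square\<close>) holds for all \<open>k\<close>: by the min-max principle it is enough that
  a spline vanishing at the \<open>k - 1\<close> points with \<open>\<phi> x = l/k\<close> has energy at least \<open>(k \<pi>)\<^sup>2\<close> times its mass, which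
  is the sharp Poincare inequality on each of the \<open>k\<close> intervals. The upper bound
  (\<open>eigval_le_square_eventually\<close>) tests the min-max principle with \<open>k\<close> splines of disjoint supports,
  each of them a spline version of one arch \<open>sin (\<pi> (\<phi> x - a)/(b - a))\<close> over an interval of length almost
  \<open>1/k\<close>. The splines have the values at the nodes as coefficients, and convexity shows that their energy
  exceeds that of the arch only by the variation of \<open>\<phi>'\<close> on the support of a B-spline.

  If \<open>k/n\<close> is bounded from below, then \<open>n/k\<close> is bounded, and the claim is the uniform convergence of the
  quantiles of the eigenvalues to \<open>\<xi>\<close> (\<open>quantile_lower\<close>, \<open>quantile_upper\<close>). It follows from the
  distribution of the eigenvalues because \<open>\<xi>\<close> is continuous with supremum \<open>max \<omega>\<close>. At the upper end the
  quantile argument fails, and there the exclusion of the outliers bounds the eigenvalues.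

  The two regimes also determine \<open>\<xi>\<close> near \<open>0\<close>: being the limit of quantiles that lie between \<open>(\<pi> k/n)\<^sup>2\<close> and
  \<open>(1 + \<eta>) (\<pi> k/n)\<^sup>2\<close>, it satisfies the same bounds with \<open>t\<close> in place of \<open>k/n\<close> (\<open>xi_ge_square\<close>,
  \<open>xi_le_square\<close>). Hence for small \<open>k/n\<close> both square roots, multiplied by \<open>n/k\<close>, are close to \<open>\<pi>\<close>.

  The symbol enters through the continuity of \<open>\<omega>\<close> alone, for which \<open>g\<^sub>p\<close> must not vanish
  (\<open>spline_symbol_pos\<close>). Continuity makes the range an interval and the distribution function of \<open>\<omega>\<close>
  strictly increasing on it, and this gives the continuity of \<open>\<xi>\<close>.\<close>


section \<open>Eigenvalues of a symmetric definite pencil\<close>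

text \<open>Over the complex numbers there is an eigenvector \<open>v\<close>, and moving the matrix from one side of
  \<open>v\<^sup>* S v\<close> to the other shows that its eigenvalue equals its own conjugate.\<close>

lemma symmetric_real_eigenvalue_exists:
  fixes S :: "real Matrix.mat"
  assumes S: "S \<in> carrier_mat n n" and sym: "transpose_mat S = S" and n: "n \<noteq> 0"
  shows "\<exists>e. eigenvalue S e"
proof -
  let ?C = "map_mat complex_of_real S"
  have C: "?C \<in> carrier_mat n n" using S by simp
  obtain as where as: "char_poly ?C = (\<Prod>a\<leftarrow>as. [:- a, 1:])" "length as = n"
    using char_poly_factorized[OF C] by blast
  then obtain z zs where "as = z # zs" using n by (cases as) auto
  then have z: "poly (char_poly ?C) z = 0" using as by simp
  then have "eigenvalue ?C z" using eigenvalue_root_char_poly[OF C] by simp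
  then obtain v where v: "v \<in> carrier_vec n" "v \<noteq> 0\<^sub>v n" "?C *\<^sub>v v = z \<cdot>\<^sub>v v"
    unfolding eigenvalue_def eigenvector_def using C by auto
  have cs: "transpose_mat ?C = ?C" using sym by (simp add: map_mat_transpose)
  have cv: "conjugate v \<in> carrier_vec n" using v by simp
  have Cv: "?C *\<^sub>v conjugate v = conjugate (?C *\<^sub>v v)"
    using v(1) S by (intro eq_vecI) (auto simp: scalar_prod_def)
  have "scalar_prod (conjugate v) (?C *\<^sub>v v) = scalar_prod (?C *\<^sub>v conjugate v) v"
    using transpose_vec_mult_scalar[OF C v(1) cv] cs by simp
  then have "z * scalar_prod (conjugate v) v = scalar_prod (conjugate (z \<cdot>\<^sub>v v)) v"
    using v cv Cv by simp
  also have "\<dots> = cnj z * scalar_prod (conjugate v) v"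
    using v cv by (simp add: conjugate_smult_vec)
  finally have eq: "z * scalar_prod (conjugate v) v = cnj z * scalar_prod (conjugate v) v" .
  have "scalar_prod v (conjugate v) \<noteq> 0"
    using conjugate_square_eq_0_vec[OF v(1)] v(2) by simp
  then have "scalar_prod (conjugate v) v \<noteq> 0"
    using comm_scalar_prod[OF v(1) cv] by simp
  then have "z = cnj z" using eq by simp
  then obtain r where r: "z = of_real r" by (metis Reals_cases Reals_cnj_iff)
  have "char_poly ?C = map_poly of_real (char_poly S)" using of_real_hom.char_poly_hom[OF S] .
  then have "complex_of_real (poly (char_poly S) r) = 0" using z r by simp
  then have "poly (char_poly S) r = 0" by simp
  then show ?thesis using eigenvalue_root_char_poly[OF S] by blast
qed

lemma four_block_mat_split_first:
  fixes A :: "'a :: zero Matrix.mat"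
  assumes A: "A \<in> carrier_mat (Suc n) (Suc n)"
    and c: "\<And>i. i \<le> n \<Longrightarrow> A $$ (i, 0) = (if i = 0 then e else 0)"
    and r: "\<And>i. i \<le> n \<Longrightarrow> A $$ (0, i) = (if i = 0 then e else 0)"
  shows "A = four_block_mat (Matrix.mat 1 1 (\<lambda>_. e)) (0\<^sub>m 1 n) (0\<^sub>m n 1)
    (Matrix.mat n n (\<lambda>(i, j). A $$ (Suc i, Suc j)))"
  using A c r by (intro eq_matI) (auto simp: less_Suc_eq_le)

text \<open>Gram-Schmidt applied to a basis that starts with \<open>v\<close>, with the resulting vectors normalised.\<close>

lemma orthogonal_mat_with_first_column:
  fixes v :: "real Matrix.vec"
  assumes v: "v \<in> carrier_vec n" and v0: "v \<noteq> 0\<^sub>v n" and n: "n \<noteq> 0"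
  shows "\<exists>W c. W \<in> carrier_mat n n \<and> transpose_mat W * W = 1\<^sub>m n \<and> Matrix.col W 0 = c \<cdot>\<^sub>v v"
proof -
  interpret cof_vec_space n "TYPE(real)" .
  define b where "b = basis_completion v"
  note bc = basis_completion[OF v v0, folded b_def]
  obtain vs where bv: "b = v # vs" using bc n by (cases b) auto
  define ws where "ws = gram_schmidt n b"
  have ws: "set ws \<subseteq> carrier_vec n" "corthogonal ws" "length ws = n"
    using gram_schmidt_result[OF bc(2,4,5) refl, folded ws_def] bc by auto
  have hd: "ws ! 0 = v"
    using gram_schmidt_hd[OF v, of vs, folded bv, folded ws_def] ws n by (cases ws) auto
  define c where "c i = 1 / sqrt (scalar_prod (ws ! i) (ws ! i))" for i
  define W where "W = mat_of_cols n (map (\<lambda>i. c i \<cdot>\<^sub>v (ws ! i)) [0..<n])"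
  have wsi: "ws ! i \<in> carrier_vec n" if "i < n" for i using that ws by auto
  have W: "W \<in> carrier_mat n n" unfolding W_def by auto
  have col: "Matrix.col W i = c i \<cdot>\<^sub>v (ws ! i)" if "i < n" for i
    unfolding W_def using that wsi by (subst col_mat_of_cols) auto
  have orth: "scalar_prod (ws ! i) (ws ! j) = 0 \<longleftrightarrow> i \<noteq> j" if "i < n" "j < n" for i j
    using ws(2,3) that unfolding corthogonal_def by auto
  have pos: "scalar_prod (ws ! i) (ws ! i) > 0" if "i < n" for i
  proof -
    have "scalar_prod (ws ! i) (ws ! i) \<ge> 0"
      unfolding scalar_prod_def by (intro sum_nonneg) simp
    then show ?thesis using orth[OF that that] by simp
  qed
  have "transpose_mat W * W = 1\<^sub>m n"
  proof (intro eq_matI)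
    fix i j assume "i < dim_row (1\<^sub>m n :: real Matrix.mat)" "j < dim_col (1\<^sub>m n :: real Matrix.mat)"
    then have ij: "i < n" "j < n" by auto
    have "(transpose_mat W * W) $$ (i, j) = scalar_prod (Matrix.col W i) (Matrix.col W j)"
      using ij W by simp
    also have "\<dots> = c i * (c j * scalar_prod (ws ! i) (ws ! j))"
      using wsi[OF ij(1)] wsi[OF ij(2)] col[OF ij(1)] col[OF ij(2)] by simp
    also have "\<dots> = 1\<^sub>m n $$ (i, j)"
    proof (cases "i = j")
      case True
      then show ?thesis using pos[OF ij(1)] ij by (simp add: c_def)
    next
      case False
      then have "scalar_prod (ws ! i) (ws ! j) = 0" using orth ij by blast
      then show ?thesis using False ij by simp
    qed
    finally show "(transpose_mat W * W) $$ (i, j) = 1\<^sub>m n $$ (i, j)" .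
  qed (use W in auto)
  moreover have "Matrix.col W 0 = c 0 \<cdot>\<^sub>v v" using col[of 0] n hd by simp
  ultimately show ?thesis using W by blast
qed

text \<open>Induction by deflation: in an orthonormal basis that starts with an eigenvector the first column
  of the matrix is a multiple of a unit vector, by symmetry so is the first row, and the remaining
  block is a smaller symmetric matrix.\<close>

lemma symmetric_real_orthogonal_diagonalization:
  fixes S :: "real Matrix.mat"
  assumes "S \<in> carrier_mat n n" and "transpose_mat S = S"
  shows "\<exists>P d. P \<in> carrier_mat n n \<and> transpose_mat P * P = 1\<^sub>m n \<and>
    transpose_mat P * S * P = mat_diag n d"
  using assms
proof (induction n arbitrary: S)
  case 0
  then show ?case by (intro exI[of _ "1\<^sub>m 0"]) (auto simp: mat_diag_def intro!: eq_matI)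
next
  case (Suc n)
  note S = Suc.prems(1) and sym = Suc.prems(2)
  obtain e v where v: "v \<in> carrier_vec (Suc n)" "v \<noteq> 0\<^sub>v (Suc n)" "S *\<^sub>v v = e \<cdot>\<^sub>v v"
    using symmetric_real_eigenvalue_exists[OF S sym] S unfolding eigenvalue_def eigenvector_def by auto
  obtain W c where W: "W \<in> carrier_mat (Suc n) (Suc n)" and WW: "transpose_mat W * W = 1\<^sub>m (Suc n)"
    and W0: "Matrix.col W 0 = c \<cdot>\<^sub>v v"
    using orthogonal_mat_with_first_column[OF v(1,2)] by auto
  define A where "A = transpose_mat W * S * W"
  have A: "A \<in> carrier_mat (Suc n) (Suc n)" using W S by (simp add: A_def)
  have Asym: "transpose_mat A = A"
    unfolding A_def using W S sym
    by (simp add: transpose_mult[of _ "Suc n" "Suc n" _ "Suc n"])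
  have SW0: "S *\<^sub>v Matrix.col W 0 = e \<cdot>\<^sub>v Matrix.col W 0"
    unfolding W0 using v S by (simp add: mult_mat_vec smult_smult_assoc mult.commute)
  have colA: "A $$ (i, 0) = (if i = 0 then e else 0)" if i: "i \<le> n" for i
  proof -
    have "A = transpose_mat W * (S * W)" using W S by (simp add: A_def)
    then have "A $$ (i, 0) = scalar_prod (Matrix.col W i) (S *\<^sub>v Matrix.col W 0)"
      using W S i col_mult2[OF S W, of 0] by simp
    also have "\<dots> = e * scalar_prod (Matrix.col W i) (Matrix.col W 0)"
      unfolding SW0 using W i by simp
    also have "scalar_prod (Matrix.col W i) (Matrix.col W 0) = (transpose_mat W * W) $$ (i, 0)"
      using W i by simp
    finally show ?thesis unfolding WW using i by simp
  qed
  have rowA: "A $$ (0, i) = (if i = 0 then e else 0)" if i: "i \<le> n" for i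
  proof -
    have "A $$ (0, i) = transpose_mat A $$ (0, i)" unfolding Asym ..
    also have "\<dots> = A $$ (i, 0)" using A i by simp
    finally show ?thesis using colA[OF i] by simp
  qed
  define A3 where "A3 = Matrix.mat n n (\<lambda>(i, j). A $$ (Suc i, Suc j))"
  have A3: "A3 \<in> carrier_mat n n" by (simp add: A3_def)
  have A3sym: "transpose_mat A3 = A3"
  proof (intro eq_matI)
    fix i j assume "i < dim_row A3" "j < dim_col A3"
    then have ij: "i < n" "j < n" using A3 by auto
    have "A $$ (Suc j, Suc i) = transpose_mat A $$ (Suc j, Suc i)" unfolding Asym ..
    then show "transpose_mat A3 $$ (i, j) = A3 $$ (i, j)"
      using ij A by (simp add: A3_def)
  qed (use A3 in auto)
  obtain Q d where Q: "Q \<in> carrier_mat n n" "transpose_mat Q * Q = 1\<^sub>m n"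
    "transpose_mat Q * A3 * Q = mat_diag n d"
    using Suc.IH[OF A3 A3sym] by blast
  define F where "F = four_block_mat (1\<^sub>m 1) (0\<^sub>m 1 n) (0\<^sub>m n 1) Q"
  have F: "F \<in> carrier_mat (Suc n) (Suc n)"
    unfolding F_def using four_block_carrier_mat[of "1\<^sub>m 1" 1 1 Q n n] Q by simp
  have FT: "transpose_mat F = four_block_mat (1\<^sub>m 1) (0\<^sub>m 1 n) (0\<^sub>m n 1) (transpose_mat Q)"
    unfolding F_def using Q by (subst transpose_four_block_mat[of _ 1 1 _ n _ n]) auto
  have FF: "transpose_mat F * F = 1\<^sub>m (Suc n)"
    unfolding FT unfolding F_def
    by (subst mult_four_block_mat[of _ 1 1 _ n _ n _ _ 1 _ n]) (use Q in auto)
  have Ablock: "A = four_block_mat (Matrix.mat 1 1 (\<lambda>_. e)) (0\<^sub>m 1 n) (0\<^sub>m n 1) A3"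
    unfolding A3_def by (rule four_block_mat_split_first[OF A colA rowA])
  have FA: "transpose_mat F * A = four_block_mat (Matrix.mat 1 1 (\<lambda>_. e)) (0\<^sub>m 1 n) (0\<^sub>m n 1) (transpose_mat Q * A3)"
    unfolding FT Ablock
    by (subst mult_four_block_mat[of _ 1 1 _ n _ n _ _ 1 _ n]) (use Q A3 in auto)
  have "transpose_mat F * A * F = four_block_mat (Matrix.mat 1 1 (\<lambda>_. e)) (0\<^sub>m 1 n) (0\<^sub>m n 1) (transpose_mat Q * A3 * Q)"
    unfolding FA unfolding F_def
    by (subst mult_four_block_mat[of _ 1 1 _ n _ n _ _ 1 _ n]) (use Q A3 in auto)
  also have "\<dots> = mat_diag (Suc n) (case_nat e d)"
    unfolding Q(3) by (intro eq_matI) (auto simp: mat_diag_def split: nat.splits)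
  finally have FAF: "transpose_mat F * A * F = mat_diag (Suc n) (case_nat e d)" .
  have PT: "transpose_mat (W * F) = transpose_mat F * transpose_mat W"
    using W F by (rule transpose_mult)
  have WT: "transpose_mat W \<in> carrier_mat (Suc n) (Suc n)"
    and FTc: "transpose_mat F \<in> carrier_mat (Suc n) (Suc n)" using W F by auto
  have "transpose_mat (W * F) * (W * F) = transpose_mat F * ((transpose_mat W * W) * F)"
    unfolding PT using W F WT FTc by (simp add: assoc_mult_mat[of _ "Suc n" "Suc n" _ "Suc n" _ "Suc n"])
  also have "\<dots> = 1\<^sub>m (Suc n)" unfolding WW using F FF by simp
  finally have 1: "transpose_mat (W * F) * (W * F) = 1\<^sub>m (Suc n)" .
  have 2: "transpose_mat (W * F) * S * (W * F) = transpose_mat F * A * F"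
    unfolding PT A_def using W F S WT FTc
    by (simp add: assoc_mult_mat[of _ "Suc n" "Suc n" _ "Suc n" _ "Suc n"])
  show ?case
    using 1 2 FAF W F by (intro exI[of _ "W * F"] exI[of _ "case_nat e d"]) auto
qed

abbreviation qform :: "real Matrix.mat \<Rightarrow> real Matrix.vec \<Rightarrow> real" where
  "qform A x \<equiv> scalar_prod x (A *\<^sub>v x)"

lemma quadratic_form_congruence:
  fixes A P :: "real Matrix.mat"
  assumes A: "A \<in> carrier_mat n n" and P: "P \<in> carrier_mat n m" and a: "a \<in> carrier_vec m"
  shows "qform A (P *\<^sub>v a) = qform (transpose_mat P * A * P) a"
proof -
  have Pa: "P *\<^sub>v a \<in> carrier_vec n" and APa: "A *\<^sub>v (P *\<^sub>v a) \<in> carrier_vec n" using A P a by auto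
  have PT: "transpose_mat P \<in> carrier_mat m n" using P by simp
  have "qform A (P *\<^sub>v a) = scalar_prod (A *\<^sub>v (P *\<^sub>v a)) (P *\<^sub>v a)"
    using comm_scalar_prod[OF Pa APa] .
  also have "\<dots> = scalar_prod (transpose_mat P *\<^sub>v (A *\<^sub>v (P *\<^sub>v a))) a"
    using transpose_vec_mult_scalar[OF P a APa] by simp
  also have "\<dots> = scalar_prod a (transpose_mat P *\<^sub>v (A *\<^sub>v (P *\<^sub>v a)))"
    using comm_scalar_prod[of _ m a] a PT APa by (metis mult_mat_vec_carrier)
  also have "transpose_mat P *\<^sub>v (A *\<^sub>v (P *\<^sub>v a)) = (transpose_mat P * A * P) *\<^sub>v a"
    using A P a PT by (simp add: assoc_mult_mat_vec[of _ m n _ m] assoc_mult_mat_vec[of _ m n _ n])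
  finally show ?thesis .
qed

lemma quadratic_form_diag:
  fixes a :: "real Matrix.vec"
  assumes a: "a \<in> carrier_vec n"
  shows "qform (mat_diag n d) a = (\<Sum>i<n. d i * (a $ i)\<^sup>2)"
proof -
  have "(mat_diag n d *\<^sub>v a) $ i = d i * a $ i" if "i < n" for i
  proof -
    have "(mat_diag n d *\<^sub>v a) $ i = (\<Sum>j = 0..<n. (if i = j then d j else 0) * a $ j)"
      using that a by (simp add: mat_diag_def scalar_prod_def)
    also have "\<dots> = (\<Sum>j = 0..<n. if i = j then d j * a $ j else 0)"
      by (intro sum.cong) auto
    also have "\<dots> = d i * a $ i" using that by simp
    finally show ?thesis .
  qed
  then show ?thesis
    unfolding scalar_prod_def using a
    by (auto simp: power2_eq_square lessThan_atLeast0 mat_diag_def intro!: sum.cong)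
qed

text \<open>Fewer equations than unknowns: padding the system with a zero row makes it square and singular.\<close>

lemma homogeneous_system_solution:
  fixes f :: "nat \<Rightarrow> nat \<Rightarrow> real"
  assumes "k \<ge> 1"
  shows "\<exists>a. a \<in> carrier_vec k \<and> a \<noteq> 0\<^sub>v k \<and> (\<forall>l<k-1. (\<Sum>i<k. f l i * a $ i) = 0)"
proof -
  define B where "B = Matrix.mat k k (\<lambda>(l, i). if l < k - 1 then f l i else 0)"
  have B: "B \<in> carrier_mat k k" by (simp add: B_def)
  have "Determinant.det B = 0"
  proof -
    have "Matrix.row B (k - 1) = 0\<^sub>v k" using assms by (intro eq_vecI) (auto simp: B_def)
    then have eq: "B = mat\<^sub>r k k (\<lambda>i. if i = k - 1 then 0\<^sub>v k else Matrix.row B i)"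
      using B by (intro eq_matI) (auto simp: B_def)
    show ?thesis by (subst eq, rule det_row_0) (use assms B in auto)
  qed
  then obtain a where a: "a \<in> carrier_vec k" "a \<noteq> 0\<^sub>v k" "B *\<^sub>v a = 0\<^sub>v k"
    using det_0_iff_vec_prod_zero[OF B] by blast
  have "(\<Sum>i<k. f l i * a $ i) = 0" if "l < k - 1" for l
  proof -
    have "(B *\<^sub>v a) $ l = (\<Sum>i<k. f l i * a $ i)"
      using that a(1) by (auto simp: B_def scalar_prod_def lessThan_atLeast0 intro!: sum.cong)
    then show ?thesis using a(3) that by simp
  qed
  then show ?thesis using a by blast
qed

text \<open>The eigenvalues of \<open>M\<^sup>-\<^sup>1 K\<close> are those of the pencil \<open>K - \<lambda> M\<close>, and with \<open>M\<close> positive definite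
  they obey the min-max principle for the quotient of the two quadratic forms, although
  \<open>M\<^sup>-\<^sup>1 K\<close> itself is not symmetric.\<close>

locale symmetric_pencil =
  fixes M K :: "real Matrix.mat" and N :: nat
  assumes M: "M \<in> carrier_mat N N" and K: "K \<in> carrier_mat N N"
    and M_sym: "transpose_mat M = M" and K_sym: "transpose_mat K = K"
    and M_pos: "\<And>x. x \<in> carrier_vec N \<Longrightarrow> x \<noteq> 0\<^sub>v N \<Longrightarrow> qform M x > 0"
begin

definition "evs = eigenvalue_list (the (mat_inverse M) * K)"

text \<open>Diagonalise \<open>M\<close> and rescale it to the identity; an orthogonal diagonalisation of the transformed
  \<open>K\<close> leaves the identity unchanged.\<close>

lemma simultaneous_diagonalization:
  "\<exists>P d. P \<in> carrier_mat N N \<and> transpose_mat P * M * P = 1\<^sub>m N \<and> transpose_mat P * K * P = mat_diag N d"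
proof -
  obtain P0 d0 where P0: "P0 \<in> carrier_mat N N" "transpose_mat P0 * P0 = 1\<^sub>m N"
      "transpose_mat P0 * M * P0 = mat_diag N d0"
    using symmetric_real_orthogonal_diagonalization[OF M M_sym] by blast
  have d0: "d0 i > 0" if i: "i < N" for i
  proof -
    have u: "unit_vec N i \<in> carrier_vec N" by simp
    have "P0 *\<^sub>v unit_vec N i \<noteq> 0\<^sub>v N"
    proof
      assume 0: "P0 *\<^sub>v unit_vec N i = 0\<^sub>v N"
      have "unit_vec N i = (transpose_mat P0 * P0) *\<^sub>v unit_vec N i" using P0(2) by simp
      also have "\<dots> = transpose_mat P0 *\<^sub>v (P0 *\<^sub>v unit_vec N i)"
        using P0(1) by (intro assoc_mult_mat_vec) auto
      also have "\<dots> = 0\<^sub>v N" unfolding 0 using P0(1) by (intro eq_vecI) auto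
      finally have "unit_vec N i = (0\<^sub>v N :: real Matrix.vec)" .
      then have "unit_vec N i $ i = (0\<^sub>v N :: real Matrix.vec) $ i" by simp
      then show False using i by simp
    qed
    then have "0 < qform M (P0 *\<^sub>v unit_vec N i)"
      using M_pos P0(1) by simp
    also have "\<dots> = (\<Sum>j<N. d0 j * (unit_vec N i $ j)\<^sup>2)"
      unfolding quadratic_form_congruence[OF M P0(1) u] P0(3) using quadratic_form_diag[OF u] .
    also have "\<dots> = (\<Sum>j<N. if j = i then d0 j else 0)" using i by (intro sum.cong) auto
    also have "\<dots> = d0 i" using i by simp
    finally show ?thesis .
  qed
  define E where "E = mat_diag N (\<lambda>i. 1 / sqrt (d0 i))"
  define R where "R = P0 * E"
  have E: "E \<in> carrier_mat N N" by (simp add: E_def)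
  have ET: "transpose_mat E = E" unfolding E_def mat_diag_def by (intro eq_matI) auto
  have R: "R \<in> carrier_mat N N" using P0(1) E by (simp add: R_def)
  have RT: "transpose_mat R = E * transpose_mat P0"
    unfolding R_def using P0(1) E ET by (simp add: transpose_mult[of _ N N _ N])
  note assoc = assoc_mult_mat[of _ N N _ N _ N] mult_carrier_mat[of _ N N _ N]
  have "transpose_mat R * M * R = E * (transpose_mat P0 * M * P0) * E"
    unfolding RT unfolding R_def using P0(1) E M by (simp add: assoc)
  also have "\<dots> = mat_diag N (\<lambda>i. 1 / sqrt (d0 i) * d0 i * (1 / sqrt (d0 i)))"
    unfolding P0(3) E_def by simp
  also have "\<dots> = 1\<^sub>m N"
  proof -
    have "1 / sqrt (d0 i) * d0 i * (1 / sqrt (d0 i)) = 1" if "i < N" for i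
      using d0[OF that] by (simp add: field_simps)
    then show ?thesis by (intro eq_matI) (auto simp: mat_diag_def)
  qed
  finally have RMR: "transpose_mat R * M * R = 1\<^sub>m N" .
  define S where "S = transpose_mat R * K * R"
  have S: "S \<in> carrier_mat N N" using R K by (simp add: S_def)
  have "transpose_mat S = S"
    unfolding S_def using R K K_sym by (simp add: transpose_mult[of _ N N _ N] assoc)
  then obtain P1 d where P1: "P1 \<in> carrier_mat N N" "transpose_mat P1 * P1 = 1\<^sub>m N"
      "transpose_mat P1 * S * P1 = mat_diag N d"
    using symmetric_real_orthogonal_diagonalization[OF S] by blast
  have T: "transpose_mat (R * P1) = transpose_mat P1 * transpose_mat R"
    using R P1(1) by (rule transpose_mult)
  have "transpose_mat (R * P1) * M * (R * P1) = transpose_mat P1 * (transpose_mat R * M * R) * P1"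
    unfolding T using R P1(1) M by (simp add: assoc)
  also have "\<dots> = 1\<^sub>m N" unfolding RMR using P1 by simp
  finally have 1: "transpose_mat (R * P1) * M * (R * P1) = 1\<^sub>m N" .
  have 2: "transpose_mat (R * P1) * K * (R * P1) = mat_diag N d"
    unfolding T P1(3)[symmetric] S_def using R P1(1) K by (simp add: assoc)
  show ?thesis using 1 2 R P1(1) by (intro exI[of _ "R * P1"] exI[of _ d]) simp
qed

text \<open>The inverse of \<open>P\<close> is \<open>P\<^sup>T M\<close>, so that \<open>M\<^sup>-\<^sup>1 K = P D P\<^sup>-\<^sup>1\<close> with the diagonal matrix \<open>D\<close> of the numbers
  \<open>d\<close>; the characteristic polynomial is the one of \<open>D\<close>.\<close>

lemma evs_of_diagonalization:
  assumes P: "P \<in> carrier_mat N N" and PM: "transpose_mat P * M * P = 1\<^sub>m N"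
    and PK: "transpose_mat P * K * P = mat_diag N d"
  shows "evs = sort (map d [0..<N])"
proof -
  note assoc = assoc_mult_mat[of _ N N _ N _ N] mult_carrier_mat[of _ N N _ N]
  have PT: "transpose_mat P \<in> carrier_mat N N" using P by simp
  have 1: "P * (transpose_mat P * M) = 1\<^sub>m N"
    by (rule mat_mult_left_right_inverse) (use P PT M PM in auto)
  have "transpose_mat P * (M * P) = 1\<^sub>m N" using P PT M PM by (simp add: assoc)
  then have "(M * P) * transpose_mat P = 1\<^sub>m N"
    by (rule mat_mult_left_right_inverse[OF PT mult_carrier_mat[OF M P]])
  then have 2: "M * (P * transpose_mat P) = 1\<^sub>m N" using P PT M by (simp add: assoc)
  then have 3: "(P * transpose_mat P) * M = 1\<^sub>m N"
    by (rule mat_mult_left_right_inverse[OF M mult_carrier_mat[OF P PT]])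
  have "M \<in> Units (ring_mat TYPE(real) N ())"
    unfolding Units_def using 2 3 M P PT by (auto simp: ring_mat_simps intro!: bexI[of _ "P * transpose_mat P"])
  then obtain B where B: "mat_inverse M = Some B"
    using mat_inverse(1)[OF M, where b = "()"] by (cases "mat_inverse M") auto
  have BM: "B * M = 1\<^sub>m N" and Bc: "B \<in> carrier_mat N N" using mat_inverse(2)[OF M B] by auto
  have "B = B * (M * (P * transpose_mat P))" using 2 Bc by simp
  also have "\<dots> = (B * M) * (P * transpose_mat P)" using Bc M P PT by (simp add: assoc)
  also have "\<dots> = P * transpose_mat P" unfolding BM using P PT by simp
  finally have Beq: "B = P * transpose_mat P" .
  have "K = (M * (P * transpose_mat P)) * K * (P * (transpose_mat P * M))"
    using 1 2 K by simp
  also have "\<dots> = M * P * (transpose_mat P * K * P) * (transpose_mat P * M)"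
    using M K P PT by (simp add: assoc)
  finally have Keq: "K = M * P * mat_diag N d * (transpose_mat P * M)" unfolding PK .
  have D: "mat_diag N d \<in> carrier_mat N N" by simp
  have "B * K = P * (transpose_mat P * M * P) * mat_diag N d * (transpose_mat P * M)"
    unfolding Beq by (subst Keq) (use M P PT D in \<open>simp add: assoc\<close>)
  then have L: "B * K = P * mat_diag N d * (transpose_mat P * M)"
    unfolding PM using P by simp
  have "similar_mat (B * K) (mat_diag N d)"
    by (rule similar_matI[of _ _ P "transpose_mat P * M" N])
      (use L P PT M D 1 PM Bc K in \<open>simp_all add: assoc\<close>)
  then have "char_poly (B * K) = char_poly (mat_diag N d)" by (rule char_poly_similar)
  also have "\<dots> = (\<Prod>a\<leftarrow>diag_mat (mat_diag N d). [:- a, 1:])"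
    by (rule char_poly_upper_triangular[OF D]) (auto simp: mat_diag_def)
  also have "diag_mat (mat_diag N d) = map d [0..<N]"
    by (auto simp: diag_mat_def mat_diag_def)
  finally have cp: "char_poly (B * K) = (\<Prod>a\<leftarrow>map d [0..<N]. [:- a, 1:])" .
  have "proots (\<Prod>a\<leftarrow>xs. [:- a, 1:]) = mset xs" for xs :: "real list"
  proof (induction xs)
    case (Cons x xs)
    have "(\<Prod>a\<leftarrow>xs. [:- a, 1:]) \<noteq> 0" by (auto simp: prod_list_zero_iff)
    then show ?case using Cons by (simp add: proots_mult del: mult_pCons_left)
  qed simp
  then show ?thesis
    unfolding evs_def eigenvalue_list_def B by (simp only: cp option.sel sorted_list_of_multiset_mset)
qed

text \<open>Permuting the columns of \<open>P\<close> sorts the diagonal.\<close>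

lemma sorted_diagonalization:
  "length evs = N \<and> sorted evs \<and> (\<exists>P. P \<in> carrier_mat N N \<and> transpose_mat P * M * P = 1\<^sub>m N \<and>
     transpose_mat P * K * P = mat_diag N (\<lambda>i. evs ! i))"
proof -
  obtain P d where P: "P \<in> carrier_mat N N" "transpose_mat P * M * P = 1\<^sub>m N"
      "transpose_mat P * K * P = mat_diag N d"
    using simultaneous_diagonalization by blast
  have evs: "evs = sort (map d [0..<N])" by (rule evs_of_diagonalization[OF P])
  have "mset (map d [0..<N]) = mset evs" unfolding evs by simp
  then obtain p where p: "p permutes {..<N}" "permute_list p (map d [0..<N]) = evs"
    by (metis mset_eq_permutation length_map length_upt minus_nat.diff_0)
  have pN: "p i < N" if "i < N" for i using permutes_in_image[OF p(1), of i] that by simp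
  have evi: "evs ! i = d (p i)" if "i < N" for i
    unfolding p(2)[symmetric] using that p(1) pN by (subst permute_list_nth) auto
  have inj: "p i = p j \<longleftrightarrow> i = j" for i j using permutes_inj[OF p(1)] by (auto dest: injD)
  define R where "R = Matrix.mat N N (\<lambda>(i, j). P $$ (i, p j))"
  have R: "R \<in> carrier_mat N N" by (simp add: R_def)
  have col: "Matrix.col R j = Matrix.col P (p j)" if "j < N" for j
    using that pN P(1) by (intro eq_vecI) (auto simp: R_def)
  have cong: "(transpose_mat R * A * R) $$ (i, j) = (transpose_mat P * A * P) $$ (p i, p j)"
    if A: "A \<in> carrier_mat N N" and ij: "i < N" "j < N" for A i j
  proof -
    have *: "(transpose_mat Q * A * Q) $$ (i, j) = scalar_prod (Matrix.col Q i) (A *\<^sub>v Matrix.col Q j)"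
      if Q: "Q \<in> carrier_mat N N" and ij: "i < N" "j < N" for i j and Q :: "real Matrix.mat"
    proof -
      have "transpose_mat Q * A * Q = transpose_mat Q * (A * Q)" using Q A by simp
      then show ?thesis using Q A ij col_mult2[OF A Q, of j] by simp
    qed
    show ?thesis using *[OF R ij] *[OF P(1), of "p i" "p j"] col ij pN by simp
  qed
  have 1: "transpose_mat R * M * R = 1\<^sub>m N"
    by (intro eq_matI) (use R M cong[OF M] P(2) pN inj in auto)
  have 2: "transpose_mat R * K * R = mat_diag N (\<lambda>i. evs ! i)"
    by (intro eq_matI) (use R K cong[OF K] P(3) pN inj evi in \<open>auto simp: mat_diag_def\<close>)
  show ?thesis using 1 2 R evs by auto
qed

text \<open>First half of the min-max principle. The span of the first \<open>k\<close> eigenvectors, on which the quotient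
  of the forms is at most the \<open>k\<close>-th eigenvalue, contains a nonzero vector that satisfies \<open>k - 1\<close>
  given linear conditions.\<close>

lemma eigenvalue_ge:
  assumes k: "1 \<le> k" "k \<le> N"
    and l: "\<And>l. l < k - 1 \<Longrightarrow> f l \<in> carrier_vec N"
    and R: "\<And>x. x \<in> carrier_vec N \<Longrightarrow> (\<And>l. l < k - 1 \<Longrightarrow> scalar_prod (f l) x = 0) \<Longrightarrow>
      \<mu> * qform M x \<le> qform K x"
  shows "\<mu> \<le> evs ! (k - 1)"
proof -
  obtain P where P: "P \<in> carrier_mat N N" "transpose_mat P * M * P = 1\<^sub>m N"
     "transpose_mat P * K * P = mat_diag N (\<lambda>i. evs ! i)" and s: "sorted evs" "length evs = N"
    using sorted_diagonalization by blast
  obtain a where a: "a \<in> carrier_vec k" "a \<noteq> 0\<^sub>v k"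
    "\<And>l. l < k - 1 \<Longrightarrow> (\<Sum>i<k. scalar_prod (f l) (Matrix.col P i) * a $ i) = 0"
    using homogeneous_system_solution[OF k(1), of "\<lambda>l i. scalar_prod (f l) (Matrix.col P i)"] by blast
  define b where "b = Matrix.vec N (\<lambda>i. if i < k then a $ i else 0)"
  have b: "b \<in> carrier_vec N" by (simp add: b_def)
  have x: "P *\<^sub>v b \<in> carrier_vec N" using P b by simp
  have "scalar_prod (f l) (P *\<^sub>v b) = 0" if ll: "l < k - 1" for l
  proof -
    have PT: "transpose_mat P \<in> carrier_mat N N" using P by simp
    have "scalar_prod (f l) (P *\<^sub>v b) = scalar_prod (transpose_mat P *\<^sub>v f l) b"
      using transpose_vec_mult_scalar[OF P(1) b l[OF ll]] by simp
    also have "\<dots> = (\<Sum>i<N. scalar_prod (Matrix.col P i) (f l) * b $ i)"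
      using P(1) b l[OF ll] by (simp add: scalar_prod_def[of "transpose_mat P *\<^sub>v f l"] lessThan_atLeast0)
    also have "\<dots> = (\<Sum>i<N. if i < k then scalar_prod (f l) (Matrix.col P i) * a $ i else 0)"
      using P(1) l[OF ll] by (intro sum.cong) (auto simp: b_def intro!: comm_scalar_prod[of _ N])
    also have "\<dots> = (\<Sum>i<k. scalar_prod (f l) (Matrix.col P i) * a $ i)"
      using k by (intro sum.mono_neutral_cong_right) auto
    finally show ?thesis using a(3)[OF ll] by simp
  qed
  then have "\<mu> * qform M (P *\<^sub>v b) \<le> qform K (P *\<^sub>v b)"
    using R[OF x] by blast
  moreover have "qform M (P *\<^sub>v b) = (\<Sum>i<N. (b $ i)\<^sup>2)"
    unfolding quadratic_form_congruence[OF M P(1) b] P(2)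
    using quadratic_form_diag[OF b, of "\<lambda>_. 1"] by simp
  moreover have "qform K (P *\<^sub>v b) = (\<Sum>i<N. evs ! i * (b $ i)\<^sup>2)"
    unfolding quadratic_form_congruence[OF K P(1) b] P(3)
    using quadratic_form_diag[OF b] by simp
  moreover have "(\<Sum>i<N. evs ! i * (b $ i)\<^sup>2) \<le> (\<Sum>i<N. evs ! (k - 1) * (b $ i)\<^sup>2)"
  proof (rule sum_mono)
    fix i assume i: "i \<in> {..<N}"
    show "evs ! i * (b $ i)\<^sup>2 \<le> evs ! (k - 1) * (b $ i)\<^sup>2"
    proof (cases "i < k")
      case True
      then have "evs ! i \<le> evs ! (k - 1)" using sorted_nth_mono[OF s(1), of i "k - 1"] k s by simp
      then show ?thesis by (rule mult_right_mono) simp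
    qed (use i in \<open>simp add: b_def\<close>)
  qed
  moreover have "0 < (\<Sum>i<N. (b $ i)\<^sup>2)"
  proof -
    obtain i where "i < k" "a $ i \<noteq> 0" using a(1,2) by (metis eq_vecI carrier_vecD index_zero_vec)
    then have "i < N" "b $ i \<noteq> 0" using k by (auto simp: b_def)
    then show ?thesis by (intro sum_pos2[of _ i]) auto
  qed
  ultimately have "\<mu> * (\<Sum>i<N. (b $ i)\<^sup>2) \<le> evs ! (k - 1) * (\<Sum>i<N. (b $ i)\<^sup>2)"
    by (simp add: sum_distrib_left)
  with \<open>0 < (\<Sum>i<N. (b $ i)\<^sup>2)\<close> show ?thesis by simp
qed

text \<open>Second half of the min-max principle. A \<open>k\<close>-dimensional space contains a nonzero vector without
  components along the first \<open>k - 1\<close> eigenvectors, and there the quotient is at least the \<open>k\<close>-th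
  eigenvalue.\<close>

lemma eigenvalue_le:
  assumes k: "1 \<le> k" "k \<le> N" and W: "W \<in> carrier_mat N k"
    and R: "\<And>a. a \<in> carrier_vec k \<Longrightarrow> a \<noteq> 0\<^sub>v k \<Longrightarrow>
      0 < qform M (W *\<^sub>v a) \<and>
      qform K (W *\<^sub>v a) \<le> \<mu> * qform M (W *\<^sub>v a)"
  shows "evs ! (k - 1) \<le> \<mu>"
proof -
  obtain P where P: "P \<in> carrier_mat N N" "transpose_mat P * M * P = 1\<^sub>m N"
     "transpose_mat P * K * P = mat_diag N (\<lambda>i. evs ! i)" and s: "sorted evs" "length evs = N"
    using sorted_diagonalization by blast
  define Q where "Q = transpose_mat P * M"
  have Q: "Q \<in> carrier_mat N N" using P M by (simp add: Q_def)
  have PQ: "P * Q = 1\<^sub>m N"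
    by (rule mat_mult_left_right_inverse) (use P Q in \<open>auto simp: Q_def\<close>)
  have QW: "Q * W \<in> carrier_mat N k" using Q W by simp
  obtain a where a: "a \<in> carrier_vec k" "a \<noteq> 0\<^sub>v k"
    "\<And>l. l < k - 1 \<Longrightarrow> (\<Sum>i<k. (Q * W) $$ (l, i) * a $ i) = 0"
    using homogeneous_system_solution[OF k(1), of "\<lambda>l i. (Q * W) $$ (l, i)"] by blast
  define b where "b = (Q * W) *\<^sub>v a"
  have b: "b \<in> carrier_vec N" using QW a by (simp add: b_def)
  have b0: "b $ l = 0" if "l < k - 1" for l
  proof -
    have "l < N" using that k by simp
    define QW' where "QW' = Q * W"
    have QW': "QW' \<in> carrier_mat N k" using QW by (simp add: QW'_def)
    have "b $ l = (\<Sum>i<k. QW' $$ (l, i) * a $ i)"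
      unfolding b_def QW'_def[symmetric] using \<open>l < N\<close> a(1) QW'
      by (auto simp: scalar_prod_def lessThan_atLeast0 intro!: sum.cong)
    then show ?thesis using a(3)[OF that] by (simp only: QW'_def)
  qed
  have Pb: "P *\<^sub>v b = W *\<^sub>v a"
  proof -
    have "P *\<^sub>v b = P *\<^sub>v (Q *\<^sub>v (W *\<^sub>v a))" unfolding b_def using Q W a by simp
    also have "\<dots> = (P * Q) *\<^sub>v (W *\<^sub>v a)" using P(1) Q W a by (intro assoc_mult_mat_vec[symmetric]) auto
    finally show ?thesis unfolding PQ using W a by simp
  qed
  have m: "qform M (P *\<^sub>v b) = (\<Sum>i<N. (b $ i)\<^sup>2)"
    unfolding quadratic_form_congruence[OF M P(1) b] P(2)
    using quadratic_form_diag[OF b, of "\<lambda>_. 1"] by simp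
  have kk: "qform K (P *\<^sub>v b) = (\<Sum>i<N. evs ! i * (b $ i)\<^sup>2)"
    unfolding quadratic_form_congruence[OF K P(1) b] P(3)
    using quadratic_form_diag[OF b] by simp
  have "(\<Sum>i<N. evs ! (k - 1) * (b $ i)\<^sup>2) \<le> (\<Sum>i<N. evs ! i * (b $ i)\<^sup>2)"
  proof (rule sum_mono)
    fix i assume i: "i \<in> {..<N}"
    show "evs ! (k - 1) * (b $ i)\<^sup>2 \<le> evs ! i * (b $ i)\<^sup>2"
    proof (cases "i < k - 1")
      case False
      then have "evs ! (k - 1) \<le> evs ! i" using sorted_nth_mono[OF s(1), of "k - 1" i] i s by simp
      then show ?thesis by (rule mult_right_mono) simp
    qed (use b0 in simp)
  qed
  also have "\<dots> \<le> \<mu> * (\<Sum>i<N. (b $ i)\<^sup>2)" using R[OF a(1,2)] m kk Pb by simp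
  finally have "evs ! (k - 1) * (\<Sum>i<N. (b $ i)\<^sup>2) \<le> \<mu> * (\<Sum>i<N. (b $ i)\<^sup>2)"
    by (simp add: sum_distrib_left)
  moreover have "0 < (\<Sum>i<N. (b $ i)\<^sup>2)" using R[OF a(1,2)] m Pb by simp
  ultimately show ?thesis by simp
qed

end

section \<open>Cardinal B-splines\<close>

lemma cardinal_bspline_support:
  "x < 0 \<or> real q + 1 \<le> x \<Longrightarrow> cardinal_bspline q x = 0"
  by (induction q arbitrary: x) auto

lemma cardinal_bspline_nonneg: "0 \<le> cardinal_bspline q x"
proof (induction q arbitrary: x)
  case (Suc q)
  show ?case
  proof (cases "x < 0 \<or> real (Suc q) + 1 \<le> x")
    case False
    then show ?thesis using Suc by (auto intro!: add_nonneg_nonneg mult_nonneg_nonneg)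
  qed (simp add: cardinal_bspline_support del: cardinal_bspline.simps)
qed simp

lemma cardinal_bspline_Suc:
  "(real q + 1) * cardinal_bspline (Suc q) x =
    x * cardinal_bspline q x + (real q + 2 - x) * cardinal_bspline q (x - 1)"
proof -
  define Q where "Q = real (Suc q)"
  have Q: "Q \<noteq> 0" "real q + 1 = Q" "real q + 2 = Q + 1" by (auto simp: Q_def)
  show ?thesis unfolding cardinal_bspline.simps(2) Q Q_def[symmetric] using Q(1) by (simp add: distrib_left)
qed

lemma cardinal_bspline_1: "cardinal_bspline 1 x = max 0 (1 - \<bar>x - 1\<bar>)"
  by (auto simp: indicator_def max_def abs_if)

lemma cardinal_bspline_symmetric:
  assumes "q \<ge> 1"
  shows "cardinal_bspline q (real q + 1 - x) = cardinal_bspline q x"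
  using assms
proof (induction q arbitrary: x rule: dec_induct)
  case base
  show ?case unfolding cardinal_bspline_1 by simp
next
  case (step q)
  have "cardinal_bspline q (real (Suc q) + 1 - x) = cardinal_bspline q (x - 1)"
    using step.IH[of "x - 1"] by (simp add: algebra_simps)
  moreover have "cardinal_bspline q (real (Suc q) + 1 - x - 1) = cardinal_bspline q x"
    using step.IH[of x] by (simp add: algebra_simps)
  ultimately show ?case by (simp add: algebra_simps)
qed

lemma continuous_on_cardinal_bspline:
  assumes "q \<ge> 1"
  shows "continuous_on UNIV (cardinal_bspline q)"
  using assms
proof (induction q rule: dec_induct)
  case base
  have "cardinal_bspline 1 = (\<lambda>x. max 0 (1 - \<bar>x - 1\<bar>))" by (intro ext cardinal_bspline_1)
  then show ?case by (auto intro!: continuous_intros)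
next
  case (step q)
  have "cardinal_bspline (Suc q) = (\<lambda>x. x / real (Suc q) * cardinal_bspline q x
      + (real (Suc q) + 1 - x) / real (Suc q) * cardinal_bspline q (x - 1))"
    by (intro ext) simp
  moreover have "continuous_on UNIV (\<lambda>x. cardinal_bspline q (x - 1))"
    by (rule continuous_on_compose2[OF step.IH]) (auto intro!: continuous_intros)
  ultimately show ?case using step.IH by (auto intro!: continuous_intros)
qed

text \<open>Shifting the second half of the recursion by one turns the two weights on each
  translate into \<open>(x - r)/q\<close> and \<open>(q - x + r)/q\<close>, which add up to one; the condition on \<open>x\<close>
  makes the two unmatched end terms vanish.\<close>

lemma cardinal_bspline_partition_of_unity:
  assumes "real q \<le> x" "x < real m"
  shows "(\<Sum>r<m. cardinal_bspline q (x - real r)) = 1"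
  using assms
proof (induction q)
  case 0
  have "(\<Sum>r<m. cardinal_bspline 0 (x - real r)) = (\<Sum>r<m. if r = nat \<lfloor>x\<rfloor> then 1 else 0)"
    using 0 by (intro sum.cong) (auto simp: indicator_def floor_eq_iff nat_eq_iff le_nat_iff less_eq_real_def, linarith+)
  also have "\<dots> = 1" using 0 by (auto simp: nat_less_iff floor_less_iff)
  finally show ?case .
next
  case (Suc q)
  define f where "f r = cardinal_bspline q (x - real r)" for r
  have IH: "(\<Sum>r<m. f r) = 1" unfolding f_def using Suc by simp
  have f0: "f 0 = 0" unfolding f_def using Suc.prems by (intro cardinal_bspline_support) auto
  have fm: "f m = 0" unfolding f_def using Suc.prems by (intro cardinal_bspline_support) auto
  have "(\<Sum>r<m. cardinal_bspline (Suc q) (x - real r)) =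
      (\<Sum>r<m. (x - real r) / real (Suc q) * f r)
      + (\<Sum>r<m. (real (Suc q) - x + real (Suc r)) / real (Suc q) * f (Suc r))"
    unfolding sum.distrib[symmetric]
    by (intro sum.cong) (auto simp: f_def algebra_simps)
  also have "(\<Sum>r<m. (real (Suc q) - x + real (Suc r)) / real (Suc q) * f (Suc r))
     = (\<Sum>r<m. (real (Suc q) - x + real r) / real (Suc q) * f r)"
    using sum.lessThan_Suc_shift[of "\<lambda>r. (real (Suc q) - x + real r) / real (Suc q) * f r" m]
      sum.lessThan_Suc[of "\<lambda>r. (real (Suc q) - x + real r) / real (Suc q) * f r" m] f0 fm by simp
  also have "(\<Sum>r<m. (x - real r) / real (Suc q) * f r) + \<dots> = (\<Sum>r<m. f r)"
    unfolding sum.distrib[symmetric]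
  proof (intro sum.cong refl)
    fix r
    have "(x - real r) / real (Suc q) + (real (Suc q) - x + real r) / real (Suc q) = 1"
      by (simp add: add_divide_distrib[symmetric] del: of_nat_Suc)
    then show "(x - real r) / real (Suc q) * f r + (real (Suc q) - x + real r) / real (Suc q) * f r = f r"
      by (metis distrib_right mult_1)
  qed
  finally show ?case using IH by simp
qed

text \<open>Moving the argument to the right by \<open>q\<close> and adding further translates gives the full partition of
  unity, and all terms are nonnegative.\<close>

lemma cardinal_bspline_translates_le_1:
  "(\<Sum>r<m. cardinal_bspline q (x - real r)) \<le> 1"
proof (cases "x < 0")
  case True
  then have "(\<Sum>r<m. cardinal_bspline q (x - real r)) = 0"
    by (intro sum.neutral ballI cardinal_bspline_support) auto
  then show ?thesis by simp
next
  case False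
  define M where "M = m + q + nat \<lceil>x\<rceil> + 1"
  have "(\<Sum>r<m. cardinal_bspline q (x - real r)) = (\<Sum>r\<in>(\<lambda>r. r + q) ` {..<m}. cardinal_bspline q (x + real q - real r))"
    by (subst sum.reindex) (auto simp: algebra_simps inj_on_def)
  also have "\<dots> \<le> (\<Sum>r<M. cardinal_bspline q (x + real q - real r))"
    by (intro sum_mono2) (auto simp: M_def cardinal_bspline_nonneg)
  also have "\<dots> = 1"
    using False by (intro cardinal_bspline_partition_of_unity) (auto simp: M_def, linarith)
  finally show ?thesis .
qed

text \<open>Induction on the degree with the defining recursion, which the formula reproduces one degree up.
  Staying off the integers admits the hat function, which has its kinks there, as the base case.\<close>

lemma cardinal_bspline_has_derivative:
  assumes "x \<notin> \<int>"
  shows "(cardinal_bspline (Suc q) has_real_derivative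
      cardinal_bspline q x - cardinal_bspline q (x - 1)) (at x)"
  using assms
proof (induction q arbitrary: x)
  case 0
  have ind: "((\<lambda>x. indicator {0..<1} (x - c)) has_real_derivative 0) (at x)"
    if c: "c \<in> \<int>" for c :: real
  proof -
    define f where "f = \<lfloor>x\<rfloor>"
    have "x \<noteq> of_int f" using 0 by (metis Ints_of_int)
    then have f: "of_int f < x" "x < of_int f + 1" unfolding f_def by linarith+
    obtain z where z: "c = of_int z" using c by (auto elim: Ints_cases)
    have iff: "0 \<le> y - of_int z \<longleftrightarrow> z \<le> f" "y - of_int z < 1 \<longleftrightarrow> f \<le> z"
      if "of_int f < y" "y < of_int f + 1" for y :: real
      using that by linarith+
    have loc: "indicator {0..<1} (y - c) = (indicator {0..<1} (x - c) :: real)"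
      if "y \<in> {of_int f<..<of_int f + 1}" for y
    proof -
      have y: "of_int f < y" "y < of_int f + 1" using that by auto
      have "y - c \<in> {0..<1} \<longleftrightarrow> z \<le> f \<and> f \<le> z" unfolding z by (simp only: atLeastLessThan_iff iff[OF y])
      moreover have "x - c \<in> {0..<1} \<longleftrightarrow> z \<le> f \<and> f \<le> z" unfolding z by (simp only: atLeastLessThan_iff iff[OF f])
      ultimately show ?thesis unfolding indicator_def by simp
    qed
    have "\<forall>\<^sub>F y in nhds x. y \<in> {of_int f<..<of_int f + 1}"
      using f by (intro eventually_nhds_in_open) auto
    then have "\<forall>\<^sub>F y in nhds x. indicator {0..<1} (y - c) = (indicator {0..<1} (x - c) :: real)"
      by (rule eventually_mono) (rule loc)
    from DERIV_cong_ev[OF refl this refl] show ?thesis by (simp only: DERIV_const)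
  qed
  have "cardinal_bspline (Suc 0) = (\<lambda>x. x * indicator {0..<1} (x - 0) + (2 - x) * indicator {0..<1} (x - 1))"
    by (intro ext) simp
  then show ?case
    using ind[of 0] ind[of 1] by (auto intro!: derivative_eq_intros)
next
  case (Suc q)
  have x1: "x - 1 \<notin> \<int>"
    using Suc.prems by (metis Ints_1 Ints_add diff_add_cancel)
  define A B C where "A = cardinal_bspline q x" and "B = cardinal_bspline q (x - 1)"
    and "C = cardinal_bspline q (x - 2)"
  define U V where "U = cardinal_bspline (Suc q) x" and "V = cardinal_bspline (Suc q) (x - 1)"
  define Q where "Q = real q + 1"
  define P where "P = Q + 1"
  have P: "P \<noteq> 0" by (simp add: P_def Q_def)
  have U: "Q * U = x * A + (Q + 1 - x) * B"
    unfolding U_def A_def B_def Q_def using cardinal_bspline_Suc[of q x] by simp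
  have V: "Q * V = (x - 1) * B + (Q + 2 - x) * C"
    unfolding V_def B_def C_def Q_def using cardinal_bspline_Suc[of q "x - 1"] by (simp add: algebra_simps)
  have d1: "(cardinal_bspline (Suc q) has_real_derivative (A - B)) (at x)"
    unfolding A_def B_def by (rule Suc.IH[OF Suc.prems])
  have "(cardinal_bspline (Suc q) has_real_derivative (B - C)) (at (x - 1))"
    using Suc.IH[OF x1] unfolding B_def C_def by (simp del: cardinal_bspline.simps)
  then have d2: "((\<lambda>x. cardinal_bspline (Suc q) (x - 1)) has_real_derivative (B - C)) (at x)"
    using DERIV_shift[of "cardinal_bspline (Suc q)" "B - C" x "-1"] by (simp del: cardinal_bspline.simps)
  have "cardinal_bspline (Suc (Suc q)) y = (y * cardinal_bspline (Suc q) y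
      + (P + 1 - y) * cardinal_bspline (Suc q) (y - 1)) / P" for y
    using cardinal_bspline_Suc[of "Suc q" y] P
    by (simp add: P_def Q_def field_simps del: cardinal_bspline.simps)
  then have eq: "cardinal_bspline (Suc (Suc q)) = (\<lambda>y. (y * cardinal_bspline (Suc q) y
      + (P + 1 - y) * cardinal_bspline (Suc q) (y - 1)) / P)"
    by blast
  have "(cardinal_bspline (Suc (Suc q)) has_real_derivative
      ((U + x * (A - B)) + ((P + 1 - x) * (B - C) - V)) / P) (at x)"
  proof -
    have "((\<lambda>y. y * cardinal_bspline (Suc q) y + (P + 1 - y) * cardinal_bspline (Suc q) (y - 1))
        has_real_derivative ((U + x * (A - B)) + ((P + 1 - x) * (B - C) - V))) (at x)"
      unfolding U_def V_def
      by (auto intro!: derivative_eq_intros d1 d2 simp: algebra_simps simp del: cardinal_bspline.simps)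
    then show ?thesis unfolding eq by (rule DERIV_cdivide)
  qed
  moreover have "(U + x * (A - B)) + ((P + 1 - x) * (B - C) - V) = (U - V) * P"
  proof -
    have "(U - V) * P = Q * U - Q * V + U - V" by (simp add: P_def algebra_simps)
    then show ?thesis unfolding U V P_def by (simp add: algebra_simps)
  qed
  ultimately show ?case using P unfolding U_def V_def by (simp del: cardinal_bspline.simps)
qed

section \<open>The spline space on clamped knots\<close>

text \<open>The B-spline recursion carried out on the cell \<open>[i/n, (i+1)/n)\<close> alone, where the result is a
  polynomial. The polynomial also makes sense at the right end of the cell, where the half-open
  convention of the B-splines gives no information.\<close>

fun spline_piece :: "nat \<Rightarrow> nat \<Rightarrow> nat \<Rightarrow> nat \<Rightarrow> nat \<Rightarrow> real poly" where
  "spline_piece n p i 0 j = (if j = p + i then 1 else 0)"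
| "spline_piece n p i (Suc q) j =
     Polynomial.smult (1 / (knot n p (j + Suc q) - knot n p j)) [:- knot n p j, 1:] * spline_piece n p i q j
   + Polynomial.smult (1 / (knot n p (j + Suc q + 1) - knot n p (j + 1))) [:knot n p (j + Suc q + 1), - 1:]
       * spline_piece n p i q (j + 1)"

locale spline_space =
  fixes n p :: nat
  assumes n: "2 \<le> n" and p: "1 \<le> p"
begin

abbreviation "\<tau> \<equiv> knot n p"

abbreviation "ndof \<equiv> sysdim p n"

abbreviation "node i \<equiv> real i / real n"

abbreviation "cell i \<equiv> {node i..node (i + 1)}"

abbreviation "open_cell i \<equiv> {node i<..<node (i + 1)}"

lemma ndof_eq: "ndof = n + p - 2"
  by (simp add: sysdim_def)

lemma knot_node: "i \<le> n \<Longrightarrow> \<tau> (p + i) = node i"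
  using n by (auto simp: knot_def)

lemma knot_low: "j \<le> p \<Longrightarrow> \<tau> j = 0"
  by (simp add: knot_def)

lemma knot_high: "p + n \<le> j \<Longrightarrow> \<tau> j = 1"
  using n by (simp add: knot_def)

lemma knot_mono: "i \<le> j \<Longrightarrow> \<tau> i \<le> \<tau> j"
  using n by (auto simp: knot_def field_simps of_nat_diff)

lemma knot_bounds: "0 \<le> \<tau> j" "\<tau> j \<le> 1"
  using knot_mono[of 0 j] knot_mono[of j "p + n + j"] knot_low[of 0] knot_high[of "p + n + j"] by auto

lemma bspline_eq_piece:
  assumes "i < n" "node i \<le> t" "t < node (i + 1)"
  shows "bspline n p q j t = poly (spline_piece n p i q j) t"
proof (induction q arbitrary: j)
  case 0
  have k: "\<tau> (p + i) = node i" "\<tau> (p + i + 1) = node (i + 1)"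
    using assms(1) knot_node[of i] knot_node[of "i + 1"] by auto
  consider "j = p + i" | "j < p + i" | "p + i < j" by linarith
  then show ?case
  proof cases
    case 1
    then show ?thesis using k assms by simp
  next
    case 2
    then have "\<tau> (j + 1) \<le> t" using knot_mono[of "j + 1" "p + i"] k assms by simp
    then show ?thesis using 2 by simp
  next
    case 3
    then have "t < \<tau> j" using knot_mono[of "p + i + 1" j] k assms by simp
    then show ?thesis using 3 by simp
  qed
next
  case (Suc q)
  then show ?case by (simp add: algebra_simps add_divide_distrib diff_divide_distrib)
qed

lemma bspline_outside: "t < 0 \<or> 1 \<le> t \<Longrightarrow> bspline n p q j t = 0"
proof (induction q arbitrary: j)
  case 0
  then show ?case using knot_bounds[of j] knot_bounds[of "j + 1"] by auto
qed auto

text \<open>An interior knot is simple, so from degree one on the two adjacent pieces take the same value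
  there. In degree one this is a computation with the three B-splines that do not vanish near the
  knot; the recursion carries it on.\<close>

lemma spline_piece_junction:
  assumes i: "i + 1 < n" and q: "1 \<le> q"
  shows "poly (spline_piece n p i q j) (node (i + 1)) =
    poly (spline_piece n p (i + 1) q j) (node (i + 1))"
  using q
proof (induction q arbitrary: j rule: dec_induct)
  case base
  define s where "s = node (i + 1)"
  have k: "\<tau> (p + i) < s" "\<tau> (p + i + 1) = s" "s < \<tau> (p + i + 2)"
    using i knot_node[of i] knot_node[of "i + 1"] knot_node[of "i + 2"]
    by (auto simp: s_def divide_strict_right_mono)
  consider "j = p + i" | "j = p + i + 1" | "j + 1 = p + i" | "j \<noteq> p + i" "j \<noteq> p + i + 1" "j + 1 \<noteq> p + i"
    by blast
  then have "poly (spline_piece n p i (Suc 0) j) s = poly (spline_piece n p (i + 1) (Suc 0) j) s"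
  proof cases
    case 1
    then have "s - \<tau> j \<noteq> 0" "\<tau> (Suc j) = s" using k by auto
    moreover have "\<tau> (Suc (Suc j)) - s \<noteq> 0" using 1 k(3) by simp
    ultimately show ?thesis using 1 by (simp add: diff_divide_distrib[symmetric])
  next
    case 2
    then show ?thesis using k by simp
  next
    case 3
    then have "\<tau> (j + 2) = s" using k by (metis add.assoc one_add_one)
    then show ?thesis using 3 by simp
  next
    case 4
    then show ?thesis by simp
  qed
  then show ?case by (simp add: s_def)
next
  case (step q)
  then show ?case by (simp only: spline_piece.simps poly_add poly_mult)
qed

text \<open>A B-spline of degree \<open>q\<close> is nonzero at the left end of its support only if the support starts with
  a knot of multiplicity \<open>q + 1\<close>.\<close>

lemma spline_piece_at_0: "poly (spline_piece n p 0 q j) 0 = (if j + q = p then 1 else 0)"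
proof (induction q arbitrary: j)
  case (Suc q)
  have pos: "0 < \<tau> (p + 1)" using knot_node[of 1] n by simp
  consider "j + Suc q = p" | "j + q = p" | "j + Suc q \<noteq> p" "j + q \<noteq> p" by blast
  then show ?case
  proof cases
    case 1
    then have "\<tau> (j + Suc q + 1) = \<tau> (p + 1)" "\<tau> (j + 1) = 0" using knot_low[of "j + 1"] by auto
    then show ?thesis using 1 Suc pos by simp
  next
    case 2
    then have "\<tau> j = 0" using knot_low by simp
    then show ?thesis using 2 Suc by simp
  next
    case 3
    then show ?thesis using Suc by simp
  qed
qed simp

lemma spline_piece_at_1: "poly (spline_piece n p (n - 1) q j) 1 = (if j = p + n - 1 then 1 else 0)"
proof (induction q arbitrary: j)
  case 0
  then show ?case using n by auto
next
  case (Suc q)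
  have lt: "\<tau> (p + n - 1) < 1" 
  proof -
    have "p + n - 1 = p + (n - 1)" "real (n - 1) < real n" using n by auto
    then show ?thesis using knot_node[of "n - 1"] n by simp
  qed
  consider "j = p + n - 1" | "j + 1 = p + n - 1" | "j \<noteq> p + n - 1" "j + 1 \<noteq> p + n - 1" by blast
  then show ?case
  proof cases
    case 1
    then have "\<tau> (j + Suc q) = 1" using knot_high n by simp
    moreover have "1 - \<tau> j \<noteq> 0" "j + 1 \<noteq> p + n - 1" using 1 lt n by auto
    ultimately show ?thesis using 1 Suc[of j] Suc[of "j + 1"] by (simp add: diff_divide_distrib[symmetric])
  next
    case 2
    then have "\<tau> (j + Suc q + 1) = 1" using knot_high n by simp
    then show ?thesis using 2 Suc by simp
  next
    case 3
    then show ?thesis using Suc by simp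
  qed
qed

text \<open>The junction of the pieces takes care of interior right ends. At \<open>1\<close> the B-splines vanish by the
  half-open convention, and so do the last pieces except the one of the B-spline number \<open>p + n - 1\<close>,
  which the range of \<open>j\<close> excludes.\<close>

lemma bspline_closed_cell:
  assumes j: "1 \<le> j" "j \<le> ndof" and i: "i < n" and t: "node i \<le> t" "t \<le> node (i + 1)"
  shows "bspline n p p j t = poly (spline_piece n p i p j) t"
proof (cases "t < node (i + 1)")
  case True
  then show ?thesis using bspline_eq_piece i t by blast
next
  case False
  then have t': "t = node (i + 1)" using t by simp
  show ?thesis
  proof (cases "i + 1 < n")
    case True
    have "bspline n p p j t = poly (spline_piece n p (i + 1) p j) t"
      using True n by (intro bspline_eq_piece) (auto simp: t' divide_strict_right_mono)
    then show ?thesis using spline_piece_junction[OF True p] t' by simp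
  next
    case False
    then have i': "i = n - 1" "t = 1" using i t' n by auto
    have "j \<noteq> p + n - 1" using j n p by (auto simp: ndof_eq)
    then show ?thesis using spline_piece_at_1[of p j] i' bspline_outside[of 1] by simp
  qed
qed

lemma cells_cover: "{0..1} = (\<Union>i<n. cell i)"
proof (intro equalityI subsetI)
  fix t :: real assume t: "t \<in> {0..1}"
  show "t \<in> (\<Union>i<n. cell i)"
  proof (cases "t = 1")
    case True
    then show ?thesis using n by (intro UN_I[of "n - 1"]) (auto simp: of_nat_diff field_simps)
  next
    case False
    define i where "i = nat \<lfloor>t * real n\<rfloor>"
    have "0 \<le> t * real n" "t * real n < real n" using t False n by auto
    then have "real i \<le> t * real n" "t * real n < real i + 1" "i < n"
      unfolding i_def by linarith+
    then show ?thesis using n by (intro UN_I[of i]) (auto simp: field_simps)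
  qed
next
  fix t :: real assume "t \<in> (\<Union>i<n. cell i)"
  then obtain i where i: "i < n" "node i \<le> t" "t \<le> node (i + 1)" by auto
  have "0 \<le> node i" "node (i + 1) \<le> 1" using i(1) n by auto
  then have "0 \<le> t" "t \<le> 1" using i(2,3) by linarith+
  then show "t \<in> {0..1}" by simp
qed

lemma continuous_on_cells:
  assumes "\<And>i. i < n \<Longrightarrow> continuous_on (cell i) f"
  shows "continuous_on {0..1} f"
  unfolding cells_cover using assms by (intro continuous_on_closed_Union) auto

lemma integrable_on_cells:
  fixes f :: "real \<Rightarrow> real"
  assumes "\<And>i. i < n \<Longrightarrow> \<exists>g. continuous_on (cell i) g \<and>
      (\<forall>x\<in>open_cell i. f x = g x)"
  shows "f integrable_on {0..1}"
proof -
  have "f integrable_on {0..node m}" if "m \<le> n" for m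
    using that
  proof (induction m)
    case 0
    show ?case using integrable_on_refl[of f "0 :: real"] by simp
  next
    case (Suc m)
    obtain g where g: "continuous_on (cell m) g"
      "\<And>x. x \<in> open_cell m \<Longrightarrow> f x = g x"
      using assms[of m] Suc.prems by auto
    have "f integrable_on (cell m)"
    proof (rule integrable_spike_finite[of "{node m, node (m + 1)}" _ f g])
      show "g integrable_on (cell m)"
        using g(1) by (rule integrable_continuous_real)
    qed (use g(2) in auto)
    moreover have "f integrable_on {0..node m}" using Suc by simp
    ultimately show ?case
      using Henstock_Kurzweil_Integration.integrable_combine[where a = 0 and c = "node m"
          and b = "node (m + 1)" and f = f] by (simp add: divide_right_mono)
  qed
  from this[of n] show ?thesis using n by simp
qed

lemma open_cell_subset: "i < n \<Longrightarrow> (open_cell i) \<subseteq> {0..1}"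
  using cells_cover by auto

lemma closed_cell_subset: "i < n \<Longrightarrow> (cell i) \<subseteq> {0..1}"
  using cells_cover by auto

subsection \<open>Spline functions\<close>

definition spline :: "(nat \<Rightarrow> real) \<Rightarrow> real \<Rightarrow> real" where
  "spline c x = (\<Sum>j<ndof. c j * bspline n p p (j + 1) x)"

definition spline_deriv :: "(nat \<Rightarrow> real) \<Rightarrow> real \<Rightarrow> real" where
  "spline_deriv c x = (\<Sum>j<ndof. c j * deriv (bspline n p p (j + 1)) x)"

definition spline_poly :: "(nat \<Rightarrow> real) \<Rightarrow> nat \<Rightarrow> real poly" where
  "spline_poly c i = (\<Sum>j<ndof. Polynomial.smult (c j) (spline_piece n p i p (j + 1)))"

lemma spline_eq_poly:
  assumes "i < n" "t \<in> cell i"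
  shows "spline c t = poly (spline_poly c i) t"
  unfolding spline_def spline_poly_def poly_sum poly_smult using assms
  by (intro sum.cong refl arg_cong2[where f = "(*)"] bspline_closed_cell) auto

lemma bspline_has_derivative:
  assumes i: "i < n" and t: "t \<in> open_cell i"
  shows "(bspline n p p j has_real_derivative poly (pderiv (spline_piece n p i p j)) t) (at t)"
proof -
  have "\<forall>\<^sub>F s in nhds t. s \<in> open_cell i"
    using t by (intro eventually_nhds_in_open) auto
  then have "\<forall>\<^sub>F s in nhds t. bspline n p p j s = poly (spline_piece n p i p j) s"
  proof eventually_elim
    case (elim s)
    then show ?case using i by (intro bspline_eq_piece) auto
  qed
  from DERIV_cong_ev[OF refl this refl] show ?thesis using poly_DERIV by blast
qed

lemma spline_deriv_eq_poly:
  assumes i: "i < n" and t: "t \<in> open_cell i"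
  shows "spline_deriv c t = poly (pderiv (spline_poly c i)) t"
proof -
  have s: "pderiv (sum f {..<m}) = (\<Sum>j<m. pderiv (f j))" for f :: "nat \<Rightarrow> real poly" and m
    by (induction m) (auto simp: pderiv_add)
  show ?thesis
    unfolding spline_deriv_def spline_poly_def s poly_sum pderiv_smult poly_smult
    using DERIV_imp_deriv[OF bspline_has_derivative[OF i t]] by simp
qed

lemma spline_has_derivative:
  assumes i: "i < n" and t: "t \<in> open_cell i"
  shows "(spline c has_real_derivative spline_deriv c t) (at t)"
proof -
  have "(bspline n p p j has_real_derivative deriv (bspline n p p j) t) (at t)" for j
    using bspline_has_derivative[OF i t] DERIV_imp_deriv by metis
  then show ?thesis
    unfolding spline_def[abs_def] spline_deriv_def by (intro DERIV_sum DERIV_cmult) auto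
qed

definition nodes :: "real set" where
  "nodes = (\<lambda>i. node i) ` {..n}"

lemma finite_nodes: "finite nodes"
  by (simp add: nodes_def)

lemma off_nodes_cell:
  assumes "t \<in> {0..1} - nodes"
  obtains i where "i < n" "t \<in> open_cell i"
proof -
  obtain i where i: "i < n" "node i \<le> t" "t \<le> node (i + 1)"
    using assms cells_cover by auto
  have "node i \<in> nodes" "node (i + 1) \<in> nodes"
    unfolding nodes_def using i(1) by (auto intro: image_eqI[of _ _ i] image_eqI[of _ _ "i + 1"])
  then have "t \<noteq> node i" "t \<noteq> node (i + 1)" using assms by auto
  then show ?thesis using i that by auto
qed

lemma continuous_on_spline: "continuous_on {0..1} (spline c)"
proof (rule continuous_on_cells)
  fix i assume i: "i < n"
  have "continuous_on (cell i) (poly (spline_poly c i))"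
    by (intro continuous_intros)
  then show "continuous_on (cell i) (spline c)"
    using spline_eq_poly[OF i] by (subst continuous_on_cong[OF refl]) auto
qed

lemma spline_at_0: "spline c 0 = 0"
proof -
  have "bspline n p p (j + 1) 0 = 0" for j
    using bspline_eq_piece[of 0 0 p "j + 1"] spline_piece_at_0[of p "j + 1"] n by simp
  then show ?thesis unfolding spline_def by simp
qed

lemma spline_at_1: "spline c 1 = 0"
  unfolding spline_def using bspline_outside[of 1] by simp

lemma spline_unit: "k < ndof \<Longrightarrow> spline (\<lambda>j. if j = k then 1 else 0) = bspline n p p (k + 1)"
  "k < ndof \<Longrightarrow> spline_deriv (\<lambda>j. if j = k then 1 else 0) = deriv (bspline n p p (k + 1))"
  unfolding spline_def[abs_def] spline_deriv_def[abs_def] by (auto simp: if_distrib[of "\<lambda>x. x * _"] cong: if_cong)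

lemma integrable_weighted_splines:
  assumes "continuous_on {0..1} w"
  shows "(\<lambda>x. w x * spline c x * spline d x) integrable_on {0..1}"
  using assms by (intro integrable_continuous_real continuous_intros continuous_on_spline)

lemma integrable_weighted_spline_derivs:
  assumes "continuous_on {0..1} w"
  shows "(\<lambda>x. w x * spline_deriv c x * spline_deriv d x) integrable_on {0..1}"
proof (rule integrable_on_cells)
  fix i assume i: "i < n"
  let ?g = "\<lambda>x. w x * poly (pderiv (spline_poly c i)) x * poly (pderiv (spline_poly d i)) x"
  have "continuous_on (cell i) ?g"
    using continuous_on_subset[OF assms closed_cell_subset[OF i]] by (intro continuous_intros)
  then show "\<exists>g. continuous_on (cell i) g \<and>
      (\<forall>x\<in>open_cell i. w x * spline_deriv c x * spline_deriv d x = g x)"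
    using spline_deriv_eq_poly[OF i] by (intro exI[of _ ?g]) auto
qed

subsection \<open>Linear independence\<close>

lemma spline_piece_zero: "p + i < j \<Longrightarrow> spline_piece n p i q j = 0"
  by (induction q arbitrary: j) auto

lemma spline_piece_first_pos:
  assumes i: "i < n"
  shows "0 < poly (spline_piece n p i q (p + i)) (node (i + 1))"
proof (induction q)
  case (Suc q)
  define s where "s = node (i + 1)"
  have a: "\<tau> (p + i) < s" unfolding s_def using knot_node[of i] i by (simp add: divide_strict_right_mono)
  have b: "s \<le> \<tau> (p + i + Suc q)"
    unfolding s_def using knot_node[of "i + 1"] knot_mono[of "p + i + 1" "p + i + Suc q"] i by simp
  have E: "poly (spline_piece n p i (Suc q) (p + i)) s =
      (s - \<tau> (p + i)) / (\<tau> (p + i + Suc q) - \<tau> (p + i)) * poly (spline_piece n p i q (p + i)) s"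
    using spline_piece_zero[of i "p + i + 1" q] by (simp add: algebra_simps diff_divide_distrib)
  have "0 < (s - \<tau> (p + i)) / (\<tau> (p + i + Suc q) - \<tau> (p + i))" using a b by simp
  then show ?case using Suc unfolding s_def[symmetric] E by (rule mult_pos_pos)
qed simp

text \<open>On the first cell the B-spline of degree \<open>p\<close> with number \<open>j \<le> p\<close> vanishes at \<open>0\<close> to the order \<open>j\<close> exactly; this
  separates the B-splines whose supports all start at \<open>0\<close>.\<close>

lemma spline_piece_order_at_0:
  assumes "j \<le> p" "p \<le> j + q"
  shows "(\<forall>m<j + q - p. coeff (spline_piece n p 0 q j) m = 0) \<and> 0 < coeff (spline_piece n p 0 q j) (j + q - p)"
  using assms
proof (induction q arbitrary: j)
  case (Suc q)
  define r where "r = j + Suc q - p"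
  have tj: "\<tau> j = 0" using Suc.prems knot_low by simp
  define \<alpha> where "\<alpha> = 1 / \<tau> (j + Suc q)"
  define X where "X = Polynomial.smult (1 / (\<tau> (j + Suc q) - \<tau> j)) [:- \<tau> j, 1:] * spline_piece n p 0 q j"
  define Y where "Y = Polynomial.smult (1 / (\<tau> (j + Suc q + 1) - \<tau> (j + 1))) [:\<tau> (j + Suc q + 1), - 1:] * spline_piece n p 0 q (j + 1)"
  have eq: "spline_piece n p 0 (Suc q) j = X + Y" unfolding X_def Y_def by simp
  have "X = pCons 0 (Polynomial.smult \<alpha> (spline_piece n p 0 q j))"
    unfolding X_def \<alpha>_def tj by simp
  then have coeffX: "coeff X m = (case m of 0 \<Rightarrow> 0 | Suc m' \<Rightarrow> \<alpha> * coeff (spline_piece n p 0 q j) m')" for m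
    by (simp split: nat.split)
  have X: "(\<forall>m<r. coeff X m = 0) \<and> (if p \<le> j + q then 0 < coeff X r else coeff X r = 0)"
  proof (cases "p \<le> j + q")
    case True
    have IH: "\<And>m. m < j + q - p \<Longrightarrow> coeff (spline_piece n p 0 q j) m = 0" "0 < coeff (spline_piece n p 0 q j) (j + q - p)"
      using Suc.IH[of j] Suc.prems True by auto
    have r: "r = Suc (j + q - p)" using True by (simp add: r_def)
    have "0 < \<tau> (p + 1)" using knot_node[of 1] n by simp
    also have "\<dots> \<le> \<tau> (j + Suc q)" using True by (intro knot_mono) simp
    finally have "0 < \<alpha>" by (simp add: \<alpha>_def)
    then show ?thesis using IH True r by (auto simp: coeffX split: nat.split)
  next
    case False
    then have "\<tau> (j + Suc q) = 0" by (intro knot_low) simp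
    then have "\<alpha> = 0" by (simp add: \<alpha>_def)
    then show ?thesis using False by (auto simp: coeffX split: nat.split)
  qed
  have Y: "(\<forall>m<r. coeff Y m = 0) \<and> (if j < p then 0 < coeff Y r else coeff Y r = 0)"
  proof (cases "j < p")
    case True
    have IH: "\<And>m. m < r \<Longrightarrow> coeff (spline_piece n p 0 q (j + 1)) m = 0" "0 < coeff (spline_piece n p 0 q (j + 1)) r"
      using Suc.IH[of "j + 1"] Suc.prems True by (auto simp: r_def)
    have t1: "\<tau> (j + 1) = 0" using True by (intro knot_low) simp
    have "0 < \<tau> (p + 1)" using knot_node[of 1] n by simp
    also have "\<dots> \<le> \<tau> (j + Suc q + 1)" using Suc.prems by (intro knot_mono) simp
    finally have pos: "0 < \<tau> (j + Suc q + 1)" .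
    have "Y = spline_piece n p 0 q (j + 1) - pCons 0 (Polynomial.smult (1 / \<tau> (j + Suc q + 1)) (spline_piece n p 0 q (j + 1)))"
      unfolding Y_def t1 using pos by (simp add: poly_eq_iff coeff_pCons split: nat.split)
    then have "coeff Y m = coeff (spline_piece n p 0 q (j + 1)) m
        - (case m of 0 \<Rightarrow> 0 | Suc m' \<Rightarrow> 1 / \<tau> (j + Suc q + 1) * coeff (spline_piece n p 0 q (j + 1)) m')" for m
      by (simp split: nat.split)
    then show ?thesis using IH True by (auto split: nat.split)
  next
    case False
    then have "Y = 0" unfolding Y_def using spline_piece_zero[of 0 "j + 1" q] by simp
    then show ?thesis using False by simp
  qed
  have "p \<le> j + q \<or> j < p" using Suc.prems by linarith
  then show ?case unfolding eq r_def[symmetric] using X Y by (auto split: if_splits)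
qed simp

lemma poly_zero_on_cell:
  assumes i: "i < n" and z: "\<And>t. t \<in> cell i \<Longrightarrow> poly P t = (0 :: real)"
  shows "P = 0"
proof (rule ccontr)
  assume "P \<noteq> 0"
  then have "finite {t. poly P t = 0}" by (rule poly_roots_finite)
  moreover have "(cell i) \<subseteq> {t. poly P t = 0}" using z by auto
  ultimately have "finite (cell i)" by (rule rev_finite_subset)
  moreover have "node i < node (i + 1)" using i by (simp add: divide_strict_right_mono)
  ultimately show False using infinite_Icc by blast
qed

text \<open>The first coefficient that could be nonzero is isolated on the first cell of the support of its
  B-spline: if the support starts at \<open>0\<close>, by the order of vanishing there, and otherwise because all
  later B-splines vanish on that cell.\<close>

lemma spline_eq_0_imp:
  assumes z: "\<And>t. t \<in> {0..1} \<Longrightarrow> spline c t = 0" and j: "j < ndof"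
  shows "c j = 0"
  using j
proof (induction j rule: less_induct)
  case (less j)
  define i where "i = j + 1 - p"
  have i: "i < n" using less.prems p n unfolding i_def ndof_eq by linarith
  have P0: "spline_poly c i = 0"
  proof (rule poly_zero_on_cell[OF i])
    fix t assume t: "t \<in> cell i"
    then have "t \<in> {0..1}" using closed_cell_subset[OF i] by blast
    then show "poly (spline_poly c i) t = 0"
      using spline_eq_poly[OF i t, of c] z[of t] by simp
  qed
  show ?case
  proof (cases "j + 1 \<le> p")
    case True
    then have i0: "i = 0" by (simp add: i_def)
    have ord: "(\<forall>m<l. coeff (spline_piece n p 0 p l) m = 0) \<and> 0 < coeff (spline_piece n p 0 p l) l" if "l \<le> p" for l
      using spline_piece_order_at_0[OF that, of p] by simp
    have "0 = coeff (spline_poly c 0) (j + 1)" using P0 i0 by simp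
    also have "\<dots> = (\<Sum>l<ndof. c l * coeff (spline_piece n p 0 p (l + 1)) (j + 1))"
      unfolding spline_poly_def by (simp add: coeff_sum)
    also have "\<dots> = (\<Sum>l<ndof. if l = j then c j * coeff (spline_piece n p 0 p (j + 1)) (j + 1) else 0)"
    proof (intro sum.cong refl)
      fix l assume l: "l \<in> {..<ndof}"
      consider "l < j" | "l = j" | "j < l" "l + 1 \<le> p" | "p < l + 1" by linarith
      then show "c l * coeff (spline_piece n p 0 p (l + 1)) (j + 1) =
          (if l = j then c j * coeff (spline_piece n p 0 p (j + 1)) (j + 1) else 0)"
      proof cases
        case 1
        then show ?thesis using less.IH[of l] l by simp
      next
        case 3
        then show ?thesis using ord[of "l + 1"] by simp
      next
        case 4
        then show ?thesis using spline_piece_zero[of 0 "l + 1" p] True by simp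
      qed simp
    qed
    also have "\<dots> = c j * coeff (spline_piece n p 0 p (j + 1)) (j + 1)" using less.prems by simp
    finally show ?thesis using ord[OF True] by simp
  next
    case False
    then have pi: "p + i = j + 1" by (simp add: i_def)
    define s where "s = node (i + 1)"
    have "0 = poly (spline_poly c i) s" using P0 by simp
    also have "\<dots> = (\<Sum>l<ndof. c l * poly (spline_piece n p i p (l + 1)) s)"
      unfolding spline_poly_def by (simp add: poly_sum)
    also have "\<dots> = (\<Sum>l<ndof. if l = j then c j * poly (spline_piece n p i p (p + i)) s else 0)"
    proof (intro sum.cong refl)
      fix l assume l: "l \<in> {..<ndof}"
      consider "l < j" | "l = j" | "j < l" by linarith
      then show "c l * poly (spline_piece n p i p (l + 1)) s = (if l = j then c j * poly (spline_piece n p i p (p + i)) s else 0)"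
      proof cases
        case 1
        then show ?thesis using less.IH[of l] l by simp
      next
        case 3
        then show ?thesis using spline_piece_zero[of i "l + 1" p] pi by simp
      qed (simp add: pi)
    qed
    also have "\<dots> = c j * poly (spline_piece n p i p (p + i)) s" using less.prems by simp
    finally show ?thesis using spline_piece_first_pos[OF i, of p] by (simp add: s_def)
  qed
qed

subsection \<open>Interior B-splines\<close>

lemma bspline_interior:
  assumes "p \<le> j" "j + q + 1 \<le> p + n"
  shows "bspline n p q j t = cardinal_bspline q (real n * t - real (j - p))"
  using assms
proof (induction q arbitrary: j)
  case 0
  have k: "\<tau> j = real (j - p) / real n" "\<tau> (j + 1) = (real (j - p) + 1) / real n"
    using knot_node[of "j - p"] knot_node[of "j - p + 1"] 0 by (auto simp: Suc_diff_le)
  have "t \<in> {\<tau> j..<\<tau> (j + 1)} \<longleftrightarrow> real n * t - real (j - p) \<in> {0..<1}"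
    unfolding k using n by (auto simp: field_simps)
  then show ?case by (simp add: indicator_def)
next
  case (Suc q)
  define Q where "Q = real (Suc q)"
  have Q: "Q > 0" by (simp add: Q_def)
  define a where "a = real (j - p)"
  have nn: "real n > 0" using n by simp
  have k: "\<tau> j = a / real n" "\<tau> (j + 1) = (a + 1) / real n" "\<tau> (j + Suc q) = (a + Q) / real n"
     "\<tau> (j + Suc q + 1) = (a + Q + 1) / real n"
    using knot_node[of "j - p"] knot_node[of "j - p + 1"] knot_node[of "j - p + Suc q"]
      knot_node[of "j - p + Suc q + 1"] Suc.prems
    by (auto simp: a_def Q_def Suc_diff_le algebra_simps)
  have 1: "bspline n p q j t = cardinal_bspline q (real n * t - a)"
    unfolding a_def using Suc.prems by (intro Suc.IH) auto
  have 2: "bspline n p q (j + 1) t = cardinal_bspline q (real n * t - a - 1)"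
    using Suc.IH[of "j + 1"] Suc.prems by (simp add: a_def Suc_diff_le algebra_simps)
  have 3: "(t - \<tau> j) / (\<tau> (j + Suc q) - \<tau> j) = (real n * t - a) / Q"
    unfolding k using Q nn by (simp add: field_simps)
  have 4: "(\<tau> (j + Suc q + 1) - t) / (\<tau> (j + Suc q + 1) - \<tau> (j + 1)) = (Q + 1 - (real n * t - a)) / Q"
    unfolding k using Q nn by (simp add: field_simps)
  show ?case
    unfolding bspline.simps(2) 1 2 3 4 cardinal_bspline.simps(2) a_def[symmetric] Q_def[symmetric] ..
qed

end

section \<open>Mass and stiffness forms and the lower eigenvalue bound\<close>

lemma C01_D:
  assumes "\<phi> \<in> C01"
  shows "continuous_on {0..1} (deriv01 \<phi>)"
    and "\<And>x. x \<in> {0..1} \<Longrightarrow> (\<phi> has_real_derivative deriv01 \<phi> x) (at x within {0..1})"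
    and "\<And>x. x \<in> {0..1} \<Longrightarrow> 0 < deriv01 \<phi> x"
    and "\<phi> 0 = 0" and "\<phi> 1 = 1"
proof -
  have d: "\<phi> differentiable_on {0..1}" "deriv01 \<phi> differentiable_on {0..1}"
    using assms unfolding C01_def C2_on01_def by auto
  show "continuous_on {0..1} (deriv01 \<phi>)"
    using d(2) by (rule differentiable_imp_continuous_on)
  show "(\<phi> has_real_derivative deriv01 \<phi> x) (at x within {0..1})" if "x \<in> {0..1}" for x
    using d(1) that unfolding differentiable_on_def deriv01_def
    by (simp add: vector_derivative_works has_real_derivative_iff_has_vector_derivative)
  show "\<And>x. x \<in> {0..1} \<Longrightarrow> 0 < deriv01 \<phi> x" "\<phi> 0 = 0" "\<phi> 1 = 1"
    using assms unfolding C01_def by auto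
qed

lemma gram_quadratic_form:
  fixes w :: "real \<Rightarrow> real"
  assumes v: "v \<in> carrier_vec N"
    and int: "\<And>i j. i < N \<Longrightarrow> j < N \<Longrightarrow> (\<lambda>x. w x * b i x * b j x) integrable_on S"
  shows "scalar_prod v (Matrix.mat N N (\<lambda>(i, j). integral S (\<lambda>x. w x * b i x * b j x)) *\<^sub>v v) =
    integral S (\<lambda>x. w x * (\<Sum>i<N. v $ i * b i x)\<^sup>2)"
proof -
  have "scalar_prod v (Matrix.mat N N (\<lambda>(i, j). integral S (\<lambda>x. w x * b i x * b j x)) *\<^sub>v v) =
      (\<Sum>i<N. v $ i * (\<Sum>j<N. integral S (\<lambda>x. w x * b i x * b j x) * v $ j))"
    using v by (auto simp: scalar_prod_def lessThan_atLeast0 intro!: sum.cong)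
  also have "\<dots> = (\<Sum>i<N. \<Sum>j<N. integral S (\<lambda>x. v $ i * v $ j * (w x * b i x * b j x)))"
    unfolding sum_distrib_left Henstock_Kurzweil_Integration.integral_mult_right
    by (intro sum.cong refl) (simp only: mult_ac)
  also have "\<dots> = (\<Sum>i<N. integral S (\<lambda>x. \<Sum>j<N. v $ i * v $ j * (w x * b i x * b j x)))"
    using int by (intro sum.cong refl integral_sum[symmetric]) (auto intro!: integrable_on_mult_right)
  also have "\<dots> = integral S (\<lambda>x. \<Sum>i<N. \<Sum>j<N. v $ i * v $ j * (w x * b i x * b j x))"
    using int by (intro integral_sum[symmetric]) (auto intro!: integrable_sum integrable_on_mult_right)
  also have "\<dots> = integral S (\<lambda>x. w x * (\<Sum>i<N. v $ i * b i x)\<^sup>2)"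
    by (simp add: power2_eq_square sum_product sum_distrib_left algebra_simps)
  finally show ?thesis .
qed

text \<open>In the variable \<open>y = \<phi> x\<close> the two matrices are the mass and the stiffness matrix of a Galerkin method
  for \<open>- u'' = \<lambda> u\<close> with zero boundary values on \<open>[0, 1]\<close>, whose eigenvalues are the numbers \<open>(k \<pi>)\<^sup>2\<close>.\<close>

locale galerkin = spline_space +
  fixes \<phi> :: "real \<Rightarrow> real"
  assumes \<phi>: "\<phi> \<in> C01"
begin

abbreviation "d \<equiv> deriv01 \<phi>"

lemma d_pos: "x \<in> {0..1} \<Longrightarrow> 0 < d x"
  using C01_D(3)[OF \<phi>] .

lemma d_nonzero: "x \<in> {0..1} \<Longrightarrow> d x \<noteq> 0"
  using d_pos[of x] by auto

lemma continuous_on_d: "continuous_on {0..1} d"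
  using C01_D(1)[OF \<phi>] .

lemma continuous_on_inverse_d: "continuous_on {0..1} (\<lambda>x. 1 / d x)"
  using continuous_on_d d_nonzero by (intro continuous_intros) auto

lemma continuous_on_phi: "continuous_on {0..1} \<phi>"
  using C01_D(2)[OF \<phi>] by (intro DERIV_continuous_on[of _ _ d])

lemma phi_deriv: "0 < x \<Longrightarrow> x < 1 \<Longrightarrow> (\<phi> has_real_derivative d x) (at x)"
  using C01_D(2)[OF \<phi>, of x] at_within_interior[of x "{0..1}"] by simp

lemma phi_strict_mono:
  assumes "0 \<le> x" "x < y" "y \<le> 1"
  shows "\<phi> x < \<phi> y"
proof (rule DERIV_pos_imp_increasing_open[OF assms(2)])
  show "\<exists>m. DERIV \<phi> t :> m \<and> 0 < m" if "x < t" "t < y" for t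
    using phi_deriv[of t] d_pos[of t] that assms by auto
  show "continuous_on {x..y} \<phi>" using assms by (intro continuous_on_subset[OF continuous_on_phi]) auto
qed

lemma phi_mono: "0 \<le> x \<Longrightarrow> x \<le> y \<Longrightarrow> y \<le> 1 \<Longrightarrow> \<phi> x \<le> \<phi> y"
  using phi_strict_mono[of x y] by (cases "x = y") auto

lemma phi_surj: "y \<in> {0..1} \<Longrightarrow> \<exists>x\<in>{0..1}. \<phi> x = y"
  using IVT'[of \<phi> 0 y 1] continuous_on_phi C01_D(4,5)[OF \<phi>] by auto

abbreviation "M \<equiv> M_mat \<phi> p n"
abbreviation "K \<equiv> K_mat \<phi> p n"

lemma M_eq: "M = Matrix.mat ndof ndof (\<lambda>(i, j). integral {0..1} (\<lambda>x. d x * bspline n p p (i + 1) x * bspline n p p (j + 1) x))"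
proof -
  have "integral {0..1} (\<lambda>x. \<bar>d x\<bar> * bspline n p p (i + 1) x * bspline n p p (j + 1) x) =
    integral {0..1} (\<lambda>x. d x * bspline n p p (i + 1) x * bspline n p p (j + 1) x)" for i j
    using d_pos by (intro Henstock_Kurzweil_Integration.integral_cong) (auto simp: abs_of_pos)
  then show ?thesis unfolding M_mat_def by simp
qed

lemma K_eq: "K = Matrix.mat ndof ndof (\<lambda>(i, j). integral {0..1}
    (\<lambda>x. 1 / d x * deriv (bspline n p p (i + 1)) x * deriv (bspline n p p (j + 1)) x))"
proof -
  have "integral {0..1} (\<lambda>x. 1 / \<bar>d x\<bar> * deriv (bspline n p p (i + 1)) x * deriv (bspline n p p (j + 1)) x) =
    integral {0..1} (\<lambda>x. 1 / d x * deriv (bspline n p p (i + 1)) x * deriv (bspline n p p (j + 1)) x)" for i j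
    using d_pos by (intro Henstock_Kurzweil_Integration.integral_cong) (auto simp: abs_of_pos)
  then show ?thesis unfolding K_mat_def by simp
qed

lemma M_form:
  assumes "v \<in> carrier_vec ndof"
  shows "qform M v = integral {0..1} (\<lambda>x. d x * (spline (\<lambda>i. v $ i) x)\<^sup>2)"
  unfolding M_eq spline_def
proof (rule gram_quadratic_form[OF assms])
  fix i j assume ij: "i < ndof" "j < ndof"
  show "(\<lambda>x. d x * bspline n p p (i + 1) x * bspline n p p (j + 1) x) integrable_on {0..1}"
    using integrable_weighted_splines[OF continuous_on_d, of "\<lambda>l. if l = i then 1 else 0" "\<lambda>l. if l = j then 1 else 0"]
    unfolding spline_unit(1)[OF ij(1)] spline_unit(1)[OF ij(2)] .
qed

lemma K_form:
  assumes "v \<in> carrier_vec ndof"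
  shows "qform K v = integral {0..1} (\<lambda>x. 1 / d x * (spline_deriv (\<lambda>i. v $ i) x)\<^sup>2)"
  unfolding K_eq spline_deriv_def
proof (rule gram_quadratic_form[OF assms])
  fix i j assume ij: "i < ndof" "j < ndof"
  show "(\<lambda>x. 1 / d x * deriv (bspline n p p (i + 1)) x * deriv (bspline n p p (j + 1)) x) integrable_on {0..1}"
    using integrable_weighted_spline_derivs[OF continuous_on_inverse_d, of "\<lambda>l. if l = i then 1 else 0" "\<lambda>l. if l = j then 1 else 0"]
    unfolding spline_unit(2)[OF ij(1)] spline_unit(2)[OF ij(2)] .
qed

lemma energy_integrable: "(\<lambda>x. 1 / d x * (spline_deriv c x)\<^sup>2) integrable_on {0..1}"
  using integrable_weighted_spline_derivs[OF continuous_on_inverse_d, of c c]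
  by (simp add: power2_eq_square)

lemma mass_integrable: "(\<lambda>x. d x * (spline c x)\<^sup>2) integrable_on {0..1}"
  using integrable_weighted_splines[OF continuous_on_d, of c c] by (simp add: power2_eq_square mult.assoc)

sublocale pencil: symmetric_pencil M K ndof
proof
  show "M \<in> carrier_mat ndof ndof" "K \<in> carrier_mat ndof ndof" by (auto simp: M_mat_def K_mat_def)
  show "transpose_mat M = M" unfolding M_eq by (intro eq_matI) (auto simp: mult_ac)
  show "transpose_mat K = K" unfolding K_eq by (intro eq_matI) (auto simp: mult.commute)
  fix v :: "real Matrix.vec" assume v: "v \<in> carrier_vec ndof" "v \<noteq> 0\<^sub>v ndof"
  have cont: "continuous_on {0..1} (\<lambda>x. d x * (spline (\<lambda>i. v $ i) x)\<^sup>2)"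
    by (intro continuous_intros continuous_on_d continuous_on_spline)
  have nn: "0 \<le> d x * (spline (\<lambda>i. v $ i) x)\<^sup>2" if "x \<in> {0..1}" for x
    using d_pos[OF that] by simp
  have "integral {0..1} (\<lambda>x. d x * (spline (\<lambda>i. v $ i) x)\<^sup>2) \<noteq> 0"
  proof
    assume "integral {0..1} (\<lambda>x. d x * (spline (\<lambda>i. v $ i) x)\<^sup>2) = 0"
    then have "\<forall>x\<in>{0..1}. d x * (spline (\<lambda>i. v $ i) x)\<^sup>2 = 0"
      using integral_eq_0_iff[OF cont] nn by auto
    then have "spline (\<lambda>i. v $ i) x = 0" if "x \<in> {0..1}" for x
      using d_nonzero[OF that] that by auto
    then have "v $ j = 0" if "j < ndof" for j
      using spline_eq_0_imp[of "\<lambda>i. v $ i" j] that by blast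
    then have "v = 0\<^sub>v ndof" using v(1) by (intro eq_vecI) auto
    then show False using v(2) by simp
  qed
  moreover have "0 \<le> integral {0..1} (\<lambda>x. d x * (spline (\<lambda>i. v $ i) x)\<^sup>2)"
    using nn by (intro Henstock_Kurzweil_Integration.integral_nonneg mass_integrable) auto
  ultimately show "0 < qform M v" unfolding M_form[OF v(1)] by simp
qed

lemma eigval_eq: "eigval \<phi> p n k = pencil.evs ! (k - 1)"
  unfolding eigval_def pencil.evs_def L_mat_def ..

lemma eigval_mono: "1 \<le> k \<Longrightarrow> k \<le> l \<Longrightarrow> l \<le> ndof \<Longrightarrow> eigval \<phi> p n k \<le> eigval \<phi> p n l"
  unfolding eigval_eq using pencil.sorted_diagonalization by (intro sorted_nth_mono) auto

subsection \<open>A lower bound for the eigenvalues\<close>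

text \<open>If \<open>u\<close> vanishes at both ends of an interval that \<open>\<phi>\<close> maps onto one of length less than
  \<open>\<pi>/c\<close>, then the energy of \<open>u\<close> there is at least \<open>c\<^sup>2\<close> times its mass: their difference is the
  integral of a square plus the derivative of \<open>- c tan (c (\<phi> - m)) u\<^sup>2\<close>, where \<open>m\<close> is the midpoint
  of the image, so that the tangent has no pole.\<close>

lemma wirtinger_interval:
  assumes z: "0 \<le> z" "z < z'" "z' \<le> 1" and c: "0 < c" "c * (\<phi> z' - \<phi> z) < pi"
    and u0: "spline w z = 0" "spline w z' = 0"
  shows "0 \<le> integral {z..z'} (\<lambda>x. 1 / d x * (spline_deriv w x)\<^sup>2 - c\<^sup>2 * (d x * (spline w x)\<^sup>2))"
proof -
  define m where "m = (\<phi> z + \<phi> z') / 2"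
  define T where "T x = tan (c * (\<phi> x - m))" for x
  define u u' where "u = spline w" and "u' = spline_deriv w"
  define F where "F x = 1 / d x * (u' x)\<^sup>2 - c\<^sup>2 * (d x * (u x)\<^sup>2)" for x
  define G where "G x = - c * T x * (u x)\<^sup>2" for x
  define G' where "G' x = - c\<^sup>2 * d x * (1 + (T x)\<^sup>2) * (u x)\<^sup>2 - 2 * c * T x * u x * u' x" for x
  have sub: "{z..z'} \<subseteq> {0..1}" using z by auto
  have cos_pos: "0 < cos (c * (\<phi> x - m))" if x: "x \<in> {z..z'}" for x
  proof -
    have "\<phi> z \<le> \<phi> x" "\<phi> x \<le> \<phi> z'" using x z by (auto intro!: phi_mono)
    then have "\<bar>\<phi> x - m\<bar> \<le> (\<phi> z' - \<phi> z) / 2" unfolding m_def by (auto simp: abs_le_iff field_simps)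
    then have "c * \<bar>\<phi> x - m\<bar> \<le> c * ((\<phi> z' - \<phi> z) / 2)" using c by (intro mult_left_mono) auto
    also have "\<dots> < pi / 2" using c by simp
    finally have "\<bar>c * (\<phi> x - m)\<bar> < pi / 2" using c by (simp add: abs_mult)
    then show ?thesis by (intro cos_gt_zero_pi) (auto simp: abs_less_iff)
  qed
  have contT: "continuous_on {z..z'} T"
    unfolding T_def[abs_def] tan_def
    using continuous_on_subset[OF continuous_on_phi sub] cos_pos
    by (intro continuous_intros) (auto simp: less_imp_neq[THEN not_sym])
  have contu: "continuous_on {z..z'} u"
    unfolding u_def using continuous_on_subset[OF continuous_on_spline sub] .
  have contG: "continuous_on {z..z'} G"
    unfolding G_def[abs_def] by (intro continuous_intros contT contu)
  have "(G' has_integral (G z' - G z)) {z..z'}"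
  proof (rule fundamental_theorem_of_calculus_interior_strong[OF finite_nodes _ _ contG])
    fix x assume x: "x \<in> {z<..<z'} - nodes"
    then have x01: "0 < x" "x < 1" using z by auto
    then have "x \<in> {0..1} - nodes" using x by auto
    then obtain i where i: "i < n" "x \<in> open_cell i"
      by (rule off_nodes_cell)
    have du: "(u has_real_derivative u' x) (at x)"
      unfolding u_def u'_def by (rule spline_has_derivative[OF i])
    have "cos (c * (\<phi> x - m)) \<noteq> 0" using cos_pos[of x] x by auto
    then have dT: "(T has_real_derivative (1 + (T x)\<^sup>2) * (c * d x)) (at x)"
      unfolding T_def[abs_def]
      by (auto intro!: derivative_eq_intros phi_deriv x01 simp: tan_sec power_inverse)
    have "(G has_real_derivative G' x) (at x)"
      unfolding G_def[abs_def] G'_def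
      by (auto intro!: derivative_eq_intros du dT simp: power2_eq_square algebra_simps)
    then show "(G has_vector_derivative G' x) (at x)"
      by (simp add: has_real_derivative_iff_has_vector_derivative)
  qed (use z in auto)
  moreover have "G z' = 0" "G z = 0" using u0 by (auto simp: G_def u_def)
  ultimately have G'int: "(G' has_integral 0) {z..z'}" by simp
  have "F integrable_on {0..1}"
    unfolding F_def u_def u'_def
    by (intro integrable_diff energy_integrable integrable_on_mult_right mass_integrable)
  then have Fint: "F integrable_on {z..z'}" by (rule integrable_subinterval_real) (use sub in auto)
  have "G' x \<le> F x" if x: "x \<in> {z..z'}" for x
  proof -
    have dx: "0 < d x" using d_pos x sub by auto
    (* Completing the square: the mixed term of the square is the one of the derivative of G. *)
    have "F x - G' x = 1 / d x * (u' x + c * T x * d x * u x)\<^sup>2"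
      using dx unfolding F_def G'_def by (simp add: field_simps power2_eq_square)
    moreover have "0 \<le> 1 / d x * (u' x + c * T x * d x * u x)\<^sup>2" using dx by simp
    ultimately show ?thesis by linarith
  qed
  then have "integral {z..z'} G' \<le> integral {z..z'} F"
    using G'int Fint by (intro integral_le) auto
  then show ?thesis using G'int unfolding F_def u_def u'_def by (simp add: integral_unique)
qed

text \<open>The zeros split \<open>[0, 1]\<close> into \<open>k\<close> intervals with images of length \<open>1/k\<close>. On each of them the
  previous estimate holds for every \<open>c < k \<pi>\<close>, and \<open>c\<close> tends to \<open>k \<pi>\<close>.\<close>

lemma spline_energy_ge:
  assumes k: "1 \<le> k" and z: "\<And>l. l \<le> k \<Longrightarrow> z l \<in> {0..1} \<and> \<phi> (z l) = real l / real k"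
    and u0: "\<And>l. 0 < l \<Longrightarrow> l < k \<Longrightarrow> spline w (z l) = 0"
  shows "(real k * pi)\<^sup>2 * integral {0..1} (\<lambda>x. d x * (spline w x)\<^sup>2) \<le>
    integral {0..1} (\<lambda>x. 1 / d x * (spline_deriv w x)\<^sup>2)"
proof -
  define A B where "A = integral {0..1} (\<lambda>x. 1 / d x * (spline_deriv w x)\<^sup>2)"
    and "B = integral {0..1} (\<lambda>x. d x * (spline w x)\<^sup>2)"
  have inj: "x = y" if "x \<in> {0..1}" "y \<in> {0..1}" "\<phi> x = \<phi> y" for x y
    using phi_strict_mono[of x y] phi_strict_mono[of y x] that by (cases x y rule: linorder_cases) auto
  have z0: "z 0 = 0" using inj[of "z 0" 0] z[of 0] C01_D(4)[OF \<phi>] by auto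
  have zk: "z k = 1" using inj[of "z k" 1] z[of k] C01_D(5)[OF \<phi>] k by auto
  have zu: "spline w (z l) = 0" if "l \<le> k" for l
    using u0[of l] spline_at_0[of w] spline_at_1[of w] z0 zk that by (cases "l = 0"; cases "l = k") auto
  have lt: "z l < z (Suc l)" if "l < k" for l
  proof (rule ccontr)
    assume "\<not> z l < z (Suc l)"
    then have "\<phi> (z (Suc l)) \<le> \<phi> (z l)" using z[of l] z[of "Suc l"] that by (intro phi_mono) auto
    then show False using z[of l] z[of "Suc l"] that by (simp add: divide_le_cancel)
  qed
  have le: "c\<^sup>2 * B \<le> A" if c: "0 < c" "c < real k * pi" for c
  proof -
    define F where "F x = 1 / d x * (spline_deriv w x)\<^sup>2 - c\<^sup>2 * (d x * (spline w x)\<^sup>2)" for x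
    have Fint: "F integrable_on {0..1}"
      unfolding F_def by (intro integrable_diff energy_integrable integrable_on_mult_right mass_integrable)
    have "0 \<le> integral {0..z l} F" if "l \<le> k" for l
      using that
    proof (induction l)
      case (Suc l)
      have "\<phi> (z (Suc l)) - \<phi> (z l) = 1 / real k"
        using z[of l] z[of "Suc l"] Suc.prems by (simp add: add_divide_distrib)
      moreover have "c * (1 / real k) < pi" using c k by (simp add: pos_divide_less_eq mult.commute)
      ultimately have "c * (\<phi> (z (Suc l)) - \<phi> (z l)) < pi" by simp
      then have "0 \<le> integral {z l..z (Suc l)} F"
        unfolding F_def using z[of l] z[of "Suc l"] zu lt[of l] Suc.prems c
        by (intro wirtinger_interval) auto
      moreover have "integral {0..z l} F + integral {z l..z (Suc l)} F = integral {0..z (Suc l)} F"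
        using z[of l] z[of "Suc l"] lt[of l] Suc.prems
        by (intro Henstock_Kurzweil_Integration.integral_combine integrable_subinterval_real[OF Fint]) auto
      ultimately show ?case using Suc by simp
    qed (simp add: z0)
    from this[of k] have "0 \<le> integral {0..1} F" by (simp add: zk)
    also have "integral {0..1} F = A - integral {0..1} (\<lambda>x. c\<^sup>2 * (d x * (spline w x)\<^sup>2))"
      unfolding F_def A_def
      by (intro Henstock_Kurzweil_Integration.integral_diff energy_integrable integrable_on_mult_right mass_integrable)
    also have "\<dots> = A - c\<^sup>2 * B" unfolding B_def by simp
    finally show ?thesis by simp
  qed
  have "\<forall>\<^sub>F c in at_left (real k * pi). c\<^sup>2 * B \<le> A"
  proof -
    have "\<forall>\<^sub>F c in at_left (real k * pi). c \<in> {0<..<real k * pi}"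
      using k by (intro eventually_at_left_real) auto
    then show ?thesis by eventually_elim (use le in auto)
  qed
  moreover have "((\<lambda>c. c\<^sup>2 * B) \<longlongrightarrow> (real k * pi)\<^sup>2 * B) (at_left (real k * pi))"
    by (intro tendsto_intros)
  ultimately have "(real k * pi)\<^sup>2 * B \<le> A" by (intro tendsto_upperbound[of "\<lambda>c. c\<^sup>2 * B"]) auto
  then show ?thesis unfolding A_def B_def .
qed

text \<open>The \<open>k - 1\<close> linear conditions are zeros at the interior points where \<open>\<phi>\<close> is a multiple of \<open>1/k\<close>.\<close>

lemma eigval_ge_square:
  assumes k: "1 \<le> k" "k \<le> ndof"
  shows "(real k * pi)\<^sup>2 \<le> eigval \<phi> p n k"
proof -
  have "\<exists>x\<in>{0..1}. \<phi> x = real l / real k" if "l \<le> k" for l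
    using that k by (intro phi_surj) auto
  then obtain z where z: "\<And>l. l \<le> k \<Longrightarrow> z l \<in> {0..1} \<and> \<phi> (z l) = real l / real k" by metis
  show ?thesis unfolding eigval_eq
  proof (rule pencil.eigenvalue_ge[OF k, of "\<lambda>l. Matrix.vec ndof (\<lambda>j. bspline n p p (j + 1) (z (l + 1)))"])
    fix x :: "real Matrix.vec" assume x: "x \<in> carrier_vec ndof"
      and zero: "\<And>l. l < k - 1 \<Longrightarrow> scalar_prod (Matrix.vec ndof (\<lambda>j. bspline n p p (j + 1) (z (l + 1)))) x = 0"
    have "spline (\<lambda>i. x $ i) (z l) = 0" if l: "0 < l" "l < k" for l
    proof -
      have "scalar_prod (Matrix.vec ndof (\<lambda>j. bspline n p p (j + 1) (z (l - 1 + 1)))) x = spline (\<lambda>i. x $ i) (z l)"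
        using x l by (auto simp: scalar_prod_def spline_def lessThan_atLeast0 intro!: sum.cong)
      then show ?thesis using zero[of "l - 1"] l by simp
    qed
    then show "(real k * pi)\<^sup>2 * qform M x \<le> qform K x"
      unfolding M_form[OF x] K_form[OF x] using z k by (intro spline_energy_ge[of k z]) auto
  qed simp
qed

end

section \<open>The upper eigenvalue bound\<close>

subsection \<open>One arch of the sine\<close>

definition bump :: "real \<Rightarrow> real \<Rightarrow> real \<Rightarrow> real" where
  "bump a b y = sin (pi / (b - a) * (max a (min b y) - a))"

text \<open>The integral of the square of the derivative of the bump up to \<open>y\<close>.\<close>

definition bump_energy :: "real \<Rightarrow> real \<Rightarrow> real \<Rightarrow> real" where
  "bump_energy a b y = (let c = pi / (b - a); t = max a (min b y) - a in
     c\<^sup>2 * t / 2 + c * sin (2 * c * t) / 4)"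

lemma bump_inside: "a \<le> y \<Longrightarrow> y \<le> b \<Longrightarrow> bump a b y = sin (pi / (b - a) * (y - a))"
  by (simp add: bump_def)

lemma bump_outside: "a < b \<Longrightarrow> y \<le> a \<or> b \<le> y \<Longrightarrow> bump a b y = 0"
  by (auto simp: bump_def max_def min_def)

lemma abs_bump_le_1: "\<bar>bump a b y\<bar> \<le> 1"
  by (simp add: bump_def)

lemma abs_sin_diff_le: "\<bar>sin x - sin y\<bar> \<le> \<bar>x - y\<bar>" for x y :: real
proof -
  have "\<bar>sin x - sin y\<bar> = 2 * \<bar>sin ((x - y) / 2)\<bar> * \<bar>cos ((x + y) / 2)\<bar>"
    by (simp add: sin_diff_sin abs_mult)
  also have "\<dots> \<le> 2 * \<bar>(x - y) / 2\<bar> * 1"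
    by (intro mult_mono abs_sin_x_le_abs_x) auto
  finally show ?thesis by simp
qed

lemma bump_lipschitz:
  assumes "a < b"
  shows "\<bar>bump a b x - bump a b y\<bar> \<le> pi / (b - a) * \<bar>x - y\<bar>"
proof -
  let ?c = "pi / (b - a)"
  have "\<bar>bump a b x - bump a b y\<bar> \<le> \<bar>?c * (max a (min b x) - a) - ?c * (max a (min b y) - a)\<bar>"
    unfolding bump_def by (rule abs_sin_diff_le)
  also have "\<dots> = ?c * \<bar>max a (min b x) - max a (min b y)\<bar>"
  proof -
    have "?c * (max a (min b x) - a) - ?c * (max a (min b y) - a) = ?c * (max a (min b x) - max a (min b y))"
      unfolding right_diff_distrib[symmetric] by simp
    then show ?thesis using assms by (simp add: abs_mult)
  qed
  also have "\<dots> \<le> ?c * \<bar>x - y\<bar>"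
    using assms by (intro mult_left_mono) (auto simp: max_def min_def)
  finally show ?thesis .
qed

lemma bump_energy_low: "a < b \<Longrightarrow> y \<le> a \<Longrightarrow> bump_energy a b y = 0"
  by (simp add: bump_energy_def Let_def)

lemma bump_energy_high: "a < b \<Longrightarrow> b \<le> y \<Longrightarrow> bump_energy a b y = pi\<^sup>2 / (2 * (b - a))"
proof -
  assume ab: "a < b" "b \<le> y"
  define l where "l = b - a"
  have l: "l > 0" "max a (min b y) - a = l" using ab by (auto simp: l_def)
  have "2 * (pi / l) * l = 2 * pi" using l by simp
  then show ?thesis
    unfolding bump_energy_def Let_def l(2) l_def[symmetric] using l(1)
    by (simp only: sin_two_pi) (simp add: power2_eq_square)
qed

text \<open>The Cauchy-Schwarz inequality for the derivative of the bump on \<open>[x, y]\<close>. For every \<open>l\<close> the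
  function \<open>l\<^sup>2 y + energy - 2 l bump\<close> is nondecreasing, its derivative being a square; the best
  \<open>l\<close> is the difference quotient of the bump.\<close>

lemma bump_increment_le:
  assumes ab: "a < b" and xy: "x \<le> y"
  shows "(bump a b y - bump a b x)\<^sup>2 \<le> (y - x) * (bump_energy a b y - bump_energy a b x)"
proof (cases "x = y")
  case False
  then have lt: "x < y" using xy by simp
  define c where "c = pi / (b - a)"
  define l where "l = (bump a b y - bump a b x) / (y - x)"
  define cl where "cl t = max a (min b t)" for t
  define G where "G t = l\<^sup>2 * t + (c\<^sup>2 * (t - a) / 2 + c * sin (2 * c * (t - a)) / 4) - 2 * l * sin (c * (t - a))" for t
  have G_mono: "G s \<le> G t" if "s \<le> t" for s t
  proof (rule DERIV_nonneg_imp_nondecreasing[OF that])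
    fix u
    have "(G has_real_derivative (l - c * cos (c * (u - a)))\<^sup>2) (at u)"
    proof -
      have cos2: "cos (2 * c * (u - a)) = 2 * (cos (c * (u - a)))\<^sup>2 - 1"
        using cos_double_cos[of "c * (u - a)"] by (simp add: mult.assoc)
      have "(G has_real_derivative l\<^sup>2 + (c\<^sup>2 / 2 + c * (cos (2 * c * (u - a)) * (2 * c)) / 4) - 2 * l * (cos (c * (u - a)) * c)) (at u)"
        unfolding G_def[abs_def] by (auto intro!: derivative_eq_intros)
      then show ?thesis unfolding cos2 by (simp add: power2_eq_square field_simps)
    qed
    then show "\<exists>y. (G has_real_derivative y) (at u) \<and> 0 \<le> y" by (intro exI conjI) auto
  qed
  have H: "l\<^sup>2 * t + bump_energy a b t - 2 * l * bump a b t = l\<^sup>2 * (t - cl t) + G (cl t)" for t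
    unfolding G_def bump_energy_def bump_def cl_def c_def Let_def by (simp add: algebra_simps)
  have "cl x \<le> cl y" "x - cl x \<le> y - cl y" using xy ab by (auto simp: cl_def max_def min_def)
  then have "l\<^sup>2 * (x - cl x) + G (cl x) \<le> l\<^sup>2 * (y - cl y) + G (cl y)"
    by (intro add_mono mult_left_mono G_mono) auto
  then have "2 * l * (bump a b y - bump a b x) \<le> l\<^sup>2 * (y - x) + (bump_energy a b y - bump_energy a b x)"
    unfolding H[symmetric] by (simp add: algebra_simps)
  moreover have "bump a b y - bump a b x = l * (y - x)" using lt by (simp add: l_def)
  ultimately have "l\<^sup>2 * (y - x) \<le> bump_energy a b y - bump_energy a b x"
    by (simp add: power2_eq_square algebra_simps)
  then have "(y - x) * (l\<^sup>2 * (y - x)) \<le> (y - x) * (bump_energy a b y - bump_energy a b x)"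
    using lt by (intro mult_left_mono) auto
  moreover have "(bump a b y - bump a b x)\<^sup>2 = (y - x) * (l\<^sup>2 * (y - x))"
    unfolding \<open>bump a b y - bump a b x = l * (y - x)\<close> by (simp add: power2_eq_square)
  ultimately show ?thesis by simp
qed simp

text \<open>Jensen's inequality for the square; weights of total less than one only help.\<close>

lemma jensen_square:
  fixes w B :: "nat \<Rightarrow> real"
  assumes "\<And>r. r \<in> S \<Longrightarrow> 0 \<le> B r" "(\<Sum>r\<in>S. B r) \<le> 1"
  shows "(\<Sum>r\<in>S. w r * B r)\<^sup>2 \<le> (\<Sum>r\<in>S. (w r)\<^sup>2 * B r)"
proof -
  have "(\<Sum>r\<in>S. w r * B r)\<^sup>2 = (\<Sum>r\<in>S. (w r * sqrt (B r)) * sqrt (B r))\<^sup>2"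
    using assms(1) by (intro arg_cong[where f = "\<lambda>x. x\<^sup>2"] sum.cong) auto
  also have "\<dots> \<le> (\<Sum>r\<in>S. (w r * sqrt (B r))\<^sup>2) * (\<Sum>r\<in>S. (sqrt (B r))\<^sup>2)"
    by (rule Cauchy_Schwarz_ineq_sum)
  also have "\<dots> = (\<Sum>r\<in>S. (w r)\<^sup>2 * B r) * (\<Sum>r\<in>S. B r)"
    using assms(1) by (simp add: power_mult_distrib)
  also have "\<dots> \<le> (\<Sum>r\<in>S. (w r)\<^sup>2 * B r) * 1"
    using assms by (intro mult_left_mono sum_nonneg) auto
  finally show ?thesis by simp
qed

lemma sum_square_of_disjoint:
  fixes u :: "nat \<Rightarrow> real"
  assumes "finite S" "\<And>i j. i \<in> S \<Longrightarrow> j \<in> S \<Longrightarrow> i \<noteq> j \<Longrightarrow> u i * u j = 0"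
  shows "(\<Sum>i\<in>S. u i)\<^sup>2 = (\<Sum>i\<in>S. (u i)\<^sup>2)"
proof -
  have "(\<Sum>i\<in>S. u i)\<^sup>2 = (\<Sum>i\<in>S. \<Sum>j\<in>S. u i * u j)" by (simp add: power2_eq_square sum_product)
  also have "\<dots> = (\<Sum>i\<in>S. \<Sum>j\<in>S. if j = i then (u i)\<^sup>2 else 0)"
    using assms(2) by (intro sum.cong refl) (auto simp: power2_eq_square)
  also have "\<dots> = (\<Sum>i\<in>S. (u i)\<^sup>2)" using assms(1) by simp
  finally show ?thesis .
qed

context spline_space
begin

lemma nonnode_not_int:
  assumes "x \<in> {0..1} - nodes"
  shows "real n * x - real r \<notin> \<int>"
proof
  assume "real n * x - real r \<in> \<int>"
  then have "real n * x - real r + real r \<in> \<int>" by (intro Ints_add) auto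
  then obtain z where z: "real n * x = of_int z" by (auto elim: Ints_cases)
  obtain i where i: "i < n" "x \<in> open_cell i"
    using off_nodes_cell[OF assms] by blast
  then have "real i < real n * x" "real n * x < real i + 1" using n by (auto simp: field_simps)
  then have "int i < z" "z < int i + 1" unfolding z by linarith+
  then show False by simp
qed

text \<open>The sum of all right translates of a cardinal B-spline has the B-spline of one degree less as
  derivative; the sum lies between \<open>0\<close> and \<open>1\<close>.\<close>

lemma cardinal_bspline_translate_integral:
  "(\<lambda>x. cardinal_bspline q (real n * x - real r)) integrable_on {0..1}"
  "integral {0..1} (\<lambda>x. cardinal_bspline q (real n * x - real r)) \<le> 1 / real n"
proof -
  define J where "J x = 1 / real n * (\<Sum>s<n + 1. cardinal_bspline (Suc q) (real n * x - real r - real s))" for x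
  have nn: "real n > 0" using n by simp
  have "((\<lambda>x. cardinal_bspline q (real n * x - real r)) has_integral (J 1 - J 0)) {0..1}"
  proof (rule fundamental_theorem_of_calculus_interior_strong[OF finite_nodes])
    have "continuous_on {0..1} (\<lambda>x. cardinal_bspline (Suc q) (real n * x - real r - real s))" for s
      by (rule continuous_on_compose2[OF continuous_on_cardinal_bspline[of "Suc q"]])
        (auto intro!: continuous_intros)
    then show "continuous_on {0..1} J"
      unfolding J_def[abs_def] by (intro continuous_on_mult_left continuous_on_sum)
    fix x :: real assume x: "x \<in> {0<..<1} - nodes"
    then have x': "x \<in> {0..1} - nodes" by auto
    have D: "((\<lambda>x. cardinal_bspline (Suc q) (real n * x - real r - real s)) has_real_derivative
       real n * (cardinal_bspline q (real n * x - real r - real s) - cardinal_bspline q (real n * x - real r - real (Suc s)))) (at x)" for s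
    proof -
      have "real n * x - real r - real s \<notin> \<int>" using nonnode_not_int[OF x', of "r + s"] by (simp add: algebra_simps)
      from cardinal_bspline_has_derivative[OF this]
      have "(cardinal_bspline (Suc q) has_real_derivative
        cardinal_bspline q (real n * x - real r - real s) - cardinal_bspline q (real n * x - real r - real (Suc s)))
        (at (real n * x - real r - real s))" by (simp add: algebra_simps del: cardinal_bspline.simps)
      then have "((\<lambda>x. cardinal_bspline (Suc q) (real n * x - real r - real s)) has_real_derivative
        (cardinal_bspline q (real n * x - real r - real s) - cardinal_bspline q (real n * x - real r - real (Suc s))) * real n) (at x)"
        by (rule DERIV_chain2) (auto intro!: derivative_eq_intros)
      then show ?thesis by (simp only: mult.commute)
    qed
    have "(J has_real_derivative 1 / real n * (\<Sum>s<n + 1. real n * (cardinal_bspline q (real n * x - real r - real s)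
        - cardinal_bspline q (real n * x - real r - real (Suc s))))) (at x)"
      unfolding J_def[abs_def] by (intro DERIV_cmult DERIV_sum D)
    also have "1 / real n * (\<Sum>s<n + 1. real n * (cardinal_bspline q (real n * x - real r - real s)
        - cardinal_bspline q (real n * x - real r - real (Suc s)))) =
        (\<Sum>s<n + 1. cardinal_bspline q (real n * x - real r - real s)
        - cardinal_bspline q (real n * x - real r - real (Suc s)))"
      using nn by (simp add: sum_distrib_left[symmetric])
    also have "\<dots> = cardinal_bspline q (real n * x - real r - real 0) - cardinal_bspline q (real n * x - real r - real (n + 1))"
      by (rule sum_lessThan_telescope')
    also have "cardinal_bspline q (real n * x - real r - real (n + 1)) = 0"
    proof (rule cardinal_bspline_support)
      have "real n * x < real n * 1" using x nn by (intro mult_strict_left_mono) auto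
      then show "real n * x - real r - real (n + 1) < 0 \<or> real q + 1 \<le> real n * x - real r - real (n + 1)" by simp
    qed
    finally show "(J has_vector_derivative cardinal_bspline q (real n * x - real r)) (at x)"
      by (simp add: has_real_derivative_iff_has_vector_derivative)
  qed simp
  moreover have "J 1 \<le> 1 / real n"
    unfolding J_def using cardinal_bspline_translates_le_1[of "Suc q" "real n * 1 - real r" "n + 1"] nn
    by (simp add: divide_right_mono del: sum.lessThan_Suc cardinal_bspline.simps)
  moreover have "0 \<le> J 0"
    unfolding J_def by (intro mult_nonneg_nonneg sum_nonneg cardinal_bspline_nonneg) auto
  ultimately show "(\<lambda>x. cardinal_bspline q (real n * x - real r)) integrable_on {0..1}"
    "integral {0..1} (\<lambda>x. cardinal_bspline q (real n * x - real r)) \<le> 1 / real n"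
    by (auto simp: integrable_on_def integral_unique)
qed

text \<open>The B-splines with index between \<open>p\<close> and \<open>n - 1\<close> are translates of the cardinal B-spline; \<open>W r\<close> is
  the coefficient of the one whose support starts at \<open>r/n\<close>.\<close>

definition interior_coeffs :: "(nat \<Rightarrow> real) \<Rightarrow> nat \<Rightarrow> real" where
  "interior_coeffs W i = (if p \<le> i + 1 then W (i + 1 - p) else 0)"

lemma interior_spline:
  assumes W: "\<And>r. r \<le> n \<Longrightarrow> n \<le> r + p \<Longrightarrow> W r = 0"
  shows "spline (interior_coeffs W) x = (\<Sum>r<n. W r * cardinal_bspline p (real n * x - real r))"
proof -
  have "spline (interior_coeffs W) x = (\<Sum>i\<in>{p - 1..<p - 1 + (n - 1)}. W (i + 1 - p) * bspline n p p (i + 1) x)"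
    unfolding spline_def
    by (rule sum.mono_neutral_cong_right) (use n p in \<open>auto simp: interior_coeffs_def ndof_eq\<close>)
  also have "\<dots> = (\<Sum>r<n - 1. W r * bspline n p p (p + r) x)"
    by (rule sum.reindex_bij_witness[of _ "\<lambda>r. r + p - 1" "\<lambda>i. i + 1 - p"]) (use p in auto)
  also have "\<dots> = (\<Sum>r<n - 1. W r * cardinal_bspline p (real n * x - real r))"
  proof (intro sum.cong refl)
    fix r assume r: "r \<in> {..<n - 1}"
    show "W r * bspline n p p (p + r) x = W r * cardinal_bspline p (real n * x - real r)"
    proof (cases "n \<le> r + p")
      case True
      then show ?thesis using W[of r] r by simp
    next
      case False
      then show ?thesis using bspline_interior[of "p + r" p x] by simp
    qed
  qed
  also have "\<dots> = (\<Sum>r<n. W r * cardinal_bspline p (real n * x - real r))"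
  proof -
    have "n = Suc (n - 1)" "W (n - 1) = 0" using n p W[of "n - 1"] by auto
    then show ?thesis using sum.lessThan_Suc[of "\<lambda>r. W r * cardinal_bspline p (real n * x - real r)" "n - 1"] by simp
  qed
  finally show ?thesis .
qed

text \<open>Summation by parts: the derivative of a B-spline is a difference of two neighbours of lower degree,
  and the difference passes to the coefficients, which vanish at both ends.\<close>

lemma interior_spline_deriv:
  assumes W: "\<And>r. r \<le> n \<Longrightarrow> n \<le> r + p \<Longrightarrow> W r = 0" and W0: "W 0 = 0" and x: "x \<in> {0..1} - nodes"
  shows "spline_deriv (interior_coeffs W) x =
    (\<Sum>r<n. real n * (W (Suc r) - W r) * cardinal_bspline (p - 1) (real n * x - real (Suc r)))"
proof -
  obtain q where q: "p = Suc q" using p by (cases p) auto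
  define f where "f r = cardinal_bspline q (real n * x - real r)" for r
  obtain i where i: "i < n" "x \<in> open_cell i"
    using off_nodes_cell[OF x] by blast
  have D: "((\<lambda>x. cardinal_bspline p (real n * x - real r)) has_real_derivative (f r - f (Suc r)) * real n) (at x)" for r
  proof -
    have "(cardinal_bspline p has_real_derivative f r - f (Suc r)) (at (real n * x - real r))"
      using cardinal_bspline_has_derivative[OF nonnode_not_int[OF x, of r], of q]
      by (simp add: f_def q algebra_simps del: cardinal_bspline.simps)
    then show ?thesis by (rule DERIV_chain2) (auto intro!: derivative_eq_intros)
  qed
  have eq: "spline (interior_coeffs W) = (\<lambda>x. \<Sum>r<n. W r * cardinal_bspline p (real n * x - real r))"
    by (intro ext interior_spline W)
  have "(spline (interior_coeffs W) has_real_derivative (\<Sum>r<n. W r * ((f r - f (Suc r)) * real n))) (at x)"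
    unfolding eq by (intro DERIV_sum DERIV_cmult D)
  then have "spline_deriv (interior_coeffs W) x = (\<Sum>r<n. W r * ((f r - f (Suc r)) * real n))"
    using spline_has_derivative[OF i] DERIV_unique by blast
  also have "\<dots> = real n * ((\<Sum>r<n. W r * f r) - (\<Sum>r<n. W r * f (Suc r)))"
    by (simp add: sum_subtractf[symmetric] sum_distrib_left algebra_simps)
  also have "(\<Sum>r<n. W r * f r) = (\<Sum>r<n. W (Suc r) * f (Suc r))"
    using sum.lessThan_Suc_shift[of "\<lambda>r. W r * f r" n] sum.lessThan_Suc[of "\<lambda>r. W r * f r" n] W0 W[of n] by simp
  finally show ?thesis
    by (simp add: q f_def sum_subtractf[symmetric] sum_distrib_left algebra_simps del: cardinal_bspline.simps)
qed

end

context galerkin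
begin

lemma phi_mvt:
  assumes "u < v" "0 \<le> u" "v \<le> 1"
  obtains z where "u < z" "z < v" "\<phi> v - \<phi> u = (v - u) * d z"
proof -
  obtain z where "u < z" "z < v" "\<phi> v - \<phi> u = (*) (d z) (v - u)"
  proof (rule mvt[OF assms(1), of \<phi> "\<lambda>x. (*) (d x)"])
    show "continuous_on {u..v} \<phi>" using assms by (intro continuous_on_subset[OF continuous_on_phi]) auto
    show "(\<phi> has_derivative (*) (d x)) (at x)" if "u < x" "x < v" for x
      using phi_deriv[of x] that assms by (simp add: has_field_derivative_def)
  qed
  then show ?thesis using that by (simp add: mult.commute)
qed

text \<open>The energy of an interior spline whose coefficients are values at the nodes of a function of
  \<open>\<phi>\<close>. The derivative is a combination of difference quotients with the weights of a partition of
  unity, so by convexity its square is at most the same combination of the squared difference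
  quotients; each B-spline has integral at most \<open>1/n\<close>, and \<open>\<phi>'\<close> is nearly constant on its support.\<close>

lemma interior_energy_le:
  assumes W: "\<And>r. r \<le> n \<Longrightarrow> n \<le> r + p \<Longrightarrow> W r = 0" and W0: "W 0 = 0"
    and \<eta>: "0 \<le> \<eta>"
    and osc: "\<And>x y. x \<in> {0..1} \<Longrightarrow> y \<in> {0..1} \<Longrightarrow> \<bar>x - y\<bar> \<le> (real p + 1) / real n \<Longrightarrow> d y \<le> (1 + \<eta>) * d x"
    and E: "\<And>r. r < n \<Longrightarrow> (W (Suc r) - W r)\<^sup>2 \<le>
      (\<phi> (node (Suc r)) - \<phi> (node r)) * (E (Suc r) - E r)"
  shows "integral {0..1} (\<lambda>x. 1 / d x * (spline_deriv (interior_coeffs W) x)\<^sup>2) \<le> (1 + \<eta>) * (E n - E 0)"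
proof -
  define b where "b r x = cardinal_bspline (p - 1) (real n * x - real (Suc r))" for r x
  define \<alpha> where "\<alpha> r = real n * (1 + \<eta>) * (E (Suc r) - E r)" for r
  have nn: "real n > 0" using n by simp
  have "\<exists>z. z \<in> {node r<..<node (Suc r)} \<and>
      \<phi> (node (Suc r)) - \<phi> (node r) = d z / real n" if r: "r < n" for r
  proof -
    have "node r < node (Suc r)" "0 \<le> node r" "node (Suc r) \<le> 1"
      using nn r by (auto simp: divide_strict_right_mono)
    from phi_mvt[OF this] obtain z where "node r < z" "z < node (Suc r)"
      "\<phi> (node (Suc r)) - \<phi> (node r) = (node (Suc r) - node r) * d z" .
    then show ?thesis by (intro exI[of _ z]) (auto simp: diff_divide_distrib[symmetric])
  qed
  then obtain \<zeta> where \<zeta>: "\<And>r. r < n \<Longrightarrow> \<zeta> r \<in> {node r<..<node (Suc r)}"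
    "\<And>r. r < n \<Longrightarrow> \<phi> (node (Suc r)) - \<phi> (node r) = d (\<zeta> r) / real n" by metis
  have \<zeta>01: "\<zeta> r \<in> {0..1}" if "r < n" for r
    using \<zeta>(1)[OF that] open_cell_subset[OF that] by auto
  have Ed: "0 \<le> E (Suc r) - E r" if "r < n" for r
  proof (rule ccontr)
    assume "\<not> 0 \<le> E (Suc r) - E r"
    then have "d (\<zeta> r) / real n * (E (Suc r) - E r) < 0"
      using d_pos[OF \<zeta>01[OF that]] nn by (intro mult_pos_neg) auto
    moreover have "(W (Suc r) - W r)\<^sup>2 \<le> d (\<zeta> r) / real n * (E (Suc r) - E r)"
      using E[OF that] unfolding \<zeta>(2)[OF that] .
    ultimately show False using zero_le_power2[of "W (Suc r) - W r"] by linarith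
  qed
  have \<alpha>0: "0 \<le> \<alpha> r" if "r < n" for r using Ed[OF that] \<eta> by (simp add: \<alpha>_def)
  have b0: "0 \<le> b r x" for r x unfolding b_def by (rule cardinal_bspline_nonneg)
  have pw: "1 / d x * (spline_deriv (interior_coeffs W) x)\<^sup>2 \<le> (\<Sum>r<n. \<alpha> r * b r x)" if x: "x \<in> {0..1} - nodes" for x
  proof -
    have x01: "x \<in> {0..1}" using x by simp
    have dx: "0 < d x" using d_pos[OF x01] .
    have "(\<Sum>r<n. b r x) \<le> 1"
      unfolding b_def using cardinal_bspline_translates_le_1[of "p - 1" "real n * x - 1" n]
      by (simp add: algebra_simps del: cardinal_bspline.simps)
    moreover have "spline_deriv (interior_coeffs W) x = (\<Sum>r<n. real n * (W (Suc r) - W r) * b r x)"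
      unfolding b_def by (rule interior_spline_deriv[OF _ _ x]) (use W W0 in auto)
    ultimately have "(spline_deriv (interior_coeffs W) x)\<^sup>2 \<le> (\<Sum>r<n. (real n * (W (Suc r) - W r))\<^sup>2 * b r x)"
      using jensen_square[of "{..<n}" "\<lambda>r. b r x" "\<lambda>r. real n * (W (Suc r) - W r)"] b0 by metis
    then have "1 / d x * (spline_deriv (interior_coeffs W) x)\<^sup>2 \<le> 1 / d x * (\<Sum>r<n. (real n * (W (Suc r) - W r))\<^sup>2 * b r x)"
      using dx by (intro mult_left_mono) auto
    also have "\<dots> = (\<Sum>r<n. 1 / d x * (real n * (W (Suc r) - W r))\<^sup>2 * b r x)"
      by (simp add: sum_distrib_left mult.assoc)
    also have "\<dots> \<le> (\<Sum>r<n. \<alpha> r * b r x)"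
    proof (rule sum_mono)
      fix r assume "r \<in> {..<n}"
      then have r: "r < n" by simp
      show "1 / d x * (real n * (W (Suc r) - W r))\<^sup>2 * b r x \<le> \<alpha> r * b r x"
      proof (cases "b r x = 0")
        case False
        then have "\<not> (real n * x - real (Suc r) < 0 \<or> real (p - 1) + 1 \<le> real n * x - real (Suc r))"
          unfolding b_def using cardinal_bspline_support by blast
        then have xr: "real (Suc r) \<le> real n * x" "real n * x \<le> real r + 1 + real p" using p by auto
        have zr: "real r < real n * \<zeta> r" "real n * \<zeta> r < real r + 1"
          using \<zeta>(1)[OF r] nn by (auto simp: field_simps)
        have "\<bar>real n * x - real n * \<zeta> r\<bar> \<le> real p + 1" using xr zr by (simp add: abs_le_iff)
        then have "real n * \<bar>x - \<zeta> r\<bar> \<le> real p + 1"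
          using nn by (simp add: right_diff_distrib[symmetric] abs_mult)
        then have "\<bar>x - \<zeta> r\<bar> \<le> (real p + 1) / real n" using nn by (simp add: field_simps)
        then have dd: "d (\<zeta> r) \<le> (1 + \<eta>) * d x" using osc x01 \<zeta>01[OF r] by blast
        have "1 / d x * (real n * (W (Suc r) - W r))\<^sup>2 = (real n)\<^sup>2 / d x * (W (Suc r) - W r)\<^sup>2"
          by (simp add: power_mult_distrib)
        also have "\<dots> \<le> (real n)\<^sup>2 / d x * (d (\<zeta> r) / real n * (E (Suc r) - E r))"
          using E[OF r] \<zeta>(2)[OF r] dx by (intro mult_left_mono) auto
        also have "\<dots> = real n * (E (Suc r) - E r) / d x * d (\<zeta> r)"
          using nn dx by (simp add: power2_eq_square field_simps)
        also have "\<dots> \<le> real n * (E (Suc r) - E r) / d x * ((1 + \<eta>) * d x)"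
          using dd Ed[OF r] dx by (intro mult_left_mono) auto
        also have "\<dots> = \<alpha> r" using dx by (simp add: \<alpha>_def)
        finally show ?thesis using b0 by (intro mult_right_mono)
      qed simp
    qed
    finally show ?thesis .
  qed
  have bint: "b r integrable_on {0..1}" "integral {0..1} (b r) \<le> 1 / real n" for r
    unfolding b_def using cardinal_bspline_translate_integral[of "p - 1" "Suc r"] by auto
  let ?f = "\<lambda>x. 1 / d x * (spline_deriv (interior_coeffs W) x)\<^sup>2"
  let ?g = "\<lambda>x. if x \<in> nodes then 0 else ?f x"
  have "integral {0..1} ?f = integral {0..1} ?g"
    by (rule integral_spike[OF negligible_finite[OF finite_nodes]]) auto
  also have "\<dots> \<le> integral {0..1} (\<lambda>x. \<Sum>r<n. \<alpha> r * b r x)"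
  proof (rule integral_le)
    show "?g integrable_on {0..1}"
      by (rule integrable_spike_finite[OF finite_nodes _ energy_integrable]) auto
    show "(\<lambda>x. \<Sum>r<n. \<alpha> r * b r x) integrable_on {0..1}"
      by (intro integrable_sum integrable_on_mult_right bint) auto
    show "?g x \<le> (\<Sum>r<n. \<alpha> r * b r x)" if "x \<in> {0..1}" for x
      using pw[of x] that \<alpha>0 b0 by (cases "x \<in> nodes") (auto intro!: sum_nonneg mult_nonneg_nonneg)
  qed
  also have "\<dots> = (\<Sum>r<n. \<alpha> r * integral {0..1} (b r))"
    by (subst integral_sum) (auto intro!: integrable_on_mult_right bint)
  also have "\<dots> \<le> (\<Sum>r<n. \<alpha> r * (1 / real n))"
    using \<alpha>0 bint by (intro sum_mono mult_left_mono) auto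
  also have "\<dots> = (1 + \<eta>) * (\<Sum>r<n. E (Suc r) - E r)"
    using nn by (simp add: \<alpha>_def sum_distrib_left)
  also have "(\<Sum>r<n. E (Suc r) - E r) = E n - E 0" by (rule sum_lessThan_telescope)
  finally show ?thesis .
qed

lemma phi_lipschitz:
  assumes B: "\<And>x. x \<in> {0..1} \<Longrightarrow> d x \<le> B" and xy: "x \<in> {0..1}" "y \<in> {0..1}"
  shows "\<bar>\<phi> x - \<phi> y\<bar> \<le> B * \<bar>x - y\<bar>"
proof -
  have *: "\<bar>\<phi> v - \<phi> u\<bar> \<le> B * \<bar>v - u\<bar>" if uv: "u < v" "0 \<le> u" "v \<le> 1" for u v
  proof -
    obtain z where z: "u < z" "z < v" "\<phi> v - \<phi> u = (v - u) * d z" using phi_mvt[OF uv] .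
    have "d z \<le> B" "0 < d z" using z uv by (auto intro!: B d_pos)
    then have "(v - u) * d z \<le> (v - u) * B" "0 \<le> (v - u) * d z" using uv by (auto intro: mult_left_mono)
    then show ?thesis using z(3) uv(1) by (simp add: mult.commute)
  qed
  show ?thesis
    using *[of x y] *[of y x] xy by (cases x y rule: linorder_cases) (auto simp: abs_minus_commute)
qed

end

text \<open>A bump over \<open>[a, b]\<close>, seen through \<open>\<phi>\<close>, as a spline. The margin \<open>D/n\<close> at both ends is
  the amount by which \<open>\<phi>\<close> can change on the support of a B-spline.\<close>

locale galerkin_bump = galerkin +
  fixes B \<eta> a b D :: real
  assumes B: "\<And>x. x \<in> {0..1} \<Longrightarrow> d x \<le> B"
    and \<eta>: "0 < \<eta>"
    and osc: "\<And>x y. x \<in> {0..1} \<Longrightarrow> y \<in> {0..1} \<Longrightarrow> \<bar>x - y\<bar> \<le> (real p + 1) / real n \<Longrightarrow> d y \<le> (1 + \<eta>) * d x"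
    and D: "D = (real p + 1) * B"
    and ab: "D / real n \<le> a" "a < b" "b \<le> 1 - D / real n"
begin

definition coeffs :: "nat \<Rightarrow> real" where
  "coeffs = interior_coeffs (\<lambda>r. bump a b (\<phi> (node r)))"

lemma B_pos: "0 < B"
  using d_pos[of 0] B[of 0] by simp

lemma D_pos: "0 < D"
  using B_pos D by simp

lemma node_in: "r \<le> n \<Longrightarrow> node r \<in> {0..1}"
  using n by simp

lemma values_0: "bump a b (\<phi> (node 0)) = 0"
  using ab D_pos n C01_D(4)[OF \<phi>] by (intro bump_outside) (auto intro: order_trans[rotated])

text \<open>A node within \<open>p\<close> cells of the right end lies in the margin.\<close>

lemma values_end:
  assumes "r \<le> n" "n \<le> r + p"
  shows "bump a b (\<phi> (node r)) = 0"
proof (rule bump_outside[OF ab(2)])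
  have nn: "real n > 0" using n by simp
  have "\<bar>1 - node r\<bar> = (real n - real r) / real n"
    using assms(1) nn by (simp add: field_simps)
  also have "\<dots> \<le> (real p + 1) / real n" using assms nn by (intro divide_right_mono) auto
  finally have "\<bar>1 - node r\<bar> \<le> (real p + 1) / real n" .
  then have "B * \<bar>1 - node r\<bar> \<le> B * ((real p + 1) / real n)"
    using B_pos by (intro mult_left_mono) auto
  moreover have "\<bar>\<phi> 1 - \<phi> (node r)\<bar> \<le> B * \<bar>1 - node r\<bar>"
    using assms by (intro phi_lipschitz[OF B] node_in) auto
  ultimately have "1 - \<phi> (node r) \<le> D / real n"
    using C01_D(5)[OF \<phi>] by (simp add: D mult.commute abs_le_iff)
  then show "\<phi> (node r) \<le> a \<or> b \<le> \<phi> (node r)" using ab by simp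
qed

text \<open>The increments of the bump are controlled by those of its energy, whose sum telescopes to the
  total energy of the arch; only the variation of \<open>\<phi>'\<close> costs the factor \<open>1 + \<eta>\<close>.\<close>

lemma energy_le:
  "integral {0..1} (\<lambda>x. 1 / d x * (spline_deriv coeffs x)\<^sup>2) \<le> (1 + \<eta>) * (pi\<^sup>2 / (2 * (b - a)))"
proof -
  have nn: "real n > 0" using n by simp
  let ?E = "\<lambda>r. bump_energy a b (\<phi> (node r))"
  have "integral {0..1} (\<lambda>x. 1 / d x * (spline_deriv coeffs x)\<^sup>2) \<le> (1 + \<eta>) * (?E n - ?E 0)"
    unfolding coeffs_def
  proof (rule interior_energy_le)
    fix r assume r: "r < n"
    have "\<phi> (node r) \<le> \<phi> (node (Suc r))"
      using r nn by (intro phi_mono) (auto simp: divide_right_mono)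
    then show "(bump a b (\<phi> (node (Suc r))) - bump a b (\<phi> (node r)))\<^sup>2 \<le>
        (\<phi> (node (Suc r)) - \<phi> (node r)) * (?E (Suc r) - ?E r)"
      by (rule bump_increment_le[OF ab(2)])
  qed (use values_end values_0 \<eta> osc in auto)
  moreover have "?E n = pi\<^sup>2 / (2 * (b - a))"
    using ab D_pos nn C01_D(5)[OF \<phi>] by (intro bump_energy_high) (auto intro: order_trans)
  moreover have "?E 0 = 0"
    using ab D_pos nn C01_D(4)[OF \<phi>] by (intro bump_energy_low) (auto intro: order_trans[rotated])
  ultimately show ?thesis by simp
qed

lemma phi_near_node:
  assumes "x \<in> {0..1}" "r \<le> n" "\<bar>real n * x - real r\<bar> \<le> real p + 1"
  shows "\<bar>\<phi> x - \<phi> (node r)\<bar> \<le> D / real n"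
proof -
  have nn: "real n > 0" using n by simp
  have "\<bar>\<phi> x - \<phi> (node r)\<bar> \<le> B * \<bar>x - node r\<bar>"
    using assms by (intro phi_lipschitz[OF B] node_in) auto
  also have "x - node r = (real n * x - real r) / real n" using nn by (simp add: field_simps)
  also have "B * \<bar>(real n * x - real r) / real n\<bar> \<le> B * ((real p + 1) / real n)"
    using assms nn B_pos by (intro mult_left_mono) (auto simp: divide_right_mono)
  finally show ?thesis by (simp add: D mult.commute)
qed

lemma spline_support:
  assumes x: "x \<in> {0..1}" and nz: "spline coeffs x \<noteq> 0"
  shows "a - D / real n < \<phi> x" "\<phi> x < b + D / real n"
proof -
  have "spline coeffs x = (\<Sum>r<n. bump a b (\<phi> (node r)) * cardinal_bspline p (real n * x - real r))"
    unfolding coeffs_def by (rule interior_spline) (rule values_end)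
  then have "\<exists>r<n. bump a b (\<phi> (node r)) * cardinal_bspline p (real n * x - real r) \<noteq> 0"
    using nz by (metis (no_types, lifting) lessThan_iff sum.neutral)
  then obtain r where r: "r < n" "bump a b (\<phi> (node r)) \<noteq> 0" "cardinal_bspline p (real n * x - real r) \<noteq> 0"
    by auto
  have "\<not> (real n * x - real r < 0 \<or> real p + 1 \<le> real n * x - real r)"
    using r(3) cardinal_bspline_support by blast
  then have "\<bar>\<phi> x - \<phi> (node r)\<bar> \<le> D / real n"
    using r x by (intro phi_near_node) auto
  moreover have "a < \<phi> (node r)" "\<phi> (node r) < b"
    using bump_outside[OF ab(2)] r(2) by (auto simp: not_le[symmetric])
  ultimately show "a - D / real n < \<phi> x" "\<phi> x < b + D / real n" by (auto simp: abs_le_iff)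
qed

lemma spline_deriv_support:
  assumes x: "x \<in> {0..1} - nodes" and nz: "spline_deriv coeffs x \<noteq> 0"
  shows "a - D / real n < \<phi> x" "\<phi> x < b + D / real n"
proof -
  let ?W = "\<lambda>r. bump a b (\<phi> (node r))"
  have "spline_deriv coeffs x = (\<Sum>r<n. real n * (?W (Suc r) - ?W r) * cardinal_bspline (p - 1) (real n * x - real (Suc r)))"
    unfolding coeffs_def by (rule interior_spline_deriv[OF _ _ x]) (use values_end values_0 in auto)
  then have "\<exists>r<n. real n * (?W (Suc r) - ?W r) * cardinal_bspline (p - 1) (real n * x - real (Suc r)) \<noteq> 0"
    using nz by (metis (no_types, lifting) lessThan_iff sum.neutral)
  then obtain r where r: "r < n" "?W (Suc r) \<noteq> ?W r" "cardinal_bspline (p - 1) (real n * x - real (Suc r)) \<noteq> 0"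
    by auto
  have "\<not> (real n * x - real (Suc r) < 0 \<or> real (p - 1) + 1 \<le> real n * x - real (Suc r))"
    using r(3) cardinal_bspline_support by blast
  then have xr: "\<bar>real n * x - real (Suc r)\<bar> \<le> real p + 1" "\<bar>real n * x - real r\<bar> \<le> real p + 1"
    using p by auto
  have "?W (Suc r) \<noteq> 0 \<or> ?W r \<noteq> 0" using r(2) by auto
  then have "\<exists>s. (s = r \<or> s = Suc r) \<and> ?W s \<noteq> 0" by blast
  then obtain s where s: "s = r \<or> s = Suc r" "?W s \<noteq> 0" by blast
  have "\<bar>\<phi> x - \<phi> (node s)\<bar> \<le> D / real n"
    using r x xr s(1) by (intro phi_near_node) auto
  moreover have "a < \<phi> (node s)" "\<phi> (node s) < b"
    using bump_outside[OF ab(2)] s(2) by (auto simp: not_le[symmetric])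
  ultimately show "a - D / real n < \<phi> x" "\<phi> x < b + D / real n" by (auto simp: abs_le_iff)
qed

text \<open>The spline is an average of values of the bump at nodes near \<open>x\<close>, and the bump is Lipschitz.\<close>

lemma spline_close:
  assumes x: "x \<in> {0..1}" "a \<le> \<phi> x" "\<phi> x \<le> b"
  shows "\<bar>spline coeffs x - bump a b (\<phi> x)\<bar> \<le> pi / (b - a) * (D / real n)"
proof -
  have nn: "real n > 0" using n by simp
  let ?s = "bump a b"
  let ?N = "\<lambda>r. cardinal_bspline p (real n * x - real r)"
  have "\<phi> x - \<phi> 0 \<le> B * x" using phi_lipschitz[OF B, of x 0] x by (auto simp: abs_le_iff)
  then have "D / real n \<le> B * x" using ab x C01_D(4)[OF \<phi>] by simp
  then have "B * (real p + 1) \<le> B * (real n * x)" using nn by (simp add: D field_simps)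
  then have px: "real p \<le> real n * x" using B_pos by simp
  have "x \<noteq> 1"
  proof
    assume "x = 1"
    then have "1 \<le> b" using x C01_D(5)[OF \<phi>] by simp
    moreover have "0 < D / real n" using D_pos nn by simp
    ultimately show False using ab(3) by linarith
  qed
  then have "real n * x < real n * 1" using x nn by (intro mult_strict_left_mono) auto
  then have one: "(\<Sum>r<n. ?N r) = 1" using px by (intro cardinal_bspline_partition_of_unity) auto
  have "spline coeffs x - ?s (\<phi> x) = (\<Sum>r<n. ?s (\<phi> (node r)) * ?N r) - ?s (\<phi> x) * (\<Sum>r<n. ?N r)"
    unfolding coeffs_def one by (subst interior_spline) (use values_end in auto)
  also have "\<dots> = (\<Sum>r<n. (?s (\<phi> (node r)) - ?s (\<phi> x)) * ?N r)"
    by (simp add: sum_distrib_left sum_subtractf left_diff_distrib)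
  finally have "\<bar>spline coeffs x - ?s (\<phi> x)\<bar> \<le> (\<Sum>r<n. \<bar>(?s (\<phi> (node r)) - ?s (\<phi> x)) * ?N r\<bar>)"
    by (simp only: sum_abs)
  also have "\<dots> \<le> (\<Sum>r<n. pi / (b - a) * (D / real n) * ?N r)"
  proof (rule sum_mono)
    fix r assume r: "r \<in> {..<n}"
    show "\<bar>(?s (\<phi> (node r)) - ?s (\<phi> x)) * ?N r\<bar> \<le> pi / (b - a) * (D / real n) * ?N r"
    proof (cases "?N r = 0")
      case False
      then have "\<not> (real n * x - real r < 0 \<or> real p + 1 \<le> real n * x - real r)"
        using cardinal_bspline_support by blast
      then have near: "\<bar>\<phi> x - \<phi> (node r)\<bar> \<le> D / real n"
        using r x by (intro phi_near_node) auto
      have "\<bar>?s (\<phi> (node r)) - ?s (\<phi> x)\<bar> \<le> pi / (b - a) * \<bar>\<phi> (node r) - \<phi> x\<bar>"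
        by (rule bump_lipschitz[OF ab(2)])
      also have "\<dots> \<le> pi / (b - a) * (D / real n)"
        using near ab(2) by (intro mult_left_mono) (auto simp: abs_minus_commute)
      finally have "\<bar>?s (\<phi> (node r)) - ?s (\<phi> x)\<bar> * ?N r \<le> pi / (b - a) * (D / real n) * ?N r"
        using cardinal_bspline_nonneg by (rule mult_right_mono)
      then show ?thesis unfolding abs_mult abs_of_nonneg[OF cardinal_bspline_nonneg] .
    qed simp
  qed
  also have "\<dots> = pi / (b - a) * (D / real n) * (\<Sum>r<n. ?N r)" by (rule sum_distrib_left[symmetric])
  finally show ?thesis unfolding one by simp
qed

text \<open>The mass over the part of \<open>[0, 1]\<close> that \<open>\<phi>\<close> maps to \<open>[a, b]\<close>; there the square of the spline is at
  least the square of the bump minus \<open>2 \<kappa>\<close>, and with the weight \<open>\<phi>'\<close> the remaining integral is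
  explicit.\<close>

lemma mass_ge:
  defines "\<kappa> \<equiv> pi / (b - a) * (D / real n)"
  shows "(b - a) * (1 / 2 - 2 * \<kappa>) \<le> integral {0..1} (\<lambda>x. d x * (spline coeffs x)\<^sup>2)"
proof -
  have nn: "real n > 0" using n by simp
  have "0 \<le> D / real n" using D_pos nn by simp
  then have ab01: "a \<in> {0..1}" "b \<in> {0..1}" using ab by auto
  obtain u v where u: "u \<in> {0..1}" "\<phi> u = a" and v: "v \<in> {0..1}" "\<phi> v = b"
    using phi_surj[OF ab01(1)] phi_surj[OF ab01(2)] by blast
  have uv: "u < v" using phi_mono[of v u] u v ab(2) by (cases "u < v") auto
  define c where "c = pi / (b - a)"
  have c: "c > 0" using ab(2) by (simp add: c_def)
  define S where "S y = (y - a) / 2 - sin (2 * (c * (y - a))) / (4 * c) - 2 * \<kappa> * y" for y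
  have "((\<lambda>x. d x * ((bump a b (\<phi> x))\<^sup>2 - 2 * \<kappa>)) has_integral (S (\<phi> v) - S (\<phi> u))) {u..v}"
  proof (rule fundamental_theorem_of_calculus_interior_strong[of "{}"])
    show "continuous_on {u..v} (\<lambda>x. S (\<phi> x))"
    proof -
      have "continuous_on {u..v} \<phi>" using u v by (intro continuous_on_subset[OF continuous_on_phi]) auto
      then show ?thesis unfolding S_def using c by (intro continuous_intros) auto
    qed
    fix x assume x: "x \<in> {u<..<v} - {}"
    have y: "a \<le> \<phi> x" "\<phi> x \<le> b" using phi_mono[of u x] phi_mono[of x v] u v x by auto
    have dS: "(S has_real_derivative (sin (c * (y - a)))\<^sup>2 - 2 * \<kappa>) (at y)" for y
    proof -
      have "(S has_real_derivative 1 / 2 - cos (2 * (c * (y - a))) * (2 * c) / (4 * c) - 2 * \<kappa>) (at y)"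
        unfolding S_def[abs_def] using c by (auto intro!: derivative_eq_intros)
      moreover have "1 / 2 - cos (2 * (c * (y - a))) * (2 * c) / (4 * c) - 2 * \<kappa> = (sin (c * (y - a)))\<^sup>2 - 2 * \<kappa>"
        unfolding cos_double_sin using c by (simp add: diff_divide_distrib)
      ultimately show ?thesis by (simp only:)
    qed
    have "((\<lambda>x. S (\<phi> x)) has_real_derivative ((sin (c * (\<phi> x - a)))\<^sup>2 - 2 * \<kappa>) * d x) (at x)"
      using x u v by (intro DERIV_chain2[OF dS] phi_deriv) auto
    then show "((\<lambda>x. S (\<phi> x)) has_vector_derivative d x * ((bump a b (\<phi> x))\<^sup>2 - 2 * \<kappa>)) (at x)"
      using bump_inside[OF y] by (simp add: c_def has_real_derivative_iff_has_vector_derivative mult.commute)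
  qed (use uv in auto)
  moreover have "S (\<phi> v) - S (\<phi> u) = (b - a) * (1 / 2 - 2 * \<kappa>)"
  proof -
    have "c * (b - a) = pi" using ab(2) by (simp add: c_def)
    then show ?thesis unfolding S_def u v by (simp add: algebra_simps diff_divide_distrib)
  qed
  ultimately have I: "((\<lambda>x. d x * ((bump a b (\<phi> x))\<^sup>2 - 2 * \<kappa>)) has_integral (b - a) * (1 / 2 - 2 * \<kappa>)) {u..v}"
    by simp
  have sub: "{u..v} \<subseteq> {0..1}" using u v by auto
  have mi: "(\<lambda>x. d x * (spline coeffs x)\<^sup>2) integrable_on {u..v}"
    by (rule integrable_subinterval_real[OF mass_integrable sub])
  have "(b - a) * (1 / 2 - 2 * \<kappa>) = integral {u..v} (\<lambda>x. d x * ((bump a b (\<phi> x))\<^sup>2 - 2 * \<kappa>))"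
    using I by (simp add: integral_unique)
  also have "\<dots> \<le> integral {u..v} (\<lambda>x. d x * (spline coeffs x)\<^sup>2)"
  proof (rule integral_le[OF _ mi])
    show "(\<lambda>x. d x * ((bump a b (\<phi> x))\<^sup>2 - 2 * \<kappa>)) integrable_on {u..v}" using I by blast
    fix x assume x: "x \<in> {u..v}"
    have x01: "x \<in> {0..1}" using x sub by blast
    have y: "a \<le> \<phi> x" "\<phi> x \<le> b" using phi_mono[of u x] phi_mono[of x v] u v x by auto
    define s e where "s = bump a b (\<phi> x)" and "e = spline coeffs x - bump a b (\<phi> x)"
    have "\<bar>e\<bar> \<le> \<kappa>" unfolding e_def \<kappa>_def by (rule spline_close[OF x01 y])
    moreover have "\<bar>s\<bar> \<le> 1" unfolding s_def by (rule abs_bump_le_1)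
    ultimately have "\<bar>s\<bar> * \<bar>e\<bar> \<le> 1 * \<kappa>" by (intro mult_mono) auto
    then have "\<bar>s * e\<bar> \<le> \<kappa>" by (simp add: abs_mult)
    then have "- \<kappa> \<le> s * e" by (simp add: abs_le_iff)
    moreover have "(spline coeffs x)\<^sup>2 = s\<^sup>2 + 2 * (s * e) + e\<^sup>2"
      by (simp add: s_def e_def power2_eq_square algebra_simps)
    ultimately have "s\<^sup>2 - 2 * \<kappa> \<le> (spline coeffs x)\<^sup>2" using zero_le_power2[of e] by linarith
    then show "d x * ((bump a b (\<phi> x))\<^sup>2 - 2 * \<kappa>) \<le> d x * (spline coeffs x)\<^sup>2"
      unfolding s_def using d_pos[OF x01] by (intro mult_left_mono) auto
  qed
  also have "\<dots> \<le> integral {0..1} (\<lambda>x. d x * (spline coeffs x)\<^sup>2)"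
    by (rule integral_subset_le[OF sub mi mass_integrable]) (use d_pos in \<open>auto simp: less_imp_le\<close>)
  finally show ?thesis .
qed

end

context galerkin
begin

text \<open>The test space: \<open>k\<close> bumps with disjoint supports, one over each interval
  \<open>[j/k, (j+1)/k]\<close>. Both forms are diagonal in them, so one bump decides the Rayleigh quotient.\<close>

lemma eigval_le_bumps:
  assumes B: "\<And>x. x \<in> {0..1} \<Longrightarrow> d x \<le> B" and \<eta>: "0 < \<eta>"
    and osc: "\<And>x y. x \<in> {0..1} \<Longrightarrow> y \<in> {0..1} \<Longrightarrow> \<bar>x - y\<bar> \<le> (real p + 1) / real n \<Longrightarrow> d y \<le> (1 + \<eta>) * d x"
    and D: "D = (real p + 1) * B" and k: "1 \<le> k" "k \<le> ndof"
    and L: "L = 1 / real k - 2 * (D / real n)" "0 < L" and \<kappa>: "\<kappa> = pi / L * (D / real n)" "4 * \<kappa> < 1"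
  shows "eigval \<phi> p n k \<le> (1 + \<eta>) * pi\<^sup>2 / (L\<^sup>2 * (1 - 4 * \<kappa>))"
proof -
  have nn: "real n > 0" and kk: "real k > 0" using n k by auto
  define a where "a j = real j / real k + D / real n" for j
  define b where "b j = real (Suc j) / real k - D / real n" for j
  have ba: "b j - a j = L" for j
    unfolding a_def b_def L by (simp add: add_divide_distrib)
  have bump: "galerkin_bump n p \<phi> B \<eta> (a j) (b j) D" if j: "j < k" for j
  proof
    have "real (Suc j) / real k \<le> 1" using j kk by simp
    then show "b j \<le> 1 - D / real n" by (simp add: b_def)
    show "D / real n \<le> a j" using kk by (simp add: a_def)
    show "a j < b j" using ba[of j] L(2) by linarith
  qed (use B \<eta> osc D in auto)
  define w where "w j = galerkin_bump.coeffs n p \<phi> (a j) (b j)" for j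
  define Eb where "Eb = (1 + \<eta>) * (pi\<^sup>2 / (2 * L))"
  define Mb where "Mb = L * (1 / 2 - 2 * \<kappa>)"
  have Mb: "0 < Mb" using L(2) \<kappa>(2) by (simp add: Mb_def)
  have en: "integral {0..1} (\<lambda>x. 1 / d x * (spline_deriv (w j) x)\<^sup>2) \<le> Eb" if "j < k" for j
    using galerkin_bump.energy_le[OF bump[OF that]] unfolding w_def Eb_def ba .
  have ma: "Mb \<le> integral {0..1} (\<lambda>x. d x * (spline (w j) x)\<^sup>2)" if "j < k" for j
    using galerkin_bump.mass_ge[OF bump[OF that]] unfolding w_def Mb_def ba \<kappa>(1) .
  have same: "i = j" if "real i / real k < y" "y < real (Suc i) / real k" "real j / real k < y" "y < real (Suc j) / real k" for i j y
  proof -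
    have "real i < y * real k" "y * real k < real (Suc i)" "real j < y * real k" "y * real k < real (Suc j)"
      using that kk by (auto simp: field_simps)
    then have "real i < real (Suc j)" "real j < real (Suc i)" by linarith+
    then show ?thesis by linarith
  qed
  have disj: "spline (w i) x * spline (w j) x = 0" if "i < k" "j < k" "i \<noteq> j" "x \<in> {0..1}" for i j x
  proof (rule ccontr)
    assume "spline (w i) x * spline (w j) x \<noteq> 0"
    then have nz: "spline (w i) x \<noteq> 0" "spline (w j) x \<noteq> 0" by auto
    show False
      using same[of i "\<phi> x" j] galerkin_bump.spline_support[OF bump[OF that(1)] that(4)] nz
        galerkin_bump.spline_support[OF bump[OF that(2)] that(4)] that(3)
      unfolding w_def by (simp add: a_def b_def)
  qed
  have disj': "spline_deriv (w i) x * spline_deriv (w j) x = 0" if "i < k" "j < k" "i \<noteq> j" "x \<in> {0..1} - nodes" for i j x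
  proof (rule ccontr)
    assume "spline_deriv (w i) x * spline_deriv (w j) x \<noteq> 0"
    then have nz: "spline_deriv (w i) x \<noteq> 0" "spline_deriv (w j) x \<noteq> 0" by auto
    show False
      using same[of i "\<phi> x" j] galerkin_bump.spline_deriv_support[OF bump[OF that(1)] that(4)] nz
        galerkin_bump.spline_deriv_support[OF bump[OF that(2)] that(4)] that(3)
      unfolding w_def by (simp add: a_def b_def)
  qed
  define W where "W = Matrix.mat ndof k (\<lambda>(i, j). w j i)"
  have W: "W \<in> carrier_mat ndof k" by (simp add: W_def)
  have "pencil.evs ! (k - 1) \<le> Eb / Mb"
  proof (rule pencil.eigenvalue_le[OF k W])
    fix \<alpha> :: "real Matrix.vec" assume \<alpha>: "\<alpha> \<in> carrier_vec k" "\<alpha> \<noteq> 0\<^sub>v k"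
    define v where "v = W *\<^sub>v \<alpha>"
    have v: "v \<in> carrier_vec ndof" using W \<alpha> by (simp add: v_def)
    have vi: "v $ i = (\<Sum>j<k. \<alpha> $ j * w j i)" if "i < ndof" for i
      using that \<alpha>(1) by (auto simp: v_def W_def scalar_prod_def lessThan_atLeast0 mult.commute intro!: sum.cong)
    have sp: "spline (\<lambda>i. v $ i) x = (\<Sum>j<k. \<alpha> $ j * spline (w j) x)" for x
      unfolding spline_def using vi
      by (simp add: sum_distrib_left sum_distrib_right mult.assoc sum.swap[of _ "{..<k}"])
    have sd: "spline_deriv (\<lambda>i. v $ i) x = (\<Sum>j<k. \<alpha> $ j * spline_deriv (w j) x)" for x
      unfolding spline_deriv_def using vi
      by (simp add: sum_distrib_left sum_distrib_right mult.assoc sum.swap[of _ "{..<k}"])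
    define s where "s = (\<Sum>j<k. (\<alpha> $ j)\<^sup>2)"
    have s: "0 < s"
    proof -
      obtain j where "j < k" "\<alpha> $ j \<noteq> 0" using \<alpha> by (metis eq_vecI carrier_vecD index_zero_vec)
      then show ?thesis unfolding s_def by (intro sum_pos2[of _ j]) auto
    qed
    have "qform M v = integral {0..1} (\<lambda>x. d x * (\<Sum>j<k. \<alpha> $ j * spline (w j) x)\<^sup>2)"
      unfolding M_form[OF v] sp ..
    also have "\<dots> = integral {0..1} (\<lambda>x. \<Sum>j<k. (\<alpha> $ j)\<^sup>2 * (d x * (spline (w j) x)\<^sup>2))"
    proof (rule Henstock_Kurzweil_Integration.integral_cong)
      fix x :: real assume x: "x \<in> {0..1}"
      have "(\<Sum>j<k. \<alpha> $ j * spline (w j) x)\<^sup>2 = (\<Sum>j<k. (\<alpha> $ j * spline (w j) x)\<^sup>2)"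
        using disj x by (intro sum_square_of_disjoint) auto
      then show "d x * (\<Sum>j<k. \<alpha> $ j * spline (w j) x)\<^sup>2 = (\<Sum>j<k. (\<alpha> $ j)\<^sup>2 * (d x * (spline (w j) x)\<^sup>2))"
        by (simp add: sum_distrib_left power_mult_distrib mult_ac)
    qed
    also have "\<dots> = (\<Sum>j<k. (\<alpha> $ j)\<^sup>2 * integral {0..1} (\<lambda>x. d x * (spline (w j) x)\<^sup>2))"
      by (subst integral_sum) (auto intro!: integrable_on_mult_right mass_integrable)
    finally have mass: "qform M v = (\<Sum>j<k. (\<alpha> $ j)\<^sup>2 * integral {0..1} (\<lambda>x. d x * (spline (w j) x)\<^sup>2))" .
    have "s * Mb \<le> qform M v"
      unfolding mass s_def sum_distrib_right using ma by (intro sum_mono mult_left_mono) auto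
    moreover have "qform K v \<le> s * Eb"
    proof -
      have "qform K v = integral {0..1} (\<lambda>x. 1 / d x * (\<Sum>j<k. \<alpha> $ j * spline_deriv (w j) x)\<^sup>2)"
        unfolding K_form[OF v] sd ..
      also have "\<dots> = integral {0..1} (\<lambda>x. \<Sum>j<k. (\<alpha> $ j)\<^sup>2 * (1 / d x * (spline_deriv (w j) x)\<^sup>2))"
      proof (rule integral_spike[OF negligible_finite[OF finite_nodes]])
        fix x :: real assume x: "x \<in> {0..1} - nodes"
        have "(\<Sum>j<k. \<alpha> $ j * spline_deriv (w j) x)\<^sup>2 = (\<Sum>j<k. (\<alpha> $ j * spline_deriv (w j) x)\<^sup>2)"
          using disj' x by (intro sum_square_of_disjoint) auto
        then show "(\<Sum>j<k. (\<alpha> $ j)\<^sup>2 * (1 / d x * (spline_deriv (w j) x)\<^sup>2)) = 1 / d x * (\<Sum>j<k. \<alpha> $ j * spline_deriv (w j) x)\<^sup>2"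
          by (simp add: sum_distrib_left sum_divide_distrib power_mult_distrib mult_ac)
      qed
      also have "\<dots> = (\<Sum>j<k. (\<alpha> $ j)\<^sup>2 * integral {0..1} (\<lambda>x. 1 / d x * (spline_deriv (w j) x)\<^sup>2))"
      proof -
        have "(\<lambda>x. (\<alpha> $ j)\<^sup>2 * (1 / d x * (spline_deriv (w j) x)\<^sup>2)) integrable_on {0..1}" for j
          by (intro integrable_on_mult_right energy_integrable)
        then show ?thesis by (subst integral_sum) (simp_all only: finite_lessThan Henstock_Kurzweil_Integration.integral_mult_right)
      qed
      also have "\<dots> \<le> s * Eb"
        unfolding s_def sum_distrib_right using en by (intro sum_mono mult_left_mono) auto
      finally show ?thesis .
    qed
    moreover have "0 < s * Mb" using s Mb by simp
    moreover have "s * Eb \<le> Eb / Mb * qform M v"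
    proof -
      have "0 \<le> Eb / Mb" using \<eta> L(2) Mb by (simp add: Eb_def)
      then have "Eb / Mb * (s * Mb) \<le> Eb / Mb * qform M v"
        using \<open>s * Mb \<le> qform M v\<close> by (intro mult_left_mono)
      then show ?thesis using Mb by (simp add: mult.commute)
    qed
    ultimately show "0 < qform M (W *\<^sub>v \<alpha>) \<and>
      qform K (W *\<^sub>v \<alpha>) \<le> Eb / Mb * qform M (W *\<^sub>v \<alpha>)"
      unfolding v_def[symmetric] by linarith
  qed
  also have "Eb / Mb = (1 + \<eta>) * pi\<^sup>2 / (L\<^sup>2 * (1 - 4 * \<kappa>))"
  proof -
    have "Mb = L * (1 - 4 * \<kappa>) / 2" by (simp add: Mb_def field_simps)
    then show ?thesis unfolding Eb_def using L(2) \<kappa>(2) by (simp add: power2_eq_square)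
  qed
  finally show ?thesis unfolding eigval_eq .
qed

text \<open>The bound of the bumps in terms of \<open>t\<close>, the ratio of the margin \<open>D/n\<close> to the length \<open>1/k\<close> of the
  intervals: the arches have length \<open>L = (1 - 2 t)/k\<close>, and both \<open>L\<close> and \<open>\<kappa>\<close> lose at most a multiple
  of \<open>t\<close>.\<close>

lemma eigval_le_square:
  assumes B: "\<And>x. x \<in> {0..1} \<Longrightarrow> d x \<le> B" "1 \<le> B" and \<eta>: "0 < \<eta>"
    and osc: "\<And>x y. x \<in> {0..1} \<Longrightarrow> y \<in> {0..1} \<Longrightarrow> \<bar>x - y\<bar> \<le> (real p + 1) / real n \<Longrightarrow> d y \<le> (1 + \<eta>) * d x"
    and k: "1 \<le> k" and \<delta>: "2 * (2 + 4 * pi) * ((real p + 1) * B * real k / real n) \<le> \<eta> / (1 + \<eta>)"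
  shows "k \<le> ndof \<and> eigval \<phi> p n k \<le> (real k * pi)\<^sup>2 * (1 + \<eta>)\<^sup>2"
proof -
  have nn: "real n > 0" and kk: "real k > 0" using n k by auto
  define D where "D = (real p + 1) * B"
  define t where "t = D * real k / real n"
  have D1: "2 \<le> D" unfolding D_def using mult_mono[of 2 "real p + 1" 1 B] p B(2) by auto
  have t0: "0 < t" using D1 kk nn by (simp add: t_def)
  have frac: "\<eta> / (1 + \<eta>) < 1" "0 < \<eta> / (1 + \<eta>)" using \<eta> by auto
  have td: "2 * (2 + 4 * pi) * t \<le> \<eta> / (1 + \<eta>)" using \<delta> unfolding t_def D_def .
  then have tpi: "4 * t + 8 * (pi * t) \<le> \<eta> / (1 + \<eta>)" by (simp add: algebra_simps)
  have pt: "0 < pi * t" using t0 by simp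
  have t4: "4 * t < 1" using tpi pt frac by linarith
  have "2 * real k \<le> D * real k" using D1 by (intro mult_right_mono) auto
  also have "D * real k = t * real n" using nn by (simp add: t_def)
  finally have "8 * real k \<le> 4 * t * real n" by simp
  also have "\<dots> \<le> 1 * real n" using t4 by (intro mult_right_mono) auto
  finally have kn: "k \<le> ndof" unfolding ndof_eq using n p by linarith
  define L where "L = 1 / real k - 2 * (D / real n)"
  have Lk: "L = (1 - 2 * t) / real k" using kk nn by (simp add: L_def t_def field_simps)
  have L0: "0 < L" unfolding Lk using kk t4 t0 by simp
  define \<kappa> where "\<kappa> = pi / L * (D / real n)"
  have \<kappa>t: "\<kappa> = pi * t / (1 - 2 * t)" 
  proof -
    have "D / real n = t / real k" using kk nn by (simp add: t_def)
    then show ?thesis unfolding \<kappa>_def Lk using kk by simp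
  qed
  have q: "(1 - 2 * t)\<^sup>2 * (1 - 4 * \<kappa>) = (1 - 2 * t) * (1 - 2 * t - 4 * (pi * t))"
    unfolding \<kappa>t using t4 t0 by (simp add: power2_eq_square field_simps)
  (* Dropping the positive quadratic terms leaves 1 - 4 t - 4 pi t, even more than claimed. *)
  have "1 - (4 * t + 8 * (pi * t)) \<le> (1 - 2 * t) * (1 - 2 * t - 4 * (pi * t))"
  proof -
    have "(1 - 2 * t) * (1 - 2 * t - 4 * (pi * t)) = 1 - 4 * t - 4 * (pi * t) + 4 * (t * t) + 8 * (t * (pi * t))"
      by (simp add: algebra_simps)
    moreover have "0 \<le> t * t" "0 \<le> t * (pi * t)" using t0 pt by auto
    ultimately show ?thesis using pt by linarith
  qed
  moreover have "1 - \<eta> / (1 + \<eta>) = 1 / (1 + \<eta>)" using \<eta> by (simp add: field_simps)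
  ultimately have Q: "1 / (1 + \<eta>) \<le> (1 - 2 * t)\<^sup>2 * (1 - 4 * \<kappa>)" unfolding q using tpi by linarith
  have Qpos: "0 < (1 - 2 * t)\<^sup>2 * (1 - 4 * \<kappa>)" using Q \<eta> by (intro less_le_trans[OF _ Q]) auto
  then have \<kappa>1: "4 * \<kappa> < 1" by (simp add: zero_less_mult_iff)
  have "eigval \<phi> p n k \<le> (1 + \<eta>) * pi\<^sup>2 / (L\<^sup>2 * (1 - 4 * \<kappa>))"
    by (rule eigval_le_bumps[OF B(1) \<eta> osc D_def k kn L_def L0 \<kappa>_def \<kappa>1])
  also have "\<dots> = (1 + \<eta>) * (real k * pi)\<^sup>2 * (1 / ((1 - 2 * t)\<^sup>2 * (1 - 4 * \<kappa>)))"
    unfolding Lk using kk by (simp add: power_divide power_mult_distrib)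
  also have "\<dots> \<le> (1 + \<eta>) * (real k * pi)\<^sup>2 * (1 + \<eta>)"
  proof (rule mult_left_mono)
    show "1 / ((1 - 2 * t)\<^sup>2 * (1 - 4 * \<kappa>)) \<le> 1 + \<eta>"
      using Q Qpos \<eta> by (simp add: divide_le_eq le_divide_eq mult.commute)
  qed (use \<eta> in auto)
  finally show ?thesis using kn by (simp add: power2_eq_square mult_ac)
qed

end

text \<open>For small \<open>k/n\<close> the margins are negligible against the lengths of the arches, and for large \<open>n\<close> the
  derivative of \<open>\<phi>\<close> is nearly constant on the support of a B-spline, by uniform continuity.\<close>

lemma eigval_le_square_eventually:
  assumes \<phi>: "\<phi> \<in> C01" and p: "1 \<le> p" and \<eta>: "0 < \<eta>"
  shows "\<exists>\<epsilon>>0. \<forall>\<^sub>F n in sequentially. \<forall>k. 1 \<le> k \<and> real k \<le> \<epsilon> * real n \<longrightarrow>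
      k \<le> sysdim p n \<and> eigval \<phi> p n k \<le> (real k * pi)\<^sup>2 * (1 + \<eta>)"
proof -
  let ?d = "deriv01 \<phi>"
  have cont: "continuous_on {0..1} ?d" using C01_D(1)[OF \<phi>] .
  obtain xM where xM: "xM \<in> {0..1}" "\<And>x. x \<in> {0..1} \<Longrightarrow> ?d x \<le> ?d xM"
    using continuous_attains_sup[OF compact_Icc _ cont] by fastforce
  obtain xm where xm: "xm \<in> {0..1}" "\<And>x. x \<in> {0..1} \<Longrightarrow> ?d xm \<le> ?d x"
    using continuous_attains_inf[OF compact_Icc _ cont] by fastforce
  define B where "B = max 1 (?d xM)"
  have B: "\<And>x. x \<in> {0..1} \<Longrightarrow> ?d x \<le> B" "1 \<le> B" using xM by (auto simp: B_def le_max_iff_disj)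
  define h where "h = min 1 (\<eta> / 3)"
  have h: "0 < h" using \<eta> by (simp add: h_def)
  have h2: "(1 + h)\<^sup>2 \<le> 1 + \<eta>"
  proof -
    have "h \<le> 1" "3 * h \<le> \<eta>" by (auto simp: h_def)
    moreover have "h * h \<le> 1 * h" using h \<open>h \<le> 1\<close> by (intro mult_right_mono) auto
    ultimately show ?thesis by (simp add: power2_eq_square algebra_simps)
  qed
  have m: "0 < ?d xm" using C01_D(3)[OF \<phi> xm(1)] .
  have "uniformly_continuous_on {0..1} ?d" using cont by (intro compact_uniformly_continuous) auto
  then obtain \<rho> where \<rho>: "0 < \<rho>" "\<And>x y. x \<in> {0..1} \<Longrightarrow> y \<in> {0..1} \<Longrightarrow> dist y x < \<rho> \<Longrightarrow> dist (?d y) (?d x) < h * ?d xm"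
    using m h unfolding uniformly_continuous_on_def by (metis mult_pos_pos)
  define X where "X = 2 * (2 + 4 * pi) * ((real p + 1) * B)"
  define \<epsilon> where "\<epsilon> = h / (1 + h) / X"
  have C: "0 < X" unfolding X_def using B(2) by (intro mult_pos_pos) (auto intro: add_pos_pos)
  have \<epsilon>: "0 < \<epsilon>" unfolding \<epsilon>_def using h C by (intro divide_pos_pos) auto
  have "(\<lambda>n. (real p + 1) * (1 / real n)) \<longlonglongrightarrow> (real p + 1) * 0" by (intro tendsto_intros lim_1_over_n)
  then have "\<forall>\<^sub>F n in sequentially. (real p + 1) * (1 / real n) < \<rho>" using \<rho>(1) by (intro order_tendstoD(2)) auto
  then have "\<forall>\<^sub>F n in sequentially. \<forall>k. 1 \<le> k \<and> real k \<le> \<epsilon> * real n \<longrightarrow>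
      k \<le> sysdim p n \<and> eigval \<phi> p n k \<le> (real k * pi)\<^sup>2 * (1 + \<eta>)"
    using eventually_ge_at_top[of 2]
  proof eventually_elim
    case (elim n)
    interpret galerkin n p \<phi> using elim p \<phi> by unfold_locales auto
    show ?case
    proof (intro allI impI)
      fix k assume k: "1 \<le> k \<and> real k \<le> \<epsilon> * real n"
      have nn: "real n > 0" using elim by simp
      have "k \<le> sysdim p n \<and> eigval \<phi> p n k \<le> (real k * pi)\<^sup>2 * (1 + h)\<^sup>2"
      proof (rule eigval_le_square[OF B h])
        fix x y :: real assume xy: "x \<in> {0..1}" "y \<in> {0..1}" "\<bar>x - y\<bar> \<le> (real p + 1) / real n"
        then have "dist y x < \<rho>" using elim(1) by (simp add: dist_real_def abs_minus_commute)
        then have "dist (?d y) (?d x) < h * ?d xm" using \<rho>(2) xy by blast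
        then have "?d y \<le> ?d x + h * ?d xm" by (simp add: dist_real_def)
        also have "\<dots> \<le> ?d x + h * ?d x" using xm(2)[OF xy(1)] h by simp
        finally show "?d y \<le> (1 + h) * ?d x" by (simp add: algebra_simps)
      next
        have "X * (real k / real n) \<le> X * \<epsilon>"
          using C k nn by (intro mult_left_mono) (auto simp: divide_le_eq)
        also have "\<dots> = h / (1 + h)" unfolding \<epsilon>_def using C by simp
        finally show "2 * (2 + 4 * pi) * ((real p + 1) * B * real k / real n) \<le> h / (1 + h)"
          by (simp add: X_def)
      qed (use k in auto)
      moreover have "(real k * pi)\<^sup>2 * (1 + h)\<^sup>2 \<le> (real k * pi)\<^sup>2 * (1 + \<eta>)" using h2 by (intro mult_left_mono) auto
      ultimately show "k \<le> sysdim p n \<and> eigval \<phi> p n k \<le> (real k * pi)\<^sup>2 * (1 + \<eta>)" by linarith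
    qed
  qed
  then show ?thesis using \<epsilon> by blast
qed

section \<open>Positivity and continuity of the symbol\<close>

lemma sum_symmetric_split:
  fixes f :: "nat \<Rightarrow> real"
  shows "(\<Sum>k\<le>2 * n. f k) = f n + (\<Sum>j = 1..n. f (n - j) + f (n + j))"
proof (induction n arbitrary: f)
  case (Suc n)
  have "2 * Suc n = Suc (Suc (2 * n))" by simp
  then have "(\<Sum>k\<le>2 * Suc n. f k) = (\<Sum>k\<le>Suc (2 * n). f k) + f (2 * n + 2)"
    by (simp only: sum.atMost_Suc) simp
  also have "(\<Sum>k\<le>Suc (2 * n). f k) = f 0 + (\<Sum>k\<le>2 * n. f (Suc k))"
    by (rule sum.atMost_Suc_shift)
  also have "(\<Sum>k\<le>2 * n. f (Suc k)) = f (Suc n) + (\<Sum>j = 1..n. f (Suc (n - j)) + f (Suc (n + j)))"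
    by (rule Suc.IH)
  also have "(\<Sum>j = 1..n. f (Suc (n - j)) + f (Suc (n + j))) = (\<Sum>j = 1..n. f (Suc n - j) + f (Suc n + j))"
    by (intro sum.cong) (auto simp: Suc_diff_le)
  finally show ?case by (simp add: mult_2)
qed simp

text \<open>The trigonometric polynomial with the values of the degree-\<open>q\<close> cardinal B-spline at the
  integers as coefficients, centred at the midpoint of the support.\<close>

definition spline_symbol :: "nat \<Rightarrow> real \<Rightarrow> real" where
  "spline_symbol q \<theta> = (\<Sum>k\<le>q + 1. cardinal_bspline q (real k) * cos ((real k - (real q + 1) / 2) * \<theta>))"

text \<open>The weights of the B-spline recursion are affine in the index; the constant part of the weights
  produces the factor \<open>cos (\<theta>/2)\<close>, the linear part the derivative in \<open>\<theta>\<close>.\<close>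

lemma spline_symbol_Suc:
  assumes D: "(spline_symbol q has_real_derivative D) (at \<theta>)"
  shows "spline_symbol (Suc q) \<theta> = cos (\<theta> / 2) * spline_symbol q \<theta> - 2 / (real q + 1) * sin (\<theta> / 2) * D"
proof -
  define N where "N k = cardinal_bspline q (real k)" for k
  define m where "m k = real k - (real q + 1) / 2" for k :: nat
  define Q where "Q = real q + 1"
  have Q: "Q > 0" by (simp add: Q_def)
  have sym: "spline_symbol q \<theta> = (\<Sum>k\<le>q + 1. N k * cos (m k * \<theta>))"
    unfolding spline_symbol_def N_def m_def ..
  have "(spline_symbol q has_real_derivative (\<Sum>k\<le>q + 1. N k * (- sin (m k * \<theta>) * m k))) (at \<theta>)"
    unfolding spline_symbol_def[abs_def] N_def m_def
    by (auto intro!: derivative_eq_intros sum.cong)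
  then have D': "D = (\<Sum>k\<le>q + 1. N k * (- sin (m k * \<theta>) * m k))"
    using D DERIV_unique by blast
  have N_end: "N (q + 1) = 0" unfolding N_def by (intro cardinal_bspline_support) auto
  have N_end2: "N (q + 2) = 0" unfolding N_def by (intro cardinal_bspline_support) auto
  define c where "c k = cos ((real k - (Q + 1) / 2) * \<theta>)" for k
  have "spline_symbol (Suc q) \<theta> = (\<Sum>k\<le>q + 2. (real k / Q * N k + (Q + 1 - real k) / Q * cardinal_bspline q (real k - 1)) * c k)"
  proof -
    have "real (Suc q) = Q" "Suc q + 1 = q + 2" by (simp_all add: Q_def)
    then show ?thesis
      unfolding spline_symbol_def c_def N_def cardinal_bspline.simps(2) by (simp only:)
  qed
  also have "\<dots> = (\<Sum>k\<le>q + 2. real k / Q * N k * c k) + (\<Sum>k\<le>q + 2. (Q + 1 - real k) / Q * cardinal_bspline q (real k - 1) * c k)"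
    by (simp add: sum.distrib[symmetric] distrib_right del: sum.atMost_Suc)
  also have "(\<Sum>k\<le>q + 2. real k / Q * N k * c k) = (\<Sum>k\<le>q + 1. real k / Q * N k * c k)"
    using N_end2 by simp
  also have "(\<Sum>k\<le>q + 2. (Q + 1 - real k) / Q * cardinal_bspline q (real k - 1) * c k)
      = (\<Sum>k\<le>q + 1. (Q - real k) / Q * N k * c (Suc k))"
    using cardinal_bspline_support[of "-1" q]
    by (simp add: sum.atMost_Suc_shift N_def del: sum.atMost_Suc)
  also have "(\<Sum>k\<le>q + 1. real k / Q * N k * c k) + \<dots> =
      (\<Sum>k\<le>q + 1. cos (\<theta> / 2) * (N k * cos (m k * \<theta>)) - 2 / Q * sin (\<theta> / 2) * (N k * (- sin (m k * \<theta>) * m k)))"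
    unfolding sum.distrib[symmetric]
  proof (intro sum.cong refl)
    fix k
    have "(real k - (Q + 1) / 2) * \<theta> = m k * \<theta> - \<theta> / 2"
      by (simp add: m_def Q_def field_simps)
    then have c1: "c k = cos (m k * \<theta>) * cos (\<theta> / 2) + sin (m k * \<theta>) * sin (\<theta> / 2)"
      unfolding c_def cos_diff[symmetric] by simp
    have "(real (Suc k) - (Q + 1) / 2) * \<theta> = m k * \<theta> + \<theta> / 2"
      by (simp add: m_def Q_def field_simps)
    then have c2: "c (Suc k) = cos (m k * \<theta>) * cos (\<theta> / 2) - sin (m k * \<theta>) * sin (\<theta> / 2)"
      unfolding c_def cos_add[symmetric] by simp
    have k: "real k = m k + Q / 2" by (simp add: m_def Q_def)
    show "real k / Q * N k * c k + (Q - real k) / Q * N k * c (Suc k) =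
        cos (\<theta> / 2) * (N k * cos (m k * \<theta>)) - 2 / Q * sin (\<theta> / 2) * (N k * (- sin (m k * \<theta>) * m k))"
      unfolding c1 c2 k using Q by (simp add: field_simps)
  qed
  also have "\<dots> = cos (\<theta> / 2) * spline_symbol q \<theta> - 2 / Q * sin (\<theta> / 2) * D"
    unfolding sym D' by (simp only: sum_subtractf sum_distrib_left)
  finally show ?thesis unfolding Q_def .
qed

text \<open>In the variable \<open>s = cos (\<theta>/2)\<close> the recursion reads \<open>E\<^bsub>q+1\<^esub> = s E\<^sub>q + (1 - s\<^sup>2) E\<^sub>q' / (q + 1)\<close>. As long as
  the degree is below \<open>q + 1\<close>, it maps polynomials with nonnegative coefficients to such polynomials,
  and it moves a positive coefficient back and forth between \<open>s\<^sup>0\<close> and \<open>s\<^sup>1\<close>. These are Eulerian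
  polynomials in disguise.\<close>

lemma spline_symbol_polynomial:
  assumes "q \<ge> 1"
  shows "\<exists>E :: real poly. (\<forall>i\<ge>q. coeff E i = 0) \<and> (\<forall>i. coeff E i \<ge> 0) \<and>
     coeff E (if odd q then 0 else 1) > 0 \<and> (\<forall>\<theta>. spline_symbol q \<theta> = poly E (cos (\<theta> / 2)))"
  using assms
proof (induction q rule: dec_induct)
  case base
  have "spline_symbol 1 \<theta> = 1" for \<theta>
    unfolding spline_symbol_def cardinal_bspline_1 by (simp add: numeral_2_eq_2)
  then show ?case by (intro exI[of _ 1]) (auto simp: coeff_eq_0)
next
  case (step q)
  then obtain E :: "real poly" where E: "\<And>i. i \<ge> q \<Longrightarrow> coeff E i = 0" "\<And>i. coeff E i \<ge> 0"
    "coeff E (if odd q then 0 else 1) > 0" "\<And>\<theta>. spline_symbol q \<theta> = poly E (cos (\<theta> / 2))"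
    by blast
  define R where "R = 1 / (real q + 1)"
  define F where "F = pCons 0 E + Polynomial.smult R (pderiv E - pCons 0 (pCons 0 (pderiv E)))"
  have c0: "coeff F 0 = R * coeff E 1"
    by (simp add: F_def coeff_pderiv)
  have c1: "coeff F (Suc 0) = coeff E 0 + R * (2 * coeff E 2)"
    by (simp add: F_def coeff_pderiv numeral_2_eq_2)
  have c2: "coeff F (Suc (Suc i)) = (1 - (real i + 1) * R) * coeff E (Suc i)
      + R * ((real i + 3) * coeff E (i + 3))" for i
    by (simp add: F_def coeff_pderiv numeral_3_eq_3 algebra_simps)
  have R0: "R > 0" by (simp add: R_def)
  have "coeff F i \<ge> 0" for i
  proof (cases i)
    case 0
    then show ?thesis using E(2)[of 1] c0 R0 by simp
  next
    case (Suc j)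
    show ?thesis
    proof (cases j)
      case 0
      then show ?thesis using E(2)[of 0] E(2)[of 2] c1 Suc R0 by simp
    next
      case (Suc l)
      show ?thesis
      proof (cases "l < q")
        case True
        then have "0 \<le> 1 - (real l + 1) * R" by (simp add: R_def field_simps)
        then show ?thesis using E(2)[of "Suc l"] E(2)[of "l + 3"] \<open>i = Suc j\<close> Suc R0 by (simp add: c2)
      next
        case False
        then show ?thesis using E(1)[of "Suc l"] E(1)[of "l + 3"] \<open>i = Suc j\<close> Suc R0 by (simp add: c2)
      qed
    qed
  qed
  moreover have "coeff F i = 0" if "i \<ge> Suc q" for i
  proof (cases i)
    case (Suc j)
    show ?thesis
    proof (cases j)
      case 0
      then show ?thesis using that Suc step.hyps by simp
    next
      case l: (Suc l)
      then show ?thesis using E(1)[of "Suc l"] E(1)[of "l + 3"] that Suc by (simp add: c2)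
    qed
  qed (use that in simp)
  moreover have "coeff F (if odd (Suc q) then 0 else 1) > 0"
    using E(3) E(2)[of 2] R0 by (auto simp: c0 c1 split: if_splits intro!: add_pos_nonneg)
  moreover have "spline_symbol (Suc q) \<theta> = poly F (cos (\<theta> / 2))" for \<theta>
  proof -
    have fe: "spline_symbol q = (\<lambda>\<theta>. poly E (cos (\<theta> / 2)))" using E(4) by blast
    have "(spline_symbol q has_real_derivative poly (pderiv E) (cos (\<theta> / 2)) * (- sin (\<theta> / 2) * (1 / 2))) (at \<theta>)"
      unfolding fe by (rule DERIV_chain2[OF poly_DERIV]) (auto intro!: derivative_eq_intros)
    from spline_symbol_Suc[OF this]
    have "spline_symbol (Suc q) \<theta> = cos (\<theta> / 2) * poly E (cos (\<theta> / 2))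
        + 2 * R * sin (\<theta> / 2) * (poly (pderiv E) (cos (\<theta> / 2)) * sin (\<theta> / 2) * (1 / 2))"
      unfolding E(4) by (simp add: R_def)
    also have "\<dots> = cos (\<theta> / 2) * poly E (cos (\<theta> / 2))
        + R * (poly (pderiv E) (cos (\<theta> / 2)) * (sin (\<theta> / 2))\<^sup>2)"
      by (simp add: power2_eq_square)
    also have "\<dots> = poly F (cos (\<theta> / 2))"
      unfolding sin_squared_eq by (simp add: F_def algebra_simps power2_eq_square)
    finally show ?thesis .
  qed
  ultimately show ?case by (intro exI[of _ F]) blast
qed

text \<open>On \<open>[0, \<pi>]\<close> the variable \<open>cos (\<theta>/2)\<close> is nonnegative, so the constant coefficient is a lower bound;
  at \<open>\<theta> = \<pi>\<close>, where the coefficients of the cosines alternate in sign, it is all that is left.\<close>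

lemma spline_symbol_pos:
  assumes q: "odd q" and \<theta>: "0 \<le> \<theta>" "\<theta> \<le> pi"
  shows "0 < spline_symbol q \<theta>"
proof -
  have "q \<ge> 1" using q by (cases q) auto
  then obtain E :: "real poly" where E: "\<And>i. coeff E i \<ge> 0" "coeff E 0 > 0"
    "spline_symbol q \<theta> = poly E (cos (\<theta> / 2))"
    using spline_symbol_polynomial[of q] q by auto
  have "0 \<le> cos (\<theta> / 2)" using \<theta> by (intro cos_ge_zero) auto
  then have "0 < (\<Sum>i\<le>degree E. coeff E i * cos (\<theta> / 2) ^ i)"
    using E by (intro sum_pos2[of _ 0]) auto
  then show ?thesis unfolding E(3) poly_altdef .
qed

lemma g_symb_eq_spline_symbol: "g_symb p \<theta> = spline_symbol (2 * p + 1) \<theta>"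
proof -
  define f where "f k = cardinal_bspline (2 * p + 1) (real k) * cos ((real k - (real p + 1)) * \<theta>)" for k
  have f: "f (p + 1 - j) = cardinal_bspline (2 * p + 1) (real p + 1 - real j) * cos (real j * \<theta>)"
    "f (p + 1 + j) = f (p + 1 - j)" if "j \<le> p + 1" for j
  proof -
    have 1: "real (p + 1 - j) = real p + 1 - real j" using that by simp
    have "cos ((real p + 1 - real j - (real p + 1)) * \<theta>) = cos (real j * \<theta>)"
      by (metis add_diff_cancel_left' cos_minus diff_add_cancel minus_diff_eq mult_minus_left)
    then show a: "f (p + 1 - j) = cardinal_bspline (2 * p + 1) (real p + 1 - real j) * cos (real j * \<theta>)"
      unfolding f_def 1 by simp
    have "cardinal_bspline (2 * p + 1) (real (p + 1 + j)) = cardinal_bspline (2 * p + 1) (real p + 1 - real j)"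
      using cardinal_bspline_symmetric[of "2 * p + 1" "real p + 1 - real j"]
      by (simp add: algebra_simps del: cardinal_bspline.simps)
    then show "f (p + 1 + j) = f (p + 1 - j)"
      unfolding a by (simp add: f_def del: cardinal_bspline.simps)
  qed
  have "spline_symbol (2 * p + 1) \<theta> = (\<Sum>k\<le>2 * (p + 1). f k)"
  proof -
    have "(real (2 * p + 1) + 1) / 2 = real p + 1" "2 * p + 1 + 1 = 2 * (p + 1)" by auto
    then show ?thesis unfolding spline_symbol_def f_def by (simp only:)
  qed
  also have "\<dots> = f (p + 1) + (\<Sum>j = 1..p + 1. f (p + 1 - j) + f (p + 1 + j))"
    by (rule sum_symmetric_split)
  also have "(\<Sum>j = 1..p + 1. f (p + 1 - j) + f (p + 1 + j)) = (\<Sum>j = 1..p + 1. 2 * f (p + 1 - j))"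
    using f(2) by (intro sum.cong) auto
  also have "\<dots> = (\<Sum>j = 1..p. 2 * f (p + 1 - j)) + 2 * f 0" by simp
  also have "f 0 = 0"
  proof -
    have "cardinal_bspline (2 * p + 1) 0 = cardinal_bspline (2 * p + 1) (real (2 * p + 1) + 1)"
      using cardinal_bspline_symmetric[of "2 * p + 1" 0] by (simp del: cardinal_bspline.simps)
    also have "\<dots> = 0" by (rule cardinal_bspline_support) simp
    finally show ?thesis by (simp add: f_def del: cardinal_bspline.simps)
  qed
  also have "(\<Sum>j = 1..p. 2 * f (p + 1 - j)) = 2 * (\<Sum>j = 1..p. cardinal_bspline (2 * p + 1) (real p + 1 - real j) * cos (real j * \<theta>))"
    unfolding sum_distrib_left using f(1) by (intro sum.cong) auto
  finally show ?thesis unfolding g_symb_def by (simp add: f_def add.commute del: cardinal_bspline.simps)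
qed

lemma continuous_on_e_symb: "continuous_on {0..pi} (e_symb p)"
proof -
  have "g_symb p \<theta> \<noteq> 0" if "\<theta> \<in> {0..pi}" for \<theta>
    unfolding g_symb_eq_spline_symbol using spline_symbol_pos[of "2 * p + 1" \<theta>] that by simp
  moreover have "continuous_on {0..pi} (g_symb p)"
    unfolding g_symb_def[abs_def] by (intro continuous_intros)
  moreover have "continuous_on {0..pi} (f_symb p)"
    unfolding f_symb_def[abs_def] by (intro continuous_intros)
  ultimately show ?thesis unfolding e_symb_def[abs_def] by (intro continuous_intros) auto
qed

section \<open>The monotone rearrangement\<close>

lemma continuous_on_omega:
  assumes "\<phi> \<in> C01"
  shows "continuous_on omega_dom (omega \<phi> p)"
proof -
  have 1: "continuous_on omega_dom (\<lambda>z. e_symb p (snd z))"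
    by (rule continuous_on_compose2[OF continuous_on_e_symb])
      (auto simp: omega_dom_def intro!: continuous_intros)
  have 2: "continuous_on omega_dom (\<lambda>z. deriv01 \<phi> (fst z))"
    by (rule continuous_on_compose2[OF C01_D(1)[OF assms]])
      (auto simp: omega_dom_def intro!: continuous_intros)
  have "omega \<phi> p = (\<lambda>z. e_symb p (snd z) / (deriv01 \<phi> (fst z))\<^sup>2)"
    by (intro ext) (simp add: omega_def split: prod.splits)
  moreover have "(deriv01 \<phi> (fst z))\<^sup>2 \<noteq> 0" if "z \<in> omega_dom" for z
    using C01_D(3)[OF assms, of "fst z"] that by (auto simp: omega_dom_def)
  ultimately show ?thesis using 1 2 by (auto intro!: continuous_intros)
qed

lemma omega_dom_cbox: "omega_dom = cbox (0, 0) (1, pi)"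
  by (auto simp: omega_dom_def cbox_Pair_eq)

lemma measure_omega_dom: "measure lebesgue omega_dom = pi"
proof -
  have b: "(Basis :: (real \<times> real) set) = {(1, 0), (0, 1)}" by (auto simp: Basis_prod_def)
  show ?thesis unfolding omega_dom_cbox
    by (subst measure_completion)
       (auto simp: content_cbox_if b box_eq_empty inner_prod_def)
qed

text \<open>The distribution function of \<open>\<omega>\<close>, up to the factor \<open>\<pi>\<close>.\<close>

definition sublevel_measure :: "(real \<Rightarrow> real) \<Rightarrow> nat \<Rightarrow> real \<Rightarrow> real" where
  "sublevel_measure \<phi> p y = measure lebesgue {z \<in> omega_dom. omega \<phi> p z \<le> y}"

lemma sublevel_lmeasurable:
  assumes "\<phi> \<in> C01"
  shows "{z \<in> omega_dom. omega \<phi> p z \<le> y} \<in> lmeasurable"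
proof -
  have "closed {z \<in> omega_dom. omega \<phi> p z \<le> y}"
    using continuous_on_omega[OF assms] unfolding omega_dom_cbox
    by (intro continuous_closed_preimage_constant[of _ _, unfolded vimage_def] continuous_on_closed_Collect_le) (auto intro: closed_cbox)
  moreover have "bounded {z \<in> omega_dom. omega \<phi> p z \<le> y}"
    by (rule bounded_subset[of omega_dom]) (auto simp: omega_dom_cbox)
  ultimately show ?thesis by (intro lmeasurable_compact) (simp add: compact_eq_bounded_closed)
qed

lemma sublevel_measure_mono:
  assumes "\<phi> \<in> C01" "y \<le> y'"
  shows "sublevel_measure \<phi> p y \<le> sublevel_measure \<phi> p y'"
  unfolding sublevel_measure_def using assms
  by (intro measure_mono_fmeasurable) (auto intro: sublevel_lmeasurable fmeasurableD)

text \<open>If \<open>\<omega>\<close> attains a value strictly between the two levels, the points with values between them form a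
  nonempty relatively open subset of the rectangle. The rectangle being the closure of its interior,
  this subset contains a nonempty open set of the plane.\<close>

lemma sublevel_measure_strict:
  assumes \<phi>: "\<phi> \<in> C01" and y: "y1 < y" "y < y2" and yR: "y \<in> Rg_omega \<phi> p"
  shows "sublevel_measure \<phi> p y1 < sublevel_measure \<phi> p y2"
proof -
  obtain z0 where z0: "z0 \<in> omega_dom" "omega \<phi> p z0 = y"
    using yR unfolding Rg_omega_def by auto
  have "openin (top_of_set omega_dom) (omega_dom \<inter> omega \<phi> p -` {y1<..<y2})"
    using continuous_on_omega[OF \<phi>] by (intro continuous_openin_preimage_gen) auto
  then obtain T where T: "open T" "omega_dom \<inter> omega \<phi> p -` {y1<..<y2} = omega_dom \<inter> T"
    by (auto simp: openin_open)
  have "z0 \<in> T" using T z0 y by auto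
  moreover have "z0 \<in> closure (box (0, 0) (1, pi))"
    using z0(1) by (subst closure_box) (auto simp: omega_dom_cbox box_eq_empty Basis_prod_def inner_prod_def not_le)
  ultimately have ne: "T \<inter> box (0, 0) (1, pi) \<noteq> {}"
    using T(1) by (metis closure_iff_nhds_not_empty inf_commute interior_open interior_subset)
  define U where "U = T \<inter> box (0, 0) (1, pi)"
  have U: "open U" "U \<noteq> {}" "U \<subseteq> omega_dom"
    using T(1) ne unfolding U_def omega_dom_cbox using box_subset_cbox[of "(0, 0)" "(1 :: real, pi)"] by (auto intro: open_box)
  have Um: "U \<in> lmeasurable"
    using U bounded_subset[OF bounded_cbox U(3)[unfolded omega_dom_cbox]] by (intro lmeasurable_open) auto
  have pos: "0 < measure lebesgue U"
    using open_not_negligible[OF U(1,2)] negligible_iff_measure[of U] Um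
    by (metis measure_nonneg order_le_less)
  let ?A = "{z \<in> omega_dom. omega \<phi> p z \<le> y1}" and ?B = "{z \<in> omega_dom. omega \<phi> p z \<le> y2}"
  have "U \<subseteq> ?B - ?A"
  proof
    fix z assume z: "z \<in> U"
    then have "z \<in> omega_dom \<inter> omega \<phi> p -` {y1<..<y2}" using U(3) unfolding T(2) by (auto simp: U_def)
    then show "z \<in> ?B - ?A" by auto
  qed
  then have "measure lebesgue U \<le> measure lebesgue (?B - ?A)"
    using Um sublevel_lmeasurable[OF \<phi>] by (intro measure_mono_fmeasurable) (auto intro: fmeasurable_Diff fmeasurableD)
  also have "\<dots> = measure lebesgue ?B - measure lebesgue ?A"
    using sublevel_lmeasurable[OF \<phi>] y by (intro measurable_measure_Diff) (auto intro: fmeasurableD)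
  finally show ?thesis using pos unfolding sublevel_measure_def by simp
qed

lemma Rg_omega_interval:
  assumes "\<phi> \<in> C01"
  obtains a b where "Rg_omega \<phi> p = {a..b}" "a \<le> b"
proof -
  have "connected (Rg_omega \<phi> p)" "compact (Rg_omega \<phi> p)"
    unfolding Rg_omega_def using continuous_on_omega[OF assms]
    by (auto intro!: connected_continuous_image compact_continuous_image simp: omega_dom_cbox convex_connected)
  moreover have "Rg_omega \<phi> p \<noteq> {}"
    unfolding Rg_omega_def omega_dom_def by (auto intro: less_imp_le)
  ultimately show ?thesis using that connected_compact_interval_1[of "Rg_omega \<phi> p"] by fastforce
qed

text \<open>On the range \<open>[a, b]\<close> of \<open>\<omega>\<close> the rearrangement is a generalised inverse of \<open>\<Phi>/\<pi>\<close>.\<close>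

locale rearrangement =
  fixes \<phi> :: "real \<Rightarrow> real" and p :: nat and a b :: real
  assumes \<phi>: "\<phi> \<in> C01" and Rg: "Rg_omega \<phi> p = {a..b}" and ab: "a \<le> b"
begin

abbreviation "\<Phi> \<equiv> sublevel_measure \<phi> p"
abbreviation "\<xi> \<equiv> xi \<phi> p"

lemma xi_eq: "0 < x \<Longrightarrow> x < 1 \<Longrightarrow> \<xi> x = Inf {y \<in> {a..b}. \<Phi> y > pi * x}"
  unfolding xi_def xi_open_def Rg sublevel_measure_def by simp

lemma full_measure: "\<Phi> b = pi"
proof -
  have "{z \<in> omega_dom. omega \<phi> p z \<le> b} = omega_dom"
    using Rg unfolding Rg_omega_def by auto
  then show ?thesis unfolding sublevel_measure_def by (simp add: measure_omega_dom)
qed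

lemma b_mem: "x < 1 \<Longrightarrow> b \<in> {y \<in> {a..b}. \<Phi> y > pi * x}"
  using ab full_measure by simp

lemma xi_le: "0 < x \<Longrightarrow> x < 1 \<Longrightarrow> y \<in> {a..b} \<Longrightarrow> pi * x < \<Phi> y \<Longrightarrow> \<xi> x \<le> y"
  unfolding xi_eq by (intro cInf_lower bdd_belowI[of _ a]) auto

lemma xi_ge:
  assumes "0 < x" "x < 1" "\<And>y. y \<in> {a..b} \<Longrightarrow> pi * x < \<Phi> y \<Longrightarrow> c \<le> y"
  shows "c \<le> \<xi> x"
  unfolding xi_eq[OF assms(1,2)] using b_mem[OF assms(2)] assms(3) by (intro cInf_greatest) auto

lemma xi_range: "0 < x \<Longrightarrow> x < 1 \<Longrightarrow> \<xi> x \<in> {a..b}"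
  using xi_le[of x b] xi_ge[of x a] b_mem[of x] by auto

lemma xi_mono:
  assumes "0 < x" "x \<le> x'" "x' < 1"
  shows "\<xi> x \<le> \<xi> x'"
proof (rule xi_ge)
  fix y assume y: "y \<in> {a..b}" "pi * x' < \<Phi> y"
  have "pi * x \<le> pi * x'" using assms(2) by simp
  then have "pi * x < \<Phi> y" using y by linarith
  then show "\<xi> x \<le> y" using y assms by (intro xi_le) auto
qed (use assms in auto)

text \<open>A jump of \<open>\<xi>\<close> from the left would be an interval of levels on which \<open>\<Phi>\<close> is constant.\<close>

lemma xi_left_continuous:
  assumes x: "0 < x" "x < 1" and d: "0 < \<delta>"
  shows "\<exists>s. 0 < s \<and> s < x \<and> \<xi> x - \<delta> \<le> \<xi> s"
proof -
  have R: "\<xi> x \<in> {a..b}" using xi_range[OF x] .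
  show ?thesis
  proof (cases "\<xi> x - \<delta> \<le> a")
    case True
    have "\<xi> (x / 2) \<in> {a..b}" using x by (intro xi_range) auto
    then show ?thesis using True x by (intro exI[of _ "x / 2"]) auto
  next
    case False
    define y where "y = \<xi> x - \<delta> / 3" 
    define y2 where "y2 = \<xi> x - \<delta> / 2" 
    define y1 where "y1 = \<xi> x - \<delta>" 
    have y: "y1 < y2" "y2 < y" "y < \<xi> x" "y2 \<in> {a..b}" "y \<in> {a..b}" "y1 \<in> {a..b}"
      using d False R by (auto simp: y_def y1_def y2_def)
    have lt: "\<Phi> y1 < \<Phi> y" using y Rg by (intro sublevel_measure_strict[OF \<phi>, of _ y2]) auto
    have "\<not> pi * x < \<Phi> y" using xi_le[OF x y(5)] y(3) by auto
    then have "\<Phi> y1 < pi * x" using lt by simp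
    then have "max 0 (\<Phi> y1 / pi) < x" using x by (simp add: pos_divide_less_eq mult.commute)
    then obtain s where s: "max 0 (\<Phi> y1 / pi) < s" "s < x" using dense by blast
    then have s': "\<Phi> y1 < pi * s" by (simp add: pos_divide_less_eq mult.commute)
    have "y1 \<le> \<xi> s"
    proof (rule xi_ge)
      fix y' assume "y' \<in> {a..b}" "pi * s < \<Phi> y'"
      then have "\<Phi> y1 < \<Phi> y'" using s' by simp
      then show "y1 \<le> y'" using sublevel_measure_mono[OF \<phi>, of y' y1 p] by linarith
    qed (use s x in auto)
    then show ?thesis using s unfolding y1_def by auto
  qed
qed

text \<open>Any level above \<open>\<xi> x\<close> has \<open>\<Phi> > \<pi> x\<close>, which persists for arguments slightly larger than \<open>x\<close>.\<close>

lemma xi_right_continuous: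
  assumes x: "0 < x" "x < 1" and d: "0 < \<delta>"
  shows "\<exists>s. x < s \<and> s < 1 \<and> \<xi> s \<le> \<xi> x + \<delta>"
proof -
  have R: "\<xi> x \<in> {a..b}" using xi_range[OF x] .
  show ?thesis
  proof (cases "b \<le> \<xi> x + \<delta>")
    case True
    have "\<xi> ((x + 1) / 2) \<in> {a..b}" using x by (intro xi_range) auto
    then show ?thesis using True x by (intro exI[of _ "(x + 1) / 2"]) auto
  next
    case False
    define y where "y = \<xi> x + \<delta>"
    have y: "y \<in> {a..b}" using R d False by (auto simp: y_def)
    have "pi * x < \<Phi> y"
    proof (rule ccontr)
      assume neg: "\<not> pi * x < \<Phi> y"
      have "y \<le> \<xi> x"
      proof (rule xi_ge[OF x])
        fix y' assume "y' \<in> {a..b}" "pi * x < \<Phi> y'"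
        then show "y \<le> y'" using neg sublevel_measure_mono[OF \<phi>, of y' y p] by linarith
      qed
      then show False using d by (simp add: y_def)
    qed
    then have "x < min 1 (\<Phi> y / pi)" using x by (simp add: pos_less_divide_eq mult.commute)
    then obtain s where s: "x < s" "s < min 1 (\<Phi> y / pi)" using dense by blast
    then have "pi * s < \<Phi> y" by (simp add: pos_less_divide_eq mult.commute)
    then have "\<xi> s \<le> y" using s x y by (intro xi_le) auto
    then show ?thesis using s unfolding y_def by auto
  qed
qed

text \<open>A level below the maximum of \<open>\<omega>\<close> is exceeded on a set of positive measure.\<close>

lemma xi_sup:
  assumes d: "0 < \<delta>"
  shows "\<exists>s. 0 < s \<and> s < 1 \<and> b - \<delta> \<le> \<xi> s"
proof -
  define y1 where "y1 = b - \<delta>"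
  have lt: "\<Phi> y1 < pi"
  proof (cases "a \<le> b - \<delta> / 2")
    case True
    have "\<Phi> y1 < \<Phi> b"
      using True d Rg by (intro sublevel_measure_strict[OF \<phi>, of _ "b - \<delta> / 2"]) (auto simp: y1_def)
    then show ?thesis using full_measure by simp
  next
    case False
    have "{z \<in> omega_dom. omega \<phi> p z \<le> y1} = {}"
    proof -
      have "y1 < omega \<phi> p z" if "z \<in> omega_dom" for z
      proof -
        have "omega \<phi> p z \<in> {a..b}" using that Rg unfolding Rg_omega_def by blast
        then show ?thesis using False d ab by (simp add: y1_def)
      qed
      then show ?thesis by (auto simp: not_le[symmetric])
    qed
    then show ?thesis unfolding sublevel_measure_def by (simp only: measure_empty pi_gt_zero)
  qed
  then have "max 0 (\<Phi> y1 / pi) < 1" by simp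
  then obtain s where s: "max 0 (\<Phi> y1 / pi) < s" "s < 1" using dense by blast
  then have s': "\<Phi> y1 < pi * s" by (simp add: pos_divide_less_eq mult.commute)
  have "y1 \<le> \<xi> s"
  proof (rule xi_ge)
    fix y' assume "y' \<in> {a..b}" "pi * s < \<Phi> y'"
    then have "\<Phi> y1 < \<Phi> y'" using s' by simp
    then show "y1 \<le> y'" using sublevel_measure_mono[OF \<phi>, of y' y1 p] by linarith
  qed (use s in auto)
  then show ?thesis using s unfolding y1_def by auto
qed

end

section \<open>From quantiles to the weighted gap\<close>

lemma sqrt_diff_le:
  assumes "0 \<le> x" "0 \<le> y" "\<bar>x - y\<bar> \<le> \<kappa>\<^sup>2" "0 \<le> \<kappa>"
  shows "\<bar>sqrt x - sqrt y\<bar> \<le> \<kappa>"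
proof -
  have aux: "sqrt u - sqrt v \<le> \<kappa>" if "0 \<le> v" "u \<le> v + \<kappa>\<^sup>2" for u v
  proof -
    have "0 \<le> 2 * sqrt v * \<kappa>" using that assms(4) by simp
    moreover have "(sqrt v + \<kappa>)\<^sup>2 = v + \<kappa>\<^sup>2 + 2 * sqrt v * \<kappa>"
      using that by (simp add: power2_sum)
    ultimately have "u \<le> (sqrt v + \<kappa>)\<^sup>2" using that by linarith
    then have "sqrt u \<le> sqrt v + \<kappa>" using that assms(4) by (intro real_le_lsqrt) auto
    then show ?thesis by simp
  qed
  show ?thesis using aux[of y x] aux[of x y] assms by (auto simp: abs_le_iff)
qed

text \<open>A continuous function with compact support that is \<open>1\<close> on \<open>[A + 1, u]\<close> and \<open>0\<close> from \<open>v\<close> on.\<close>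

definition trapezoid :: "real \<Rightarrow> real \<Rightarrow> real \<Rightarrow> real \<Rightarrow> real" where
  "trapezoid A u v y = max 0 (min 1 (min ((v - y) / (v - u)) (y - A)))"

lemma trapezoid_bounds: "0 \<le> trapezoid A u v y" "trapezoid A u v y \<le> 1"
  unfolding trapezoid_def by auto

lemma trapezoid_eq_1: "u < v \<Longrightarrow> A + 1 \<le> y \<Longrightarrow> y \<le> u \<Longrightarrow> trapezoid A u v y = 1"
  unfolding trapezoid_def by (simp add: max_def min_def field_simps)

lemma trapezoid_eq_0: "u < v \<Longrightarrow> v \<le> y \<Longrightarrow> trapezoid A u v y = 0"
proof -
  assume "u < v" "v \<le> y"
  then have "(v - y) / (v - u) \<le> 0" by (intro divide_nonpos_pos) auto
  then show ?thesis unfolding trapezoid_def by (simp add: max_def min_def)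
qed

lemma trapezoid_test_function:
  assumes "u < v"
  shows "continuous_on UNIV (trapezoid A u v)" "compact (closure {y. trapezoid A u v y \<noteq> 0})"
proof -
  show "continuous_on UNIV (trapezoid A u v)"
    unfolding trapezoid_def[abs_def] using assms by (auto intro!: continuous_intros)
  have "{y. trapezoid A u v y \<noteq> 0} \<subseteq> {A..v}"
  proof
    fix y assume y: "y \<in> {y. trapezoid A u v y \<noteq> 0}"
    then have "\<not> v \<le> y" using trapezoid_eq_0[OF assms] by blast
    moreover have "\<not> y \<le> A" 
    proof
      assume "y \<le> A"
      then have "min 1 (min ((v - y) / (v - u)) (y - A)) \<le> 0" by (simp add: min_le_iff_disj)
      then show False using y by (simp add: trapezoid_def)
    qed
    ultimately show "y \<in> {A..v}" by auto
  qed
  then have "bounded {y. trapezoid A u v y \<noteq> 0}" by (rule bounded_subset[OF bounded_closed_interval])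
  then show "compact (closure {y. trapezoid A u v y \<noteq> 0})" by (simp add: compact_closure)
qed

text \<open>What the rest of the argument uses of the eigenvalues: their distribution, their order, and
  \<open>\<lambda>\<^sub>k = (k \<pi>)\<^sup>2 (1 + o(1))\<close> as \<open>k/n\<close> tends to \<open>0\<close>.\<close>

locale eigenvalue_asymptotics = rearrangement +
  assumes p: "p \<ge> 1"
    and distribution: "sim_lambda_xi \<phi> p"
    and sorted_eigval: "\<forall>\<^sub>F n in sequentially. \<forall>k l. 1 \<le> k \<and> k \<le> l \<and> l \<le> sysdim p n \<longrightarrow>
      eigval \<phi> p n k \<le> eigval \<phi> p n l"
    and eigval_ge: "\<forall>\<^sub>F n in sequentially. \<forall>k. 1 \<le> k \<and> k \<le> sysdim p n \<longrightarrow> (real k * pi)\<^sup>2 \<le> eigval \<phi> p n k"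
    and eigval_le: "\<And>\<eta>. 0 < \<eta> \<Longrightarrow> \<exists>\<epsilon>>0. \<forall>\<^sub>F n in sequentially. \<forall>k. 1 \<le> k \<and> real k \<le> \<epsilon> * real n \<longrightarrow>
      k \<le> sysdim p n \<and> eigval \<phi> p n k \<le> (real k * pi)\<^sup>2 * (1 + \<eta>)"
begin

abbreviation "N n \<equiv> sysdim p n"
abbreviation "I n \<equiv> non_outlier_idx \<phi> p n"
abbreviation "\<mu> n k \<equiv> eigval \<phi> p n k / (real n)\<^sup>2"

lemma continuous_on_xi: "continuous_on {0<..<1} \<xi>"
proof (rule continuous_at_imp_continuous_on, rule ballI)
  fix x :: real assume x: "x \<in> {0<..<1}"
  show "isCont \<xi> x"
    unfolding continuous_at_eps_delta
  proof (intro allI impI)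
    fix e :: real assume e: "0 < e"
    obtain s1 where s1: "0 < s1" "s1 < x" "\<xi> x - e / 2 \<le> \<xi> s1"
      using xi_left_continuous[of x "e / 2"] x e by auto
    obtain s2 where s2: "x < s2" "s2 < 1" "\<xi> s2 \<le> \<xi> x + e / 2"
      using xi_right_continuous[of x "e / 2"] x e by auto
    have "dist (\<xi> y) (\<xi> x) < e" if "dist y x < min (x - s1) (s2 - x)" for y
    proof -
      have y: "s1 \<le> y" "y \<le> s2" using that by (auto simp: dist_real_def)
      have "\<xi> s1 \<le> \<xi> y" "\<xi> y \<le> \<xi> s2" using y s1 s2 by (auto intro!: xi_mono)
      then show ?thesis using s1 s2 e by (auto simp: dist_real_def)
    qed
    then show "\<exists>d>0. \<forall>y. dist y x < d \<longrightarrow> dist (\<xi> y) (\<xi> x) < e"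
      using s1 s2 by (intro exI[of _ "min (x - s1) (s2 - x)"]) auto
  qed
qed

lemma trapezoid_xi_integrable:
  assumes "u < v"
  shows "(\<lambda>x. trapezoid A u v (\<xi> x)) integrable_on {0..1}"
proof -
  have c: "continuous_on {0<..<1} (\<lambda>x. trapezoid A u v (\<xi> x))"
    by (rule continuous_on_compose2[OF trapezoid_test_function(1)[OF assms] continuous_on_xi]) auto
  have "(\<lambda>x. trapezoid A u v (\<xi> x)) integrable_on {0<..<1}"
    by (rule measurable_bounded_by_integrable_imp_integrable_real[where g = "\<lambda>_. 1"])
      (auto intro!: continuous_imp_measurable_on_sets_lebesgue c integrable_on_const simp: trapezoid_bounds)
  then show ?thesis using integrable_on_open_interval[of "\<lambda>x. trapezoid A u v (\<xi> x)" "0 :: real" 1] by (simp add: box_real)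
qed

lemma trapezoid_mean_tendsto:
  assumes "u < v"
  shows "(\<lambda>n. 1 / real (N n) * (\<Sum>k = 1..N n. trapezoid A u v (\<mu> n k)))
    \<longlonglongrightarrow> integral {0..1} (\<lambda>x. trapezoid A u v (\<xi> x))"
  using distribution trapezoid_test_function[OF assms] unfolding sim_lambda_xi_def by blast

lemma large_n: "\<forall>\<^sub>F n in sequentially. real n \<ge> c \<and> n \<ge> 2 \<and> real (N n) + 1 = real n + real p - 1 \<and> N n \<ge> 1"
proof -
  have "\<forall>\<^sub>F n in sequentially. n \<ge> nat \<lceil>c\<rceil> + 2" by (rule eventually_ge_at_top)
  then show ?thesis
  proof eventually_elim
    case (elim n)
    have "real n \<ge> c" using elim by linarith
    then show ?case using elim p by (auto simp: sysdim_def of_nat_diff)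
  qed
qed

text \<open>If the \<open>k\<close>-th eigenvalue were small, so would be all earlier ones, a fraction of at least \<open>t\<close>; but
  the fraction of eigenvalues below \<open>\<xi> t - \<delta>\<close> is less than \<open>t\<close> for large \<open>n\<close>, since \<open>\<xi>\<close> is continuous
  from the left.\<close>

lemma quantile_lower:
  assumes t: "0 < t" "t < 1" and \<delta>: "0 < \<delta>"
  shows "\<forall>\<^sub>F n in sequentially. \<forall>k. 1 \<le> k \<and> k \<le> N n \<and> t * (real (N n) + 1) \<le> real k \<longrightarrow> \<xi> t - \<delta> \<le> \<mu> n k"
proof -
  define u v where "u = \<xi> t - \<delta>" and "v = \<xi> t - \<delta> / 2"
  (* The plateau of the test function starts at 0, below all eigenvalues. *)
  define A where "A = (- 1 :: real)"
  have uv: "u < v" using \<delta> by (simp add: u_def v_def)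
  obtain s where s: "0 < s" "s < t" "v \<le> \<xi> s"
    using xi_left_continuous[of t "\<delta> / 2"] t \<delta> unfolding v_def by auto
  let ?F = "\<lambda>x. trapezoid A u v (\<xi> x)"
  have int: "?F integrable_on {0..1}" by (rule trapezoid_xi_integrable[OF uv])
  have "integral {0..1} ?F = integral {0..s} ?F + integral {s..1} ?F"
    using int s t by (intro Henstock_Kurzweil_Integration.integral_combine[symmetric]) auto
  also have "integral {s..1} ?F = integral {s..1} (\<lambda>x. 0)"
  proof (rule integral_spike[of "{1}"])
    fix x assume "x \<in> {s..1} - {1}"
    then have "v \<le> \<xi> x" using xi_mono[of s x] s by auto
    then show "0 = ?F x" using trapezoid_eq_0[OF uv] by simp
  qed simp
  also have "integral {0..s} ?F \<le> integral {0..s} (\<lambda>x. 1)"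
    using s t by (intro integral_le integrable_subinterval_real[OF int]) (auto simp: trapezoid_bounds)
  finally have "integral {0..1} ?F \<le> s" using s by simp
  then have "integral {0..1} ?F < t" using s by simp
  with trapezoid_mean_tendsto[OF uv, of A]
  have "\<forall>\<^sub>F n in sequentially. 1 / real (N n) * (\<Sum>k = 1..N n. trapezoid A u v (\<mu> n k)) < t"
    by (rule order_tendstoD(2))
  then show ?thesis using large_n[of 0] sorted_eigval eigval_ge
  proof eventually_elim
    case (elim n)
    show ?case
    proof (intro allI impI, rule ccontr)
      fix k assume k: "1 \<le> k \<and> k \<le> N n \<and> t * (real (N n) + 1) \<le> real k" and neg: "\<not> \<xi> t - \<delta> \<le> \<mu> n k"
      have n: "n > 0" "real (N n) > 0" using elim by auto
      have "trapezoid A u v (\<mu> n j) = 1" if j: "j \<in> {1..k}" for j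
      proof (rule trapezoid_eq_1[OF uv])
        have jN: "1 \<le> j \<and> j \<le> N n" using j k by auto
        have "0 \<le> eigval \<phi> p n j"
          using elim(4)[rule_format, OF jN] by (meson order_trans zero_le_power2)
        then show "A + 1 \<le> \<mu> n j" by (simp add: A_def)
        have "\<mu> n j \<le> \<mu> n k" using elim(3) j k by (intro divide_right_mono) auto
        then show "\<mu> n j \<le> u" using neg by (simp add: u_def)
      qed
      then have "real k = (\<Sum>j = 1..k. trapezoid A u v (\<mu> n j))" by simp
      also have "\<dots> \<le> (\<Sum>j = 1..N n. trapezoid A u v (\<mu> n j))"
        using k by (intro sum_mono2) (auto simp: trapezoid_bounds)
      also have "\<dots> < t * real (N n)" using elim(1) n by (simp add: field_simps)
      finally show False using k t by (simp add: distrib_left)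
    qed
  qed
qed

text \<open>Dual to the previous argument, with continuity from the right.\<close>

lemma quantile_upper:
  assumes t: "0 < t" "t < 1" and \<delta>: "0 < \<delta>"
  shows "\<forall>\<^sub>F n in sequentially. \<forall>k. 1 \<le> k \<and> k \<le> N n \<and> real k \<le> t * (real (N n) + 1) \<longrightarrow> \<mu> n k \<le> \<xi> t + \<delta>"
proof -
  define u v where "u = \<xi> t + \<delta> / 2" and "v = \<xi> t + \<delta>"
  (* The plateau of the test function starts at the minimum of the rearrangement. *)
  define A where "A = a - 1"
  have uv: "u < v" using \<delta> by (simp add: u_def v_def)
  obtain s where s: "t < s" "s < 1" "\<xi> s \<le> u"
    using xi_right_continuous[of t "\<delta> / 2"] t \<delta> unfolding u_def by auto
  let ?F = "\<lambda>x. trapezoid A u v (\<xi> x)"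
  have int: "?F integrable_on {0..1}" by (rule trapezoid_xi_integrable[OF uv])
  have "s = integral {0..s} (\<lambda>x. 1)" using s t by simp
  also have "\<dots> = integral {0..s} ?F"
  proof (rule integral_spike[of "{0}"])
    fix x assume "x \<in> {0..s} - {0}"
    then have "\<xi> x \<le> u" "a \<le> \<xi> x" using xi_mono[of x s] xi_range[of x] s by auto
    then show "?F x = 1" using trapezoid_eq_1[OF uv] by (simp add: A_def)
  qed simp
  also have "\<dots> \<le> integral {0..s} ?F + integral {s..1} ?F"
    using s t by (simp, intro integral_nonneg integrable_subinterval_real[OF int]) (auto simp: trapezoid_bounds)
  also have "\<dots> = integral {0..1} ?F"
    using int s t by (intro Henstock_Kurzweil_Integration.integral_combine) auto
  finally have "s \<le> integral {0..1} ?F" .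
  define s' where "s' = (s + t) / 2"
  have s': "t < s'" "s' < integral {0..1} ?F" using s \<open>s \<le> integral {0..1} ?F\<close> by (auto simp: s'_def)
  with trapezoid_mean_tendsto[OF uv, of A]
  have "\<forall>\<^sub>F n in sequentially. s' < 1 / real (N n) * (\<Sum>k = 1..N n. trapezoid A u v (\<mu> n k))"
    by (intro order_tendstoD(1))
  then show ?thesis using large_n[of "1 + t / (s' - t)"] sorted_eigval
  proof eventually_elim
    case (elim n)
    show ?case
    proof (intro allI impI, rule ccontr)
      fix k assume k: "1 \<le> k \<and> k \<le> N n \<and> real k \<le> t * (real (N n) + 1)" and neg: "\<not> \<mu> n k \<le> \<xi> t + \<delta>"
      have n: "n > 0" "real (N n) > 0" using elim by auto
      have z: "trapezoid A u v (\<mu> n j) = 0" if j: "j \<in> {1..N n} - {1..k}" for j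
      proof (rule trapezoid_eq_0[OF uv])
        have "\<mu> n k \<le> \<mu> n j" using elim(3) j k by (intro divide_right_mono) auto
        then show "v \<le> \<mu> n j" using neg by (simp add: v_def)
      qed
      have "s' * real (N n) < (\<Sum>j = 1..N n. trapezoid A u v (\<mu> n j))"
        using elim(1) n by (simp add: field_simps)
      also have "\<dots> = (\<Sum>j = 1..k. trapezoid A u v (\<mu> n j))"
        using k z by (intro sum.mono_neutral_right) auto
      also have "\<dots> \<le> (\<Sum>j = 1..k. 1)" by (intro sum_mono trapezoid_bounds)
      also have "\<dots> \<le> t * (real (N n) + 1)" using k by simp
      finally have "(s' - t) * real (N n) < t" by (simp add: algebra_simps)
      moreover have "t / (s' - t) \<le> real (N n)" using elim(2) p by linarith
      then have "t \<le> (s' - t) * real (N n)" using s' by (simp add: pos_divide_le_eq mult.commute)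
      ultimately show False by simp
    qed
  qed
qed

text \<open>The quantiles transfer the eigenvalue bounds to \<open>\<xi>\<close>: for fixed \<open>t\<close> the index \<open>k\<close> with \<open>k/(N + 1)\<close>
  next to \<open>t\<close> has \<open>\<lambda>\<^sub>k/n\<^sup>2\<close> near \<open>\<xi> t\<close> and, in the limit, at least \<open>(\<pi> t)\<^sup>2\<close>. So the behaviour of \<open>\<xi>\<close> at
  \<open>0\<close> follows without an expansion of the symbol.\<close>

lemma xi_ge_square:
  assumes t: "0 < t" "t < 1"
  shows "(pi * t)\<^sup>2 \<le> \<xi> t"
proof (rule field_le_epsilon)
  fix \<delta> :: real assume \<delta>: "0 < \<delta>"
  have "\<forall>\<^sub>F n in sequentially. (pi * (t - 1 / real n))\<^sup>2 \<le> \<xi> t + \<delta>"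
    using quantile_upper[OF t \<delta>] eigval_ge large_n[of "2 / t"]
  proof eventually_elim
    case (elim n)
    define k where "k = nat \<lfloor>t * (real (N n) + 1)\<rfloor>"
    have n: "real n > 0" using elim by auto
    have tn: "2 \<le> t * real n" using elim(3) t by (simp add: pos_divide_le_eq mult.commute)
    have "t * real n \<le> t * (real (N n) + 1)" using elim(3) p t by (intro mult_left_mono) auto
    then have k: "real k \<le> t * (real (N n) + 1)" "t * real n - 1 < real k" "1 \<le> k"
      using tn unfolding k_def by linarith+
    have "t * (real (N n) + 1) < real (N n) + 1" using t by simp
    then have "k \<le> N n" using k by linarith
    then have "(real k * pi)\<^sup>2 \<le> eigval \<phi> p n k" and up: "\<mu> n k \<le> \<xi> t + \<delta>"
      using elim(1)[rule_format, of k] elim(2)[rule_format, of k] k by blast+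
    then have "(real k * pi)\<^sup>2 / (real n)\<^sup>2 \<le> \<mu> n k" by (intro divide_right_mono) auto
    moreover have "(pi * (t - 1 / real n))\<^sup>2 \<le> (real k * pi / real n)\<^sup>2"
    proof (intro power_mono)
      have "t - 1 / real n = (t * real n - 1) / real n" using n by (simp add: field_simps)
      also have "\<dots> \<le> real k / real n" using k by (intro divide_right_mono) auto
      finally have "t - 1 / real n \<le> real k / real n" .
      then show "pi * (t - 1 / real n) \<le> real k * pi / real n"
        using mult_left_mono[of "t - 1 / real n" "real k / real n" pi] by (simp add: mult.commute)
      show "0 \<le> pi * (t - 1 / real n)" using tn n by (simp add: field_simps)
    qed
    ultimately show ?case using up by (simp add: power_divide)
  qed
  moreover have "(\<lambda>n. (pi * (t - 1 / real n))\<^sup>2) \<longlonglongrightarrow> (pi * (t - 0))\<^sup>2"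
    by (intro tendsto_intros lim_1_over_n)
  ultimately show "(pi * t)\<^sup>2 \<le> \<xi> t + \<delta>" by (intro tendsto_upperbound) auto
qed

lemma xi_le_square:
  assumes \<eta>: "0 < \<eta>"
  shows "\<exists>\<epsilon>>0. \<forall>t. 0 < t \<and> t < \<epsilon> \<and> t < 1 \<longrightarrow> \<xi> t \<le> (pi * t)\<^sup>2 * (1 + \<eta>)"
proof -
  obtain \<epsilon> where \<epsilon>: "0 < \<epsilon>" and E: "\<forall>\<^sub>F n in sequentially. \<forall>k. 1 \<le> k \<and> real k \<le> \<epsilon> * real n \<longrightarrow>
      k \<le> N n \<and> eigval \<phi> p n k \<le> (real k * pi)\<^sup>2 * (1 + \<eta>)"
    using eigval_le[OF \<eta>] by blast
  have "\<xi> t \<le> (pi * t)\<^sup>2 * (1 + \<eta>)" if t: "0 < t" "t < \<epsilon>" "t < 1" for t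
  proof (rule field_le_epsilon)
    fix \<delta> :: real assume \<delta>: "0 < \<delta>"
    define c where "c = t * real p + 1"
    have "\<forall>\<^sub>F n in sequentially. \<xi> t - \<delta> \<le> (pi * (t + c / real n))\<^sup>2 * (1 + \<eta>)"
      using quantile_lower[OF t(1) t(3) \<delta>] E large_n[of "c / (\<epsilon> - t)"]
    proof eventually_elim
      case (elim n)
      define k where "k = nat \<lceil>t * (real (N n) + 1)\<rceil>"
      have n: "real n > 0" using elim by auto
      have pos: "0 < t * (real (N n) + 1)" using t by simp
      then have k: "t * (real (N n) + 1) \<le> real k" "real k < t * (real (N n) + 1) + 1" "1 \<le> k"
        unfolding k_def by linarith+
      have "t * (real (N n) + 1) + 1 \<le> t * real n + c"
      proof -
        have "real (N n) + 1 = real n + real p - 1" using elim(3) by blast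
        then have "t * (real (N n) + 1) = t * (real n + real p - 1)" by (rule arg_cong)
        also have "\<dots> = t * real n + t * real p - t" by (simp add: algebra_simps)
        finally have "t * (real (N n) + 1) = t * real n + t * real p - t" .
        then show ?thesis using t unfolding c_def by linarith
      qed
      then have kc: "real k \<le> t * real n + c" using k by linarith
      have "c \<le> (\<epsilon> - t) * real n" using elim(3) t by (simp add: pos_divide_le_eq mult.commute)
      then have "real k \<le> \<epsilon> * real n" using kc by (simp add: algebra_simps)
      then have kN: "k \<le> N n" "eigval \<phi> p n k \<le> (real k * pi)\<^sup>2 * (1 + \<eta>)" using elim(2) k by auto
      have "\<xi> t - \<delta> \<le> \<mu> n k" using elim(1) k kN by auto
      also have "\<dots> \<le> (real k * pi)\<^sup>2 * (1 + \<eta>) / (real n)\<^sup>2" using kN by (intro divide_right_mono) auto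
      also have "\<dots> = (pi * (real k / real n))\<^sup>2 * (1 + \<eta>)" by (simp add: power_divide power_mult_distrib)
      also have "\<dots> \<le> (pi * (t + c / real n))\<^sup>2 * (1 + \<eta>)"
      proof (intro mult_right_mono power_mono mult_left_mono)
        show "real k / real n \<le> t + c / real n" using kc n by (simp add: field_simps)
      qed (use \<eta> in auto)
      finally show ?case .
    qed
    moreover have "(\<lambda>n. (pi * (t + c * (1 / real n)))\<^sup>2 * (1 + \<eta>)) \<longlonglongrightarrow> (pi * (t + c * 0))\<^sup>2 * (1 + \<eta>)"
      by (intro tendsto_intros lim_1_over_n)
    ultimately have "\<xi> t - \<delta> \<le> (pi * t)\<^sup>2 * (1 + \<eta>)" by (intro tendsto_lowerbound) auto
    then show "\<xi> t \<le> (pi * t)\<^sup>2 * (1 + \<eta>) + \<delta>" by simp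
  qed
  then show ?thesis using \<epsilon> by blast
qed

lemma a_nonpos: "a \<le> 0"
proof -
  obtain \<epsilon> where \<epsilon>: "0 < \<epsilon>" "\<And>t. 0 < t \<and> t < \<epsilon> \<and> t < 1 \<Longrightarrow> \<xi> t \<le> (pi * t)\<^sup>2 * (1 + 1)"
    using xi_le_square[of 1] by auto
  have "\<forall>\<^sub>F t in at_right 0. a \<le> (pi * t)\<^sup>2 * (1 + 1)"
  proof -
    have "\<forall>\<^sub>F t in at_right 0. t \<in> {0<..<min \<epsilon> 1}"
      using \<epsilon>(1) by (intro eventually_at_right_real) auto
    then show ?thesis
    proof eventually_elim
      case (elim t)
      then show ?case using \<epsilon>(2)[of t] xi_range[of t] by auto
    qed
  qed
  moreover have "((\<lambda>t. (pi * t)\<^sup>2 * (1 + 1)) \<longlongrightarrow> (pi * 0)\<^sup>2 * (1 + 1)) (at_right (0 :: real))"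
    by (intro tendsto_intros)
  ultimately have "a \<le> (pi * 0)\<^sup>2 * (1 + 1)" by (intro tendsto_lowerbound) auto
  then show ?thesis by simp
qed

lemma b_pos: "0 < b"
proof -
  have "(pi * (1 / 2))\<^sup>2 \<le> \<xi> (1 / 2)" by (rule xi_ge_square) auto
  then have "0 < \<xi> (1 / 2)" by (rule less_le_trans[rotated]) simp
  then show ?thesis using xi_range[of "1 / 2"] by auto
qed

text \<open>If the \<open>k\<close>-th eigenvalue lies above the range, then so do all later ones; these alone are enough
  outliers to exclude the index \<open>k\<close>.\<close>

lemma non_outlier_le:
  assumes srt: "\<forall>k l. 1 \<le> k \<and> k \<le> l \<and> l \<le> N n \<longrightarrow> eigval \<phi> p n k \<le> eigval \<phi> p n l"
    and k: "k \<in> I n"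
  shows "1 \<le> k" "k \<le> N n" "\<mu> n k \<le> b"
proof -
  show k': "1 \<le> k" "k \<le> N n" using k unfolding non_outlier_idx_def by auto
  show "\<mu> n k \<le> b"
  proof (rule ccontr)
    assume neg: "\<not> \<mu> n k \<le> b"
    have "{k..N n} \<subseteq> {k \<in> {1..N n}. \<mu> n k \<notin> Rg_omega \<phi> p}"
    proof
      fix j assume j: "j \<in> {k..N n}"
      then have "\<mu> n k \<le> \<mu> n j" using srt k' by (intro divide_right_mono) auto
      then show "j \<in> {k \<in> {1..N n}. \<mu> n k \<notin> Rg_omega \<phi> p}" using neg Rg j k' by auto
    qed
    then have "card {k..N n} \<le> OUT \<phi> p n" unfolding OUT_def by (intro card_mono) auto
    then show False using k k' unfolding non_outlier_idx_def by auto
  qed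
qed

text \<open>The first eigenvalue is positive and tends to \<open>0\<close> after the scaling, so it ends up in the range,
  where \<open>a \<le> 0 < b\<close>.\<close>

lemma non_outlier_idx_nonempty: "\<forall>\<^sub>F n in sequentially. I n \<noteq> {}"
proof -
  obtain \<epsilon> where \<epsilon>: "0 < \<epsilon>" and E: "\<forall>\<^sub>F n in sequentially. \<forall>k. 1 \<le> k \<and> real k \<le> \<epsilon> * real n \<longrightarrow>
      k \<le> N n \<and> eigval \<phi> p n k \<le> (real k * pi)\<^sup>2 * (1 + 1)"
    using eigval_le[of 1] by auto
  have "(\<lambda>n. pi\<^sup>2 * (1 + 1) * (1 / real n)\<^sup>2) \<longlonglongrightarrow> pi\<^sup>2 * (1 + 1) * 0\<^sup>2"
    by (intro tendsto_intros lim_1_over_n)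
  then have "\<forall>\<^sub>F n in sequentially. pi\<^sup>2 * (1 + 1) * (1 / real n)\<^sup>2 < b"
    using b_pos by (intro order_tendstoD(2)) auto
  then show ?thesis using E eigval_ge large_n[of "1 / \<epsilon>"]
  proof eventually_elim
    case (elim n)
    have "1 \<le> \<epsilon> * real n" using elim(4) \<epsilon> by (simp add: pos_divide_le_eq mult.commute)
    then have e1: "eigval \<phi> p n 1 \<le> pi\<^sup>2 * (1 + 1)" using elim(2)[rule_format, of 1] by simp
    have "\<mu> n 1 \<le> pi\<^sup>2 * (1 + 1) / (real n)\<^sup>2" using e1 by (intro divide_right_mono) auto
    also have "\<dots> < b" using elim(1) by (simp add: power_divide)
    finally have "\<mu> n 1 \<le> b" by simp
    moreover have "(real 1 * pi)\<^sup>2 \<le> eigval \<phi> p n 1" using elim(3,4) by blast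
    then have "0 \<le> eigval \<phi> p n 1" by (meson order_trans zero_le_power2)
    then have "a \<le> \<mu> n 1" using a_nonpos by (meson divide_nonneg_nonneg order_trans zero_le_power2)
    ultimately have mem: "\<mu> n 1 \<in> Rg_omega \<phi> p" unfolding Rg by simp
    have "{k \<in> {1..N n}. \<mu> n k \<notin> Rg_omega \<phi> p} \<subseteq> {2..N n}"
    proof
      fix j assume j: "j \<in> {k \<in> {1..N n}. \<mu> n k \<notin> Rg_omega \<phi> p}"
      then have "j \<noteq> 1" using mem by blast
      then show "j \<in> {2..N n}" using j by auto
    qed
    then have "OUT \<phi> p n \<le> card {2..N n}" unfolding OUT_def by (intro card_mono) auto
    then show ?case using elim(4) unfolding non_outlier_idx_def by auto
  qed
qed

abbreviation "pos n k \<equiv> real k / (real (N n) + 1)"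
abbreviation "err n k \<equiv> real n / real k * \<bar>sqrt (\<mu> n k) - sqrt (\<xi> (pos n k))\<bar>"
abbreviation "error_small_near t e \<equiv>
  \<exists>d>0. \<forall>\<^sub>F n in sequentially. \<forall>k\<in>I n. \<bar>pos n k - t\<bar> < d \<longrightarrow> err n k \<le> e"

text \<open>For small indices both terms of the difference are \<open>k\<pi>/n\<close> up to a relative error, so the
  factor \<open>n/k\<close> does no harm.\<close>

lemma error_small_near_0:
  assumes e: "0 < e"
  shows "error_small_near 0 e"
proof -
  define \<eta> where "\<eta> = e / (2 * pi)"
  have \<eta>: "0 < \<eta>" using e by (simp add: \<eta>_def)
  obtain \<epsilon> where \<epsilon>: "0 < \<epsilon>" and E: "\<forall>\<^sub>F n in sequentially. \<forall>k. 1 \<le> k \<and> real k \<le> \<epsilon> * real n \<longrightarrow>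
      k \<le> N n \<and> eigval \<phi> p n k \<le> (real k * pi)\<^sup>2 * (1 + \<eta>)"
    using eigval_le[OF \<eta>] by blast
  obtain \<epsilon>' where \<epsilon>': "0 < \<epsilon>'" "\<And>t. 0 < t \<and> t < \<epsilon>' \<and> t < 1 \<Longrightarrow> \<xi> t \<le> (pi * t)\<^sup>2 * (1 + \<eta>)"
    using xi_le_square[OF \<eta>] by auto
  define d where "d = min (\<epsilon> / 2) (min \<epsilon>' 1)"
  have d: "0 < d" using \<epsilon> \<epsilon>' by (simp add: d_def)
  have "\<forall>\<^sub>F n in sequentially. \<forall>k\<in>I n. \<bar>pos n k - 0\<bar> < d \<longrightarrow> err n k \<le> e"
    using E eigval_ge sorted_eigval large_n[of "max (real p) (2 * pi * real p / e)"]
  proof eventually_elim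
    case (elim n)
    have n: "real n > 0" "real p \<le> real n" "2 * pi * real p / e \<le> real n"
      and N1: "real (N n) + 1 = real n + real p - 1" using elim(4) by auto
    show ?case
    proof (intro ballI impI)
      fix k assume kO: "k \<in> I n" and kd: "\<bar>pos n k - 0\<bar> < d"
      note k = non_outlier_le[OF elim(3) kO]
      define t where "t = pos n k"
      have t: "0 < t" "t < d" using k kd by (auto simp: t_def)
      have tk: "real k = t * (real (N n) + 1)" by (simp add: t_def)
      define x y where "x = real n / real k * sqrt (\<mu> n k)" and "y = real n / real k * sqrt (\<xi> t)"
      define z where "z = real n / (real (N n) + 1)"
      have "real n \<le> real (N n) + 1" using N1 p by simp
      then have z1: "0 < z" "z \<le> 1" using n by (auto simp: z_def)
      have nk: "real n / real k = z / t" using k t by (simp add: z_def t_def)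
      have "real k \<le> \<epsilon> / 2 * (2 * real n)"
        unfolding tk N1 using t n d by (intro mult_mono) (auto simp: d_def)
      then have ev: "(real k * pi)\<^sup>2 \<le> eigval \<phi> p n k" "eigval \<phi> p n k \<le> (real k * pi)\<^sup>2 * (1 + \<eta>)"
        using elim(1,2) k by auto
      have sq: "sqrt (1 + \<eta>) \<le> 1 + \<eta>" using \<eta> by (intro real_le_lsqrt) (auto simp: power2_eq_square algebra_simps)
      have x_eq: "x = sqrt (eigval \<phi> p n k) / real k"
        using n by (simp add: x_def real_sqrt_divide)
      have "real k * pi \<le> sqrt (eigval \<phi> p n k)" using real_sqrt_le_mono[OF ev(1)] by (simp add: abs_mult)
      then have x1: "pi \<le> x" unfolding x_eq using k by (simp add: field_simps)
      have "sqrt (eigval \<phi> p n k) \<le> sqrt ((real k * pi)\<^sup>2 * (1 + \<eta>))" using ev by simp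
      also have "\<dots> = real k * pi * sqrt (1 + \<eta>)" by (simp add: real_sqrt_mult abs_mult)
      also have "\<dots> \<le> real k * pi * (1 + \<eta>)" using sq by (intro mult_left_mono) auto
      finally have x2: "x \<le> pi * (1 + \<eta>)" unfolding x_eq using k by (simp add: field_simps)
      have tt: "0 < t" "t < 1" "t < \<epsilon>'" using t by (auto simp: d_def)
      have "pi * t \<le> sqrt (\<xi> t)"
        using real_sqrt_le_mono[OF xi_ge_square[OF tt(1,2)]] tt by (simp add: abs_mult)
      then have "z / t * (pi * t) \<le> y" unfolding y_def nk using z1 tt by (intro mult_left_mono) auto
      then have y1: "pi * z \<le> y" using tt by (simp add: mult.commute)
      have "sqrt (\<xi> t) \<le> sqrt ((pi * t)\<^sup>2 * (1 + \<eta>))" using \<epsilon>'(2) tt by simp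
      also have "\<dots> = pi * t * sqrt (1 + \<eta>)" using tt by (simp add: real_sqrt_mult abs_mult)
      also have "\<dots> \<le> pi * t * (1 + \<eta>)" using sq tt by (intro mult_left_mono) auto
      finally have "y \<le> z / t * (pi * t * (1 + \<eta>))" unfolding y_def nk using z1 tt by (intro mult_left_mono) auto
      also have "\<dots> = z * (pi * (1 + \<eta>))" using tt by simp
      also have "\<dots> \<le> 1 * (pi * (1 + \<eta>))" using z1 \<eta> by (intro mult_right_mono) auto
      finally have y2: "y \<le> pi * (1 + \<eta>)" by simp
      have "1 - real p / real n \<le> z"
      proof -
        have "(1 - real p / real n) * (real n + real p - 1) \<le> real n"
        proof -
          have "real n * ((1 - real p / real n) * (real n + real p - 1)) = (real n - real p) * (real n + real p - 1)"
            using n by (simp add: field_simps)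
          also have "\<dots> = real n * real n - real n - real p * real p + real p"
            by (simp add: algebra_simps)
          also have "\<dots> \<le> real n * real n"
            using n(2) zero_le_square[of "real p"] by linarith
          finally show ?thesis using n by simp
        qed
        then show ?thesis unfolding z_def N1 using n p by (simp add: pos_le_divide_eq)
      qed
      then have "pi * (1 - real p / real n) \<le> pi * z" by (intro mult_left_mono) auto
      then have "pi - pi * (real p / real n) \<le> pi * z" by (simp only: right_diff_distrib mult_1_right)
      moreover have "pi * (real p / real n) \<le> e / 2" using n e by (simp add: field_simps)
      moreover have "pi * (1 + \<eta>) = pi + e / 2" by (simp add: \<eta>_def distrib_left)
      moreover have "pi * z \<le> pi" using z1 by simp
      ultimately have "\<bar>x - y\<bar> \<le> e" using x1 x2 y1 y2 by linarith
      moreover have "err n k = \<bar>x - y\<bar>"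
      proof -
        have "x - y = real n / real k * (sqrt (\<mu> n k) - sqrt (\<xi> t))" by (simp add: x_def y_def right_diff_distrib)
        then show ?thesis unfolding t_def by (simp add: abs_mult)
      qed
      ultimately show "err n k \<le> e" by simp
    qed
  qed
  then show ?thesis using d by blast
qed

text \<open>Away from \<open>0\<close> the factor \<open>n/k\<close> is bounded, and the square root is Hoelder continuous with
  exponent \<open>1/2\<close>.\<close>

lemma error_bound_of_difference:
  assumes t: "0 < t" "t \<le> 2 * \<tau>" and \<tau>: "\<tau> = pos n k"
    and k: "k \<ge> 1" and n: "real n \<le> real (N n) + 1" and e: "0 \<le> e"
    and diff: "\<bar>\<mu> n k - \<xi> \<tau>\<bar> \<le> (e * t / 2)\<^sup>2" and nonneg: "0 \<le> \<mu> n k" "0 \<le> \<xi> \<tau>"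
  shows "err n k \<le> e"
proof -
  have "\<bar>sqrt (\<mu> n k) - sqrt (\<xi> \<tau>)\<bar> \<le> e * t / 2"
    using t e diff nonneg by (intro sqrt_diff_le) auto
  moreover have "real n / real k \<le> 2 / t"
  proof -
    have "t * real n \<le> t * (real (N n) + 1)" using t n by (intro mult_left_mono) auto
    also have "\<dots> \<le> 2 * \<tau> * (real (N n) + 1)" using t by (intro mult_right_mono) auto
    also have "\<dots> = 2 * real k" by (simp add: \<tau>)
    finally show ?thesis using t k by (simp add: field_simps)
  qed
  ultimately have "err n k \<le> 2 / t * (e * t / 2)"
    unfolding \<tau>[symmetric] using t by (intro mult_mono) auto
  also have "\<dots> = e" using t by simp
  finally show ?thesis .
qed

text \<open>Both \<open>\<mu>\<close> and \<open>\<xi>\<close> are squeezed between values of \<open>\<xi>\<close> on the two sides of \<open>t\<close>.\<close>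

lemma error_small_near_interior:
  assumes t: "0 < t" "t < 1" and e: "0 < e"
  shows "error_small_near t e"
proof -
  define \<kappa> where "\<kappa> = (e * t / 2)\<^sup>2"
  have \<kappa>: "0 < \<kappa>" using e t by (simp add: \<kappa>_def)
  obtain s1 where s1: "0 < s1" "s1 < t" "\<xi> t - \<kappa> / 4 \<le> \<xi> s1"
    using xi_left_continuous[of t "\<kappa> / 4"] t \<kappa> by auto
  obtain s2 where s2: "t < s2" "s2 < 1" "\<xi> s2 \<le> \<xi> t + \<kappa> / 4"
    using xi_right_continuous[of t "\<kappa> / 4"] t \<kappa> by auto
  define d where "d = min (t / 2) (min (t - s1) (s2 - t))"
  have d: "0 < d" using s1 s2 t by (simp add: d_def)
  have q1: "\<forall>\<^sub>F n in sequentially. \<forall>k. 1 \<le> k \<and> k \<le> N n \<and> s1 * (real (N n) + 1) \<le> real k \<longrightarrow> \<xi> s1 - \<kappa> / 4 \<le> \<mu> n k"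
    using s1 t \<kappa> by (intro quantile_lower) auto
  have q2: "\<forall>\<^sub>F n in sequentially. \<forall>k. 1 \<le> k \<and> k \<le> N n \<and> real k \<le> s2 * (real (N n) + 1) \<longrightarrow> \<mu> n k \<le> \<xi> s2 + \<kappa> / 4"
    using s2 t \<kappa> by (intro quantile_upper) auto
  have "\<forall>\<^sub>F n in sequentially. \<forall>k\<in>I n. \<bar>pos n k - t\<bar> < d \<longrightarrow> err n k \<le> e"
    using q1 q2 eigval_ge sorted_eigval large_n[of 1]
  proof eventually_elim
    case (elim n)
    show ?case
    proof (intro ballI impI)
      fix k assume kO: "k \<in> I n" and kd: "\<bar>pos n k - t\<bar> < d"
      note k = non_outlier_le[OF elim(4) kO]
      define \<tau> where "\<tau> = pos n k"
      have \<tau>: "s1 < \<tau>" "\<tau> < s2" "t / 2 < \<tau>" 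
      proof -
        have "\<bar>\<tau> - t\<bar> < t / 2" "\<bar>\<tau> - t\<bar> < t - s1" "\<bar>\<tau> - t\<bar> < s2 - t"
          using kd unfolding d_def \<tau>_def[symmetric] by auto
        then show "s1 < \<tau>" "\<tau> < s2" "t / 2 < \<tau>" by linarith+
      qed
      have k1: "s1 * (real (N n) + 1) \<le> real k" "real k \<le> s2 * (real (N n) + 1)"
        using \<tau> by (simp_all add: \<tau>_def field_simps)
      have m: "\<xi> s1 - \<kappa> / 4 \<le> \<mu> n k" "\<mu> n k \<le> \<xi> s2 + \<kappa> / 4" using elim(1,2) k k1 by auto
      have x: "\<xi> s1 \<le> \<xi> \<tau>" "\<xi> \<tau> \<le> \<xi> s2" using \<tau> s1 s2 by (auto intro!: xi_mono)
      have "(real k * pi)\<^sup>2 \<le> eigval \<phi> p n k" using elim(3) k by blast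
      then have "0 \<le> eigval \<phi> p n k" by (meson order_trans zero_le_power2)
      moreover have "0 \<le> \<xi> \<tau>" using xi_ge_square[of \<tau>] \<tau> s1 s2 by (meson order.trans order_less_trans zero_le_power2)
      moreover have "\<bar>\<mu> n k - \<xi> \<tau>\<bar> \<le> \<kappa>" using m x s1(3) s2(3) \<kappa> by linarith
      moreover have "real n \<le> real (N n) + 1" using elim(5) p by linarith
      ultimately show "err n k \<le> e"
        using t e k(1) \<tau>(3) by (intro error_bound_of_difference[OF t(1) _ \<tau>_def]) (simp_all add: \<kappa>_def)
    qed
  qed
  then show ?thesis using d by blast
qed

text \<open>At the right end there is no quantile above; the maximum of \<open>\<omega>\<close> bounds the eigenvalues that are
  not outliers, and the supremum of \<open>\<xi>\<close> is that maximum.\<close>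

lemma error_small_near_1:
  assumes e: "0 < e"
  shows "error_small_near 1 e"
proof -
  define \<kappa> where "\<kappa> = (e * 1 / 2)\<^sup>2"
  have \<kappa>: "0 < \<kappa>" using e by (simp add: \<kappa>_def)
  obtain s where s: "0 < s" "s < 1" "b - \<kappa> / 2 \<le> \<xi> s"
    using xi_sup[of "\<kappa> / 2"] \<kappa> by auto
  define d where "d = min (1 / 2) (1 - s)"
  have d: "0 < d" using s by (simp add: d_def)
  have q1: "\<forall>\<^sub>F n in sequentially. \<forall>k. 1 \<le> k \<and> k \<le> N n \<and> s * (real (N n) + 1) \<le> real k \<longrightarrow> \<xi> s - \<kappa> / 2 \<le> \<mu> n k"
    using s \<kappa> by (intro quantile_lower) auto
  have "\<forall>\<^sub>F n in sequentially. \<forall>k\<in>I n. \<bar>pos n k - 1\<bar> < d \<longrightarrow> err n k \<le> e"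
    using q1 eigval_ge sorted_eigval large_n[of 1]
  proof eventually_elim
    case (elim n)
    show ?case
    proof (intro ballI impI)
      fix k assume kO: "k \<in> I n" and kd: "\<bar>pos n k - 1\<bar> < d"
      note k = non_outlier_le[OF elim(3) kO]
      define \<tau> where "\<tau> = pos n k"
      have \<tau>: "s < \<tau>" "1 / 2 < \<tau>" 
      proof -
        have "\<bar>\<tau> - 1\<bar> < 1 / 2" "\<bar>\<tau> - 1\<bar> < 1 - s"
          using kd unfolding d_def \<tau>_def[symmetric] by auto
        then show "s < \<tau>" "1 / 2 < \<tau>" by linarith+
      qed
      have \<tau>1: "\<tau> < 1" using k by (simp add: \<tau>_def)
      have k1: "s * (real (N n) + 1) \<le> real k"
        using \<tau> by (simp add: \<tau>_def field_simps)
      have m: "\<xi> s - \<kappa> / 2 \<le> \<mu> n k" using elim(1) k k1 by auto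
      have x: "\<xi> s \<le> \<xi> \<tau>" "\<xi> \<tau> \<le> b" using \<tau> s \<tau>1 xi_range[of \<tau>] by (auto intro!: xi_mono)
      have "(real k * pi)\<^sup>2 \<le> eigval \<phi> p n k" using elim(2) k by blast
      then have "0 \<le> eigval \<phi> p n k" by (meson order_trans zero_le_power2)
      moreover have "0 \<le> \<xi> \<tau>" using xi_ge_square[of \<tau>] \<tau> s \<tau>1 by (meson order.trans order_less_trans zero_le_power2)
      moreover have "\<bar>\<mu> n k - \<xi> \<tau>\<bar> \<le> \<kappa>" using m x s(3) k(3) \<kappa> by linarith
      moreover have "real n \<le> real (N n) + 1" using elim(4) p by linarith
      ultimately show "err n k \<le> e"
        using e k(1) \<tau>(2) by (intro error_bound_of_difference[of 1, OF _ _ \<tau>_def]) (simp_all add: \<kappa>_def)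
    qed
  qed
  then show ?thesis using d by blast
qed

text \<open>Compactness of \<open>[0, 1]\<close> makes the local statements uniform.\<close>

lemma error_uniformly_small:
  assumes e: "0 < e"
  shows "\<forall>\<^sub>F n in sequentially. \<forall>k\<in>I n. err n k \<le> e"
proof -
  define P where "P t d \<longleftrightarrow> 0 < d \<and> (\<forall>\<^sub>F n in sequentially. \<forall>k\<in>I n.
     \<bar>pos n k - t\<bar> < d \<longrightarrow> err n k \<le> e)" for t d
  have "\<exists>d. P t d" if "t \<in> {0..1}" for t
  proof -
    consider "t = 0" | "t = 1" | "0 < t" "t < 1" using \<open>t \<in> {0..1}\<close> by fastforce
    then show ?thesis
      by cases (use error_small_near_0[OF e] error_small_near_1[OF e] error_small_near_interior[of t e] e in
        \<open>auto simp: P_def\<close>)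
  qed
  then obtain d where d: "\<And>t. t \<in> {0..1} \<Longrightarrow> P t (d t)" by metis
  obtain T where T: "T \<subseteq> {0..1}" "finite T" "{0..1 :: real} \<subseteq> (\<Union>t\<in>T. ball t (d t))"
  proof (rule compactE_image[of "{0..1 :: real}" "{0..1}" "\<lambda>t. ball t (d t)"])
    show "{0..1} \<subseteq> (\<Union>t\<in>{0..1}. ball t (d t))"
    proof
      fix t :: real assume "t \<in> {0..1}"
      then show "t \<in> (\<Union>t\<in>{0..1}. ball t (d t))" using d[of t] by (intro UN_I[of t]) (auto simp: P_def)
    qed
  qed auto
  have "\<forall>\<^sub>F n in sequentially. \<forall>t\<in>T. \<forall>k\<in>I n. \<bar>pos n k - t\<bar> < d t \<longrightarrow> err n k \<le> e"
    using T d by (intro eventually_ball_finite) (auto simp: P_def)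
  then show ?thesis
  proof eventually_elim
    case (elim n)
    show ?case
    proof
      fix k assume k: "k \<in> I n"
      then have "k \<le> N n" unfolding non_outlier_idx_def by auto
      then have "pos n k \<in> {0..1}" by simp
      then obtain t where "t \<in> T" "pos n k \<in> ball t (d t)" using T(3) by blast
      then show "err n k \<le> e" using elim k by (auto simp: dist_real_def abs_minus_commute)
    qed
  qed
qed

theorem weighted_gap_tendsto_0:
  "(\<lambda>n. SUP k\<in>I n. err n k) \<longlonglongrightarrow> 0"
proof (rule LIMSEQ_I)
  fix r :: real assume r: "0 < r"
  have "\<forall>\<^sub>F n in sequentially. norm ((SUP k\<in>I n. err n k) - 0) < r"
    using error_uniformly_small[of "r / 2"] r non_outlier_idx_nonempty
  proof (elim eventually_elim2)
    fix n assume le: "\<forall>k\<in>I n. err n k \<le> r / 2" and ne: "I n \<noteq> {}"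
    have fin: "finite (I n)" unfolding non_outlier_idx_def by simp
    obtain k where k: "k \<in> I n" using ne by blast
    have "(SUP k\<in>I n. err n k) \<le> r / 2" using le ne by (intro cSUP_least) auto
    moreover have "0 \<le> (SUP k\<in>I n. err n k)"
      using k fin by (intro cSUP_upper2[OF _ k]) auto
    ultimately show "norm ((SUP k\<in>I n. err n k) - 0) < r" using r by simp
  qed (use r in auto)
  then show "\<exists>no. \<forall>n\<ge>no. norm ((SUP k\<in>I n. err n k) - 0) < r"
    by (simp add: eventually_sequentially)
qed

end

section \<open>The gap between the eigenvalues and the rearrangement\<close>

theorem corollary4p2:
  fixes p :: nat and \<phi> :: "real \<Rightarrow> real"
  assumes "p \<ge> 1"
    and "\<phi> \<in> C01"
    and "sim_lambda_xi \<phi> p"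
  shows "(\<lambda>n. SUP k\<in>non_outlier_idx \<phi> p n.
            real n / real k * \<bar>sqrt (eigval \<phi> p n k / (real n)\<^sup>2)
                               - sqrt (xi \<phi> p (real k / (real (sysdim p n) + 1)))\<bar>) \<longlonglongrightarrow> 0"
proof -
  obtain a b where ab: "Rg_omega \<phi> p = {a..b}" "a \<le> b"
    using Rg_omega_interval[OF assms(2)] .
  have galerkin: "galerkin n p \<phi>" if "2 \<le> n" for n
    using that assms by unfold_locales auto
  have mono: "\<forall>\<^sub>F n in sequentially. \<forall>k l. 1 \<le> k \<and> k \<le> l \<and> l \<le> sysdim p n \<longrightarrow>
      eigval \<phi> p n k \<le> eigval \<phi> p n l"
    using eventually_ge_at_top[of 2] by eventually_elim (use galerkin.eigval_mono[OF galerkin] in blast)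
  have lower: "\<forall>\<^sub>F n in sequentially. \<forall>k. 1 \<le> k \<and> k \<le> sysdim p n \<longrightarrow>
      (real k * pi)\<^sup>2 \<le> eigval \<phi> p n k"
    using eventually_ge_at_top[of 2] by eventually_elim (use galerkin.eigval_ge_square[OF galerkin] in blast)
  interpret eigenvalue_asymptotics \<phi> p a b
    using assms ab mono lower eigval_le_square_eventually[OF assms(2,1)] by unfold_locales auto
  show ?thesis by (rule weighted_gap_tendsto_0)
qed

end
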